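(* Let $\Gamma$ be a linkage in $\mathbb{R}^d$, let $\Gamma_{\mathrm{op}}^k$ be an open $k$-chain which is a sub-mechanism of $\Gamma$, and let $\Gamma'$ be the complementary sub-mechanism, so that $\mathcal{C}_*(\Gamma)$ is given by the pullback of the work maps $\psi:\mathcal{C}_*(\Gamma')\to\mathbb{R}^d$ and $\phi:\mathcal{C}_*(\Gamma_{\mathrm{op}}^k)\to\mathbb{R}^d$. Then any generically non-transverse configuration $\mathcal{V}=(\mathcal{V}',\mathcal{V}^{(k)})\in\mathcal{C}_*(\Gamma)$ has a neighborhood in $\mathcal{C}_*(\Gamma)$ which is the product of a Euclidean space with a cone on a homogeneous quadratic hypersurface (with $\mathcal{V}$ corresponding to the apex of the cone in the second factor). In particular, $\mathcal{V}$ is a topological singularity of $\mathcal{C}_*(\Gamma)$.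
   Context: **Linkages and configuration spaces.** A linkage $\Gamma=(\mathcal{T}_\Gamma,\ell)$ is a finite graph $\mathcal{T}_\Gamma$ with vertex set $V$ and edge set (links) $E$, together with a length function $\ell:E\to\mathbb{R}_+$. Fix an ambient Euclidean space $\mathbb{R}^d$. Let $\mathrm{Emb}^d(\mathcal{T}_\Gamma)\subseteq(\mathbb{R}^d)^V$ be the open set of embeddings $\varphi$ of the vertex set $V$ in $\mathbb{R}^d$ (intersections of edges are disregarded). The configuration space is $$\mathcal{C}(\Gamma)=\{\varphi\in \mathrm{Emb}^d(\mathcal{T}_\Gamma): \|\varphi(u)-\varphi(v)\|^2=\ell(e)^2 \text{ for every edge } e=(u,v)\in E\},$$ with the subspace topology. Given a base-point vertex $\mathbf{x}_\star$, the pointed configuration space $\mathcal{C}_*(\Gamma)$ is the quotient of $\mathcal{C}(\Gamma)$ by translations of $\mathbb{R}^d$; equivalently, it is the space of configurations with $\mathbf{x}_\star$ at the origin. A configuration is smooth if $\mathcal{C}_*(\Gamma)$ is a smooth manifold near it. Given an end-effector vertex $\mathbf{x}_e$, the work map $\mathcal{C}_*(\Gamma)\to\mathbb{R}^d$ sends a configuration to the position of $\mathbf{x}_e$. **Reduced work map.** Where $\vec{\mathbf{v}}:=\mathbf{x}_e-\mathbf{x}_\star\neq 0$, the direction of $\vec{\mathbf{v}}$ defines a locally trivial map to $S^{d-1}$, whose fiber over the first unit vector is the reduced configuration space $\widehat{\mathcal{C}}_*(\Gamma)$. So locally $\mathcal{C}_*(\Gamma)\cong S^{d-1}\times\widehat{\mathcal{C}}_*(\Gamma)$.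 In spherical coordinates $S^{d-1}\times\mathbb{R}_+$ on $\mathbb{R}^d\setminus\{0\}$ the work map is locally $\psi=\mathrm{Id}_{S^{d-1}}\times\tilde\psi$, where $\tilde\psi:\widehat{\mathcal{C}}_*(\Gamma)\to\mathbb{R}_+$, $\tilde\psi=\|\mathbf{x}_e-\mathbf{x}_\star\|$. For a configuration $\mathcal{V}$, $\hat{\mathcal{V}}$ denotes its $\widehat{\mathcal{C}}_*$-coordinate in this decomposition. **Pullback decomposition.** An open $k$-chain $\Gamma_{\mathrm{op}}^k$ is a linkage whose graph is a path with vertices $\mathbf{x}^{(0)},\dots,\mathbf{x}^{(k)}$ and $k$ links of given lengths. Suppose it is a sub-mechanism of $\Gamma$ whose interior vertices $\mathbf{x}^{(1)},\dots,\mathbf{x}^{(k-1)}$ lie on no other links of $\Gamma$. Let $\Gamma'$ be obtained from $\Gamma$ by omitting the $k$ links of the chain and all its vertices except $\mathbf{x}^{(0)}$ and $\mathbf{x}^{(k)}$. Take $\mathbf{x}_\star:=\mathbf{x}^{(0)}$ as the common base-point of $\Gamma,\Gamma',\Gamma_{\mathrm{op}}^k$, and $\mathbf{x}_e:=\mathbf{x}^{(k)}$ as the common end-effector of $\Gamma'$ and $\Gamma_{\mathrm{op}}^k$, with work maps $\psi:\mathcal{C}_*(\Gamma')\to\mathbb{R}^d$ and $\phi:\mathcal{C}_*(\Gamma_{\mathrm{op}}^k)\to\mathbb{R}^d$. A configuration in $\mathcal{C}_*(\Gamma)$ is identified with a pair $(\mathcal{V}',\mathcal{V}^{(k)})\in\mathcal{C}_*(\Gamma')\times\mathcal{C}_*(\Gamma_{\mathrm{op}}^k)$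 with $\psi(\mathcal{V}')=\phi(\mathcal{V}^{(k)})$. **Generically non-transverse.** A configuration $(\mathcal{V}',\mathcal{V}^{(k)})\in\mathcal{C}_*(\Gamma)$ is generically non-transverse if all of the following hold: - $\mathcal{V}'$ is a smooth configuration of $\Gamma'$; - the transversality condition $\mathrm{Im}(d\phi)_{\mathcal{V}^{(k)}}+\mathrm{Im}(d\psi)_{\mathcal{V}'}=\mathbb{R}^d$ fails; - $\hat{\mathcal{V}}'$ is a non-degenerate critical point of the reduced work map $\tilde\psi$ of $\Gamma'$; - $\mathbf{x}^{(0)}\neq\mathbf{x}^{(k)}$ at this configuration. **Cones and topological singularities.** A cone on a homogeneous quadratic hypersurface means (a neighborhood of the apex $0$ in) the zero set $\{x\in\mathbb{R}^s: q(x)=0\}$ of a non-zero homogeneous quadratic polynomial $q$. A topological singularity of a space is a point with no neighborhood homeomorphic to a Euclidean space.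
   Formalization: The closing claim that the configuration is a topological singularity is proved only when its coordinate is not isolated in the reduced configuration space of Γ; otherwise it is false (a flat planar triangle with sides 1, 2, 3 gives a circle). *)

theory Defs
  imports "HOL-Analysis.Analysis"
begin

section \<open>Linkages and configuration spaces\<close>

record 'v linkage =
  verts :: "'v set"
  links :: "'v set set"
  len :: "'v set \<Rightarrow> real"

definition is_linkage :: "'v linkage \<Rightarrow> bool" where
  "is_linkage \<Gamma> \<longleftrightarrow> finite (verts \<Gamma>) \<and>
     (\<forall>e\<in>links \<Gamma>. (\<exists>u\<in>verts \<Gamma>. \<exists>v\<in>verts \<Gamma>. u \<noteq> v \<and> e = {u, v}) \<and> 0 < len \<Gamma> e)"

text \<open>
  The ambient space \<open>\<real>\<^sup>d\<close> is the type \<open>'a\<close>.  All vertices are drawn from one finite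
  type \<open>'v\<close>, and \<open>(\<real>\<^sup>d)\<^sup>W\<close> for a set \<open>W\<close> of vertices is encoded as the linear subspace
  of \<open>'a ^ 'v\<close> of those vectors that vanish outside \<open>W\<close>.  So a linkage and its
  sub-mechanisms have their configuration spaces inside the same Euclidean space.
\<close>

definition restrict_config :: "'v set \<Rightarrow> 'a::euclidean_space ^ 'v::finite \<Rightarrow> 'a ^ 'v" where
  "restrict_config W \<phi> = (\<chi> v. if v \<in> W then \<phi> $ v else 0)"

definition embeddings :: "'v linkage \<Rightarrow> ('a::euclidean_space ^ 'v::finite) set" where
  "embeddings \<Gamma> = {\<phi>. inj_on (\<lambda>v. \<phi> $ v) (verts \<Gamma>) \<and> (\<forall>v. v \<notin> verts \<Gamma> \<longrightarrow> \<phi> $ v = 0)}"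

definition config_space :: "'v linkage \<Rightarrow> ('a::euclidean_space ^ 'v::finite) set" where
  "config_space \<Gamma> = {\<phi> \<in> embeddings \<Gamma>.
     \<forall>u v. {u, v} \<in> links \<Gamma> \<longrightarrow> (norm (\<phi> $ u - \<phi> $ v))\<^sup>2 = (len \<Gamma> {u, v})\<^sup>2}"

text \<open>The quotient by translations is represented by the configurations with base-point at the origin.\<close>

definition pointed_config_space ::
    "'v linkage \<Rightarrow> 'v \<Rightarrow> ('a::euclidean_space ^ 'v::finite) set" where
  "pointed_config_space \<Gamma> xs = {\<phi> \<in> config_space \<Gamma>. \<phi> $ xs = 0}"

definition work_map :: "'v \<Rightarrow> 'a::euclidean_space ^ 'v::finite \<Rightarrow> 'a" where
  "work_map xe \<phi> = \<phi> $ xe"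

text \<open>The unit vector \<open>e\<close> plays the role of the first unit vector of \<open>\<real>\<^sup>d\<close>.\<close>

definition reduced_config_space ::
    "'v linkage \<Rightarrow> 'v \<Rightarrow> 'v \<Rightarrow> 'a \<Rightarrow> ('a::euclidean_space ^ 'v::finite) set" where
  "reduced_config_space \<Gamma> xs xe e =
     {\<phi> \<in> pointed_config_space \<Gamma> xs. \<phi> $ xe \<noteq> \<phi> $ xs \<and> sgn (\<phi> $ xe - \<phi> $ xs) = e}"

definition reduced_work_map :: "'v \<Rightarrow> 'v \<Rightarrow> 'a::euclidean_space ^ 'v::finite \<Rightarrow> real" where
  "reduced_work_map xs xe \<phi> = norm (\<phi> $ xe - \<phi> $ xs)"

text \<open>
  A local trivialization of the direction map identifies the fibre through \<open>\<phi>\<close> with the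
  fibre over \<open>e\<close> by means of an orthogonal map that takes the direction of \<open>\<phi>\<close> to \<open>e\<close>.
  Two such maps differ by an element of the stabilizer of \<open>e\<close>, which acts on the reduced
  configuration space by diffeomorphisms that preserve the reduced work map.
\<close>

definition is_reduced_coordinate ::
    "'v \<Rightarrow> 'v \<Rightarrow> 'a \<Rightarrow> 'a::euclidean_space ^ 'v::finite \<Rightarrow> 'a ^ 'v \<Rightarrow> bool" where
  "is_reduced_coordinate xs xe e \<phi> \<phi>' \<longleftrightarrow>
     (\<exists>R. orthogonal_transformation R \<and>
          R (\<phi> $ xe - \<phi> $ xs) = norm (\<phi> $ xe - \<phi> $ xs) *\<^sub>R e \<and>
          \<phi>' = (\<chi> v. R (\<phi> $ v)))"


section \<open>Open chains as sub-mechanisms\<close>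

definition chain_links :: "(nat \<Rightarrow> 'v) \<Rightarrow> nat \<Rightarrow> 'v set set" where
  "chain_links x k = {{x i, x (Suc i)} |i. i < k}"

definition is_open_chain_in :: "'v linkage \<Rightarrow> (nat \<Rightarrow> 'v) \<Rightarrow> nat \<Rightarrow> bool" where
  "is_open_chain_in \<Gamma> x k \<longleftrightarrow>
     1 \<le> k \<and> inj_on x {..k} \<and> x ` {..k} \<subseteq> verts \<Gamma> \<and> chain_links x k \<subseteq> links \<Gamma> \<and>
     (\<forall>i e. 0 < i \<and> i < k \<and> e \<in> links \<Gamma> \<and> x i \<in> e \<longrightarrow> e \<in> chain_links x k)"

definition chain_linkage :: "'v linkage \<Rightarrow> (nat \<Rightarrow> 'v) \<Rightarrow> nat \<Rightarrow> 'v linkage" where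
  "chain_linkage \<Gamma> x k = \<lparr>verts = x ` {..k}, links = chain_links x k, len = len \<Gamma>\<rparr>"

definition complementary_linkage :: "'v linkage \<Rightarrow> (nat \<Rightarrow> 'v) \<Rightarrow> nat \<Rightarrow> 'v linkage" where
  "complementary_linkage \<Gamma> x k =
     \<lparr>verts = verts \<Gamma> - x ` {0<..<k}, links = links \<Gamma> - chain_links x k, len = len \<Gamma>\<rparr>"

definition complement_part ::
    "'v linkage \<Rightarrow> (nat \<Rightarrow> 'v) \<Rightarrow> nat \<Rightarrow> 'a::euclidean_space ^ 'v::finite \<Rightarrow> 'a ^ 'v" where
  "complement_part \<Gamma> x k \<phi> = restrict_config (verts (complementary_linkage \<Gamma> x k)) \<phi>"

definition chain_part ::
    "'v linkage \<Rightarrow> (nat \<Rightarrow> 'v) \<Rightarrow> nat \<Rightarrow> 'a::euclidean_space ^ 'v::finite \<Rightarrow> 'a ^ 'v" where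
  "chain_part \<Gamma> x k \<phi> = restrict_config (verts (chain_linkage \<Gamma> x k)) \<phi>"

text \<open>
  The identification of \<open>\<C>\<^sub>*(\<Gamma>)\<close> with pairs.  Only the requirement that the embedding be
  injective across the two parts, which is an open condition, is not seen by the pullback.
\<close>

lemma pointed_config_space_pullback:
  fixes \<phi> :: "'a::euclidean_space ^ 'v::finite"
  assumes "is_linkage \<Gamma>" and "is_open_chain_in \<Gamma> x k"
  shows "\<phi> \<in> pointed_config_space \<Gamma> (x 0) \<longleftrightarrow>
     \<phi> \<in> embeddings \<Gamma> \<and>
     complement_part \<Gamma> x k \<phi> \<in> pointed_config_space (complementary_linkage \<Gamma> x k) (x 0) \<and>
     chain_part \<Gamma> x k \<phi> \<in> pointed_config_space (chain_linkage \<Gamma> x k) (x 0) \<and>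
     work_map (x k) (complement_part \<Gamma> x k \<phi>) = work_map (x k) (chain_part \<Gamma> x k \<phi>)"
proof -
  have ch: "{u, v} \<in> chain_links x k \<Longrightarrow> u \<in> x ` {..k} \<and> v \<in> x ` {..k}" for u v
    unfolding chain_links_def by (auto simp: doubleton_eq_iff)
  have co: "u \<in> verts \<Gamma> - x ` {0<..<k} \<and> v \<in> verts \<Gamma> - x ` {0<..<k}"
    if "{u, v} \<in> links \<Gamma>" "{u, v} \<notin> chain_links x k" for u v
  proof -
    have "u \<in> verts \<Gamma>" "v \<in> verts \<Gamma>"
      using assms(1) that(1) unfolding is_linkage_def by (auto simp: doubleton_eq_iff)
    moreover have "u \<notin> x ` {0<..<k}" "v \<notin> x ` {0<..<k}"
      using assms(2) that unfolding is_open_chain_in_def by force+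
    ultimately show ?thesis by blast
  qed
  have inj: "inj_on x {..k}"
    and sub: "x ` {..k} \<subseteq> verts \<Gamma>" "chain_links x k \<subseteq> links \<Gamma>"
    using assms(2) unfolding is_open_chain_in_def by auto
  have ends: "x 0 \<notin> x ` {0<..<k}" "x k \<notin> x ` {0<..<k}" "x 0 \<in> x ` {..k}" "x k \<in> x ` {..k}"
    "x 0 \<in> verts \<Gamma>" "x k \<in> verts \<Gamma>"
    using sub inj_onD[OF inj] by force+
  let ?len = "\<lambda>u v. (norm (\<phi> $ u - \<phi> $ v))\<^sup>2 = (len \<Gamma> {u, v})\<^sup>2"
  have links: "(\<forall>u v. {u, v} \<in> links \<Gamma> \<longrightarrow> ?len u v) \<longleftrightarrow>
      (\<forall>u v. {u, v} \<in> links \<Gamma> - chain_links x k \<longrightarrow> ?len u v) \<and>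
      (\<forall>u v. {u, v} \<in> chain_links x k \<longrightarrow> ?len u v)"
    using sub(2) by blast
  let ?A = "verts \<Gamma> - x ` {0<..<k}" and ?B = "x ` {..k}"
  have mem: "restrict_config A \<phi> \<in> pointed_config_space \<lparr>verts = A, links = L, len = len \<Gamma>\<rparr> (x 0)
      \<longleftrightarrow> inj_on (\<lambda>v. \<phi> $ v) A \<and> (\<forall>u v. {u, v} \<in> L \<longrightarrow> ?len u v) \<and> \<phi> $ x 0 = 0"
    if L: "\<And>u v. {u, v} \<in> L \<Longrightarrow> u \<in> A \<and> v \<in> A" and "x 0 \<in> A" for A L
  proof -
    have "restrict_config A \<phi> $ u = \<phi> $ u \<and> restrict_config A \<phi> $ v = \<phi> $ v"
      if "{u, v} \<in> L" for u v
      using L[OF that] by (simp add: restrict_config_def)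
    then have "(\<forall>u v. {u, v} \<in> L \<longrightarrow>
          (norm (restrict_config A \<phi> $ u - restrict_config A \<phi> $ v))\<^sup>2 = (len \<Gamma> {u, v})\<^sup>2)
        \<longleftrightarrow> (\<forall>u v. {u, v} \<in> L \<longrightarrow> ?len u v)"
      by (intro iff_allI imp_cong refl) simp
    moreover have "restrict_config A \<phi> \<in> embeddings \<lparr>verts = A, links = L, len = len \<Gamma>\<rparr>
        \<longleftrightarrow> inj_on (\<lambda>v. \<phi> $ v) A"
      by (auto simp: embeddings_def restrict_config_def inj_on_def)
    moreover have "restrict_config A \<phi> $ x 0 = \<phi> $ x 0"
      using \<open>x 0 \<in> A\<close> by (simp add: restrict_config_def)
    ultimately show ?thesis
      by (simp only: pointed_config_space_def config_space_def mem_Collect_eq linkage.simps) blast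
  qed
  have memA: "complement_part \<Gamma> x k \<phi> \<in> pointed_config_space (complementary_linkage \<Gamma> x k) (x 0)
      \<longleftrightarrow> inj_on (\<lambda>v. \<phi> $ v) ?A \<and>
          (\<forall>u v. {u, v} \<in> links \<Gamma> - chain_links x k \<longrightarrow> ?len u v) \<and> \<phi> $ x 0 = 0"
    unfolding complement_part_def complementary_linkage_def linkage.simps
    by (rule mem) (use co ends in auto)
  have memB: "chain_part \<Gamma> x k \<phi> \<in> pointed_config_space (chain_linkage \<Gamma> x k) (x 0)
      \<longleftrightarrow> inj_on (\<lambda>v. \<phi> $ v) ?B \<and>
          (\<forall>u v. {u, v} \<in> chain_links x k \<longrightarrow> ?len u v) \<and> \<phi> $ x 0 = 0"
    unfolding chain_part_def chain_linkage_def linkage.simps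
    by (rule mem) (use ch ends in auto)
  have wm: "work_map (x k) (complement_part \<Gamma> x k \<phi>) = work_map (x k) (chain_part \<Gamma> x k \<phi>)"
    using ends by (simp add: work_map_def complement_part_def chain_part_def
      complementary_linkage_def chain_linkage_def restrict_config_def)
  have "\<phi> \<in> embeddings \<Gamma> \<Longrightarrow> inj_on (\<lambda>v. \<phi> $ v) ?A \<and> inj_on (\<lambda>v. \<phi> $ v) ?B"
    using sub(1) unfolding embeddings_def by (auto intro: inj_on_subset)
  moreover have "\<phi> \<in> pointed_config_space \<Gamma> (x 0) \<longleftrightarrow> \<phi> \<in> embeddings \<Gamma> \<and>
      ((\<forall>u v. {u, v} \<in> links \<Gamma> - chain_links x k \<longrightarrow> ?len u v) \<and>
       (\<forall>u v. {u, v} \<in> chain_links x k \<longrightarrow> ?len u v)) \<and> \<phi> $ x 0 = 0"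
    by (simp only: pointed_config_space_def config_space_def mem_Collect_eq links conj_assoc)
  ultimately show ?thesis
    unfolding memA memB using wm by argo
qed


section \<open>Smooth submanifolds and non-degenerate critical points\<close>

text \<open>On an open set \<open>S\<close> the predicate \<open>Ck_on n S f\<close> says that \<open>f\<close> is of class \<open>C\<^sup>n\<close>.\<close>

primrec Ck_on :: "nat \<Rightarrow> 'a::euclidean_space set \<Rightarrow> ('a \<Rightarrow> 'b::euclidean_space) \<Rightarrow> bool" where
  "Ck_on 0 S f \<longleftrightarrow> continuous_on S f"
| "Ck_on (Suc n) S f \<longleftrightarrow>
     (\<forall>x\<in>S. f differentiable (at x)) \<and> (\<forall>v. Ck_on n S (\<lambda>x. frechet_derivative f (at x) v))"

definition smooth_map_on :: "'a::euclidean_space set \<Rightarrow> ('a \<Rightarrow> 'b::euclidean_space) \<Rightarrow> bool" where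
  "smooth_map_on S f \<longleftrightarrow> (\<forall>n. Ck_on n S f)"

text \<open>
  A chart of the ambient space, centred at \<open>p\<close>, that straightens \<open>S\<close> to the linear
  subspace \<open>L\<close>; \<open>\<Psi>\<close> is the inverse of the chart \<open>\<Phi>\<close>.
\<close>

definition slice_chart ::
    "'a::euclidean_space set \<Rightarrow> 'a \<Rightarrow> 'a set \<Rightarrow> 'a set \<Rightarrow> 'a set \<Rightarrow> ('a \<Rightarrow> 'a) \<Rightarrow> ('a \<Rightarrow> 'a) \<Rightarrow> bool" where
  "slice_chart S p L U W \<Phi> \<Psi> \<longleftrightarrow>
     open U \<and> open W \<and> p \<in> U \<and> \<Phi> p = 0 \<and> subspace L \<and>
     homeomorphism U W \<Phi> \<Psi> \<and> smooth_map_on U \<Phi> \<and> smooth_map_on W \<Psi> \<and>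
     \<Phi> ` (S \<inter> U) = L \<inter> W"

definition smooth_manifold_near :: "'a::euclidean_space set \<Rightarrow> 'a \<Rightarrow> bool" where
  "smooth_manifold_near S p \<longleftrightarrow> p \<in> S \<and> (\<exists>L U W \<Phi> \<Psi>. slice_chart S p L U W \<Phi> \<Psi>)"

definition smooth_configuration ::
    "'v linkage \<Rightarrow> 'v \<Rightarrow> 'a::euclidean_space ^ 'v::finite \<Rightarrow> bool" where
  "smooth_configuration \<Gamma> xs \<phi> \<longleftrightarrow> smooth_manifold_near (pointed_config_space \<Gamma> xs) \<phi>"

definition tangent_space :: "'a::euclidean_space set \<Rightarrow> 'a \<Rightarrow> 'a set" where
  "tangent_space S p = {w. \<exists>\<gamma> \<epsilon>. 0 < \<epsilon> \<and> smooth_map_on {-\<epsilon><..<\<epsilon>} \<gamma> \<and>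
     \<gamma> ` {-\<epsilon><..<\<epsilon>} \<subseteq> S \<and> \<gamma> (0::real) = p \<and> (\<gamma> has_vector_derivative w) (at 0)}"

text \<open>The image of the differential at \<open>p\<close> of the restriction of \<open>f\<close> to \<open>S\<close>.\<close>

definition image_differential ::
    "'a::euclidean_space set \<Rightarrow> ('a \<Rightarrow> 'b::euclidean_space) \<Rightarrow> 'a \<Rightarrow> 'b set" where
  "image_differential S f p = frechet_derivative f (at p) ` tangent_space S p"

definition second_derivative ::
    "('a::euclidean_space \<Rightarrow> real) \<Rightarrow> 'a \<Rightarrow> 'a \<Rightarrow> 'a \<Rightarrow> real" where
  "second_derivative g p u v = frechet_derivative (\<lambda>y. frechet_derivative g (at y) u) (at p) v"

text \<open>
  In the coordinates \<open>L\<close> of a slice chart, the differential of the restriction of \<open>f\<close> to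
  \<open>S\<close> vanishes at the origin and its Hessian there is a non-degenerate bilinear form.
\<close>

definition nondegenerate_critical_point ::
    "'a::euclidean_space set \<Rightarrow> ('a \<Rightarrow> real) \<Rightarrow> 'a \<Rightarrow> bool" where
  "nondegenerate_critical_point S f p \<longleftrightarrow> p \<in> S \<and>
     (\<exists>L U W \<Phi> \<Psi>. slice_chart S p L U W \<Phi> \<Psi> \<and> smooth_map_on U f \<and>
        (\<forall>u\<in>L. frechet_derivative (f \<circ> \<Psi>) (at 0) u = 0) \<and>
        (\<forall>u\<in>L. (\<forall>v\<in>L. second_derivative (f \<circ> \<Psi>) 0 u v = 0) \<longrightarrow> u = 0))"


section \<open>Generically non-transverse configurations\<close>

definition transverse_configuration ::
    "'v linkage \<Rightarrow> (nat \<Rightarrow> 'v) \<Rightarrow> nat \<Rightarrow> 'a::euclidean_space ^ 'v::finite \<Rightarrow> bool" where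
  "transverse_configuration \<Gamma> x k \<V> \<longleftrightarrow>
     {a + b |a b.
        a \<in> image_differential (pointed_config_space (chain_linkage \<Gamma> x k) (x 0))
              (work_map (x k)) (chain_part \<Gamma> x k \<V>) \<and>
        b \<in> image_differential (pointed_config_space (complementary_linkage \<Gamma> x k) (x 0))
              (work_map (x k)) (complement_part \<Gamma> x k \<V>)} = UNIV"

definition generically_nontransverse ::
    "'v linkage \<Rightarrow> (nat \<Rightarrow> 'v) \<Rightarrow> nat \<Rightarrow> 'a \<Rightarrow> 'a::euclidean_space ^ 'v::finite \<Rightarrow> bool" where
  "generically_nontransverse \<Gamma> x k e \<V> \<longleftrightarrow>
     smooth_configuration (complementary_linkage \<Gamma> x k) (x 0) (complement_part \<Gamma> x k \<V>) \<and>
     \<not> transverse_configuration \<Gamma> x k \<V> \<and>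
     (\<exists>\<V>hat. is_reduced_coordinate (x 0) (x k) e (complement_part \<Gamma> x k \<V>) \<V>hat \<and>
        nondegenerate_critical_point
          (reduced_config_space (complementary_linkage \<Gamma> x k) (x 0) (x k) e)
          (reduced_work_map (x 0) (x k)) \<V>hat) \<and>
     \<V> $ x 0 \<noteq> \<V> $ x k"

text \<open>
  The coordinate of the configuration in the reduced configuration space is an isolated
  point.  For a generically non-transverse configuration this is the case of a definite
  quadratic form: the cone consists of its apex only, and the pointed configuration space is
  locally a sphere, hence not singular.  A triangle in the plane with side lengths 3, 1 and 2,
  with the long side as complement of the chain, is an example.
\<close>

definition isolated_in_reduced_space ::
    "'v linkage \<Rightarrow> 'v \<Rightarrow> 'v \<Rightarrow> 'a \<Rightarrow> 'a::euclidean_space ^ 'v::finite \<Rightarrow> bool" where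
  "isolated_in_reduced_space \<Gamma> xs xe e \<phi> \<longleftrightarrow>
     (\<exists>\<phi>'. is_reduced_coordinate xs xe e \<phi> \<phi>' \<and>
        \<not> \<phi>' islimpt reduced_config_space \<Gamma> xs xe e)"


section \<open>Quadratic cones and topological singularities\<close>

definition quadratic_polynomial :: "nat \<Rightarrow> (nat \<Rightarrow> nat \<Rightarrow> real) \<Rightarrow> (nat \<Rightarrow> real) \<Rightarrow> real" where
  "quadratic_polynomial s c y = (\<Sum>j<s. \<Sum>i\<le>j. c i j * y i * y j)"

definition nonzero_coefficients :: "nat \<Rightarrow> (nat \<Rightarrow> nat \<Rightarrow> real) \<Rightarrow> bool" where
  "nonzero_coefficients s c \<longleftrightarrow> (\<exists>j<s. \<exists>i\<le>j. c i j \<noteq> 0)"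

definition quadratic_cone :: "nat \<Rightarrow> (nat \<Rightarrow> nat \<Rightarrow> real) \<Rightarrow> (nat \<Rightarrow> real) topology" where
  "quadratic_cone s c = subtopology (Euclidean_space s) {y. quadratic_polynomial s c y = 0}"

definition locally_euclidean_times_quadratic_cone :: "'p topology \<Rightarrow> 'p \<Rightarrow> bool" where
  "locally_euclidean_times_quadratic_cone X p \<longleftrightarrow>
     (\<exists>N m s c K h. openin X N \<and> p \<in> N \<and> nonzero_coefficients s c \<and>
        openin (quadratic_cone s c) K \<and> (\<lambda>_. 0) \<in> K \<and>
        homeomorphic_map (subtopology X N)
          (prod_topology (Euclidean_space m) (subtopology (quadratic_cone s c) K)) h \<and>
        snd (h p) = (\<lambda>_. 0))"

definition topological_singularity :: "'p topology \<Rightarrow> 'p \<Rightarrow> bool" where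
  "topological_singularity X p \<longleftrightarrow> p \<in> topspace X \<and>
     \<not> (\<exists>N O' n. openin X O' \<and> p \<in> O' \<and> O' \<subseteq> N \<and> N \<subseteq> topspace X \<and>
          subtopology X N homeomorphic_space Euclidean_space n)"

end

theory Submission
  imports Defs
begin

text \<open>
  Why the theorem holds.  Let \<open>d\<close> be the dimension of the ambient space.  Near \<open>\<V>\<close> the pointed
  configuration space is the product of a piece of the sphere of directions of the
  end-effector with the reduced configuration space, where the end-effector is a positive multiple
  of the unit vector \<open>e\<close>
  (\<open>pointed_config_space_direction_splitting\<close>).  The sphere contributes a Euclidean factor of
  dimension \<open>d - 1\<close>, so it remains to show that the reduced space is a quadratic cone near the
  reduced coordinate of \<open>\<V>\<close>.

  A reduced configuration is a pair of a reduced configuration of the complementary linkage and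
  one of the chain in which the ends \<open>x 0\<close> and \<open>x k\<close> have the same distance.  For the
  complementary linkage this distance has a non-degenerate critical point by hypothesis.  For the
  chain, the failure of transversality forces all links to be parallel to \<open>e\<close>
  (\<open>nontransverse_chain_aligned\<close>), for otherwise rotating the complementary linkage and turning a single
  link would produce all directions.  At an aligned chain the distance is critical as well, and
  an explicit computation shows that its Hessian is non-degenerate as long as the ends do not
  coincide (\<open>chain_hessian_nondegenerate\<close>).  Hence the reduced space is the zero set of a function,
  the difference of both distances, that has a non-degenerate critical point of value \<open>0\<close>
  (\<open>reduced_config_space_chart\<close>), and the Morse lemma (\<open>morse_coordinates\<close>) identifies the zero set
  with the cone of the Hessian.

  If the Hessian is definite, the cone is a point and the reduced coordinate is isolated.
  If it is indefinite, the product of the cone with a Euclidean space is not locally Euclidean at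
  the apex, whatever the signature (\<open>indefinite_cone_not_locally_euclidean\<close>): it contains the product
  with the positive part as a retract that is not a neighbourhood of the apex, and such a retract
  cannot sit in \<open>\<real>\<^sup>n\<close>, be \<open>n\<close> smaller than, equal to or larger than its dimension.
\<close>

section \<open>Symmetric bilinear forms and the Morse lemma\<close>

text \<open>
  Sylvester's normal form.  A vector \<open>z\<close> with \<open>H z z \<noteq> 0\<close> exists by polarization; after rescaling,
  it is split off, and the form stays non-degenerate on its \<open>H\<close>-orthogonal complement.  The
  last clause gives the coordinates of \<open>x\<close> as the linear functionals \<open>\<sigma> i * H x (b i)\<close>.
\<close>

lemma diagonal_basis:
  fixes H :: "'b::euclidean_space \<Rightarrow> 'b \<Rightarrow> real"
  assumes bil: "bilinear H" and sym: "\<And>u v. H u v = H v u"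
    and "subspace T" and "\<And>u. u \<in> T \<Longrightarrow> (\<And>v. v \<in> T \<Longrightarrow> H u v = 0) \<Longrightarrow> u = 0"
  shows "\<exists>(s::nat) b \<sigma>. (\<forall>i<s. b i \<in> T \<and> (\<sigma> i = 1 \<or> \<sigma> i = -1)) \<and>
     (\<forall>i<s. \<forall>j<s. H (b i) (b j) = (if i = j then \<sigma> i else 0)) \<and>
     (\<forall>x\<in>T. x = (\<Sum>i<s. (\<sigma> i * H x (b i)) *\<^sub>R b i))"
  using assms(3,4)
proof (induction "dim T" arbitrary: T rule: less_induct)
  case less
  note add = bilinear_ladd[OF bil] bilinear_radd[OF bil]
    and mul = bilinear_lmul[OF bil] bilinear_rmul[OF bil]
    and sub = bilinear_lsub[OF bil] bilinear_rsub[OF bil]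
  show ?case
  proof (cases "T \<subseteq> {0}")
    case True
    then show ?thesis by (intro exI[of _ 0]) auto
  next
    case False
    then obtain u where u: "u \<in> T" "u \<noteq> 0" by auto
    then obtain v where v: "v \<in> T" "H u v \<noteq> 0" using less.prems(2) by blast
    have "\<exists>z\<in>T. H z z \<noteq> 0"
    proof (rule ccontr)
      assume "\<not> ?thesis"
      then have *: "z \<in> T \<Longrightarrow> H z z = 0" for z by blast
      have "H (u + v) (u + v) = H u u + H v v + 2 * H u v"
        using sym[of u v] by (simp add: add)
      then show False using * u v subspace_add[OF less.prems(1)] by fastforce
    qed
    then obtain z where z: "z \<in> T" "H z z \<noteq> 0" by blast
    define b0 where "b0 = (1 / sqrt \<bar>H z z\<bar>) *\<^sub>R z"
    define \<sigma>0 where "\<sigma>0 = sgn (H z z)"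
    have b0: "b0 \<in> T" using z less.prems(1) by (simp add: b0_def subspace_mul)
    have \<sigma>0: "\<sigma>0 = 1 \<or> \<sigma>0 = -1" using z by (auto simp: \<sigma>0_def sgn_if)
    have "sqrt \<bar>H z z\<bar> * sqrt \<bar>H z z\<bar> = \<bar>H z z\<bar>" by simp
    then have Hb0: "H b0 b0 = \<sigma>0"
      using z by (simp add: b0_def mul \<sigma>0_def sgn_if abs_if split: if_splits)
    define T' where "T' = {x \<in> T. H x b0 = 0}"
    have sT': "subspace T'"
      using less.prems(1) unfolding T'_def subspace_def
      by (auto simp: add mul bilinear_lzero[OF bil])
    have "b0 \<notin> T'" using Hb0 \<sigma>0 unfolding T'_def by auto
    then have "T' \<subset> T" using b0 unfolding T'_def by blast
    then have dim: "dim T' < dim T"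
      using dim_psubset sT' less.prems(1) by (metis span_eq_iff)
    have dec: "w - (\<sigma>0 * H w b0) *\<^sub>R b0 \<in> T'" if "w \<in> T" for w
      using that b0 less.prems(1) \<sigma>0 unfolding T'_def
      by (auto simp: subspace_diff subspace_mul sub mul Hb0)
    have nd': "u = 0" if "u \<in> T'" "\<And>v. v \<in> T' \<Longrightarrow> H u v = 0" for u
    proof (rule less.prems(2))
      show "u \<in> T" using that by (simp add: T'_def)
      fix w assume "w \<in> T"
      then have "H u (w - (\<sigma>0 * H w b0) *\<^sub>R b0) = 0" using that(2) dec by blast
      moreover have "H u b0 = 0" using that(1) by (simp add: T'_def)
      ultimately show "H u w = 0" by (simp add: sub mul)
    qed
    from less.hyps[OF dim sT' nd'] obtain s :: nat and b :: "nat \<Rightarrow> 'b" and \<sigma> :: "nat \<Rightarrow> real" where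
      IH: "\<forall>i<s. b i \<in> T' \<and> (\<sigma> i = 1 \<or> \<sigma> i = -1)"
        "\<forall>i<s. \<forall>j<s. H (b i) (b j) = (if i = j then \<sigma> i else 0)"
        "\<forall>x\<in>T'. x = (\<Sum>i<s. (\<sigma> i * H x (b i)) *\<^sub>R b i)" by blast
    define b' where "b' = case_nat b0 b"
    define \<sigma>' where "\<sigma>' = case_nat \<sigma>0 \<sigma>"
    have bz: "H (b i) b0 = 0" "H b0 (b i) = 0" if "i < s" for i
      using IH(1) that sym unfolding T'_def by auto
    show ?thesis
    proof (intro exI[of _ "Suc s"] exI[of _ b'] exI[of _ \<sigma>'] conjI allI impI ballI)
      fix i assume "i < Suc s"
      then show "b' i \<in> T" "\<sigma>' i = 1 \<or> \<sigma>' i = -1"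
        using IH(1) b0 \<sigma>0 by (auto simp: b'_def \<sigma>'_def T'_def split: nat.split)
      fix j assume "j < Suc s"
      then show "H (b' i) (b' j) = (if i = j then \<sigma>' i else 0)"
        using IH(2) \<open>i < Suc s\<close> Hb0 bz by (auto simp: b'_def \<sigma>'_def split: nat.split)
    next
      fix x assume x: "x \<in> T"
      let ?x' = "x - (\<sigma>0 * H x b0) *\<^sub>R b0"
      have "?x' = (\<Sum>i<s. (\<sigma> i * H ?x' (b i)) *\<^sub>R b i)" using IH(3) dec[OF x] by blast
      also have "\<dots> = (\<Sum>i<s. (\<sigma> i * H x (b i)) *\<^sub>R b i)"
        by (intro sum.cong) (auto simp: sub mul bz)
      finally have "x = (\<sigma>0 * H x b0) *\<^sub>R b0 + (\<Sum>i<s. (\<sigma> i * H x (b i)) *\<^sub>R b i)"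
        by (metis add.commute diff_add_cancel)
      then show "x = (\<Sum>i<Suc s. (\<sigma>' i * H x (b' i)) *\<^sub>R b' i)"
        unfolding sum.lessThan_Suc_shift by (simp add: b'_def \<sigma>'_def)
    qed
  qed
qed

lemma diagonal_form_value:
  fixes H :: "'b::euclidean_space \<Rightarrow> 'b \<Rightarrow> real" and s :: nat
  assumes bil: "bilinear H" and exp: "x = (\<Sum>i<s. (\<sigma> i * H x (b i)) *\<^sub>R b i)"
  shows "H x x = (\<Sum>i<s. \<sigma> i * (H x (b i))\<^sup>2)"
proof -
  have lin: "linear (H x)" using bil by (simp add: bilinear_def)
  have "H x x = H x (\<Sum>i<s. (\<sigma> i * H x (b i)) *\<^sub>R b i)" using exp by simp
  also have "\<dots> = (\<Sum>i<s. (\<sigma> i * H x (b i)) * H x (b i))"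
    by (simp add: linear_sum[OF lin] linear_scale[OF lin])
  finally show ?thesis by (simp add: power2_eq_square mult.assoc)
qed

lemma definite_cone_trivial:
  fixes H :: "'b::euclidean_space \<Rightarrow> 'b \<Rightarrow> real" and s :: nat
  assumes bil: "bilinear H" and exp: "x = (\<Sum>i<s. (\<sigma> i * H x (b i)) *\<^sub>R b i)"
    and \<sigma>: "\<And>i. i < s \<Longrightarrow> \<sigma> i = c" "c = 1 \<or> c = (-1::real)" and "H x x = 0"
  shows "x = 0"
proof -
  have "0 = (\<Sum>i<s. \<sigma> i * (H x (b i))\<^sup>2)" using diagonal_form_value[OF bil exp] \<open>H x x = 0\<close> by simp
  also have "\<dots> = c * (\<Sum>i<s. (H x (b i))\<^sup>2)" by (simp add: \<sigma>(1) sum_distrib_left)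
  finally have "(\<Sum>i<s. (H x (b i))\<^sup>2) = 0" using \<sigma>(2) by auto
  then have "\<forall>i\<in>{..<s}. (H x (b i))\<^sup>2 = 0" by (subst (asm) sum_nonneg_eq_0_iff) auto
  then have "(\<Sum>i<s. (\<sigma> i * H x (b i)) *\<^sub>R b i) = 0" by simp
  then show ?thesis using exp by metis
qed

lemma sqrt_one_plus_bounds:
  fixes a b :: real
  assumes "\<bar>a\<bar> \<le> 1/2" "\<bar>b\<bar> \<le> 1/2"
  shows "\<bar>sqrt (1 + a) - sqrt (1 + b)\<bar> \<le> \<bar>a - b\<bar>"
proof -
  have "sqrt (1 + a) \<ge> 1/2" "sqrt (1 + b) \<ge> 1/2"
    using assms real_le_rsqrt[of "1/2" "1 + a"] real_le_rsqrt[of "1/2" "1 + b"]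
    by (simp_all add: power2_eq_square abs_le_iff)
  then have s: "sqrt (1 + a) + sqrt (1 + b) \<ge> 1" by simp
  have "(sqrt (1 + a) - sqrt (1 + b)) * (sqrt (1 + a) + sqrt (1 + b)) = a - b"
    using assms by (simp add: algebra_simps abs_le_iff)
  then have "\<bar>sqrt (1 + a) - sqrt (1 + b)\<bar> * \<bar>sqrt (1 + a) + sqrt (1 + b)\<bar> = \<bar>a - b\<bar>"
    by (metis abs_mult)
  moreover have "\<bar>sqrt (1 + a) - sqrt (1 + b)\<bar> * 1
      \<le> \<bar>sqrt (1 + a) - sqrt (1 + b)\<bar> * \<bar>sqrt (1 + a) + sqrt (1 + b)\<bar>"
    using s by (intro mult_left_mono) auto
  ultimately show ?thesis by simp
qed

text \<open>
  The estimate behind the Morse lemma.  Here \<open>n\<close> and \<open>m\<close> are the norms of two points, \<open>c\<close> and \<open>d\<close>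
  are one of their coordinates, \<open>D\<close> is the distance of the points, and \<open>r\<close> and \<open>t\<close> are the values of
  a remainder that is small in the \<open>C\<^sup>1\<close> sense compared with the squared norm.  Scaling
  the coordinate by \<open>sqrt (1 \<plusminus> remainder / norm\<^sup>2)\<close> then distorts differences by a small factor
  only, although the quotient need not be differentiable at the origin.
\<close>

lemma morse_scaling_estimate:
  fixes c d a b r t n m D \<epsilon> \<sigma> :: real
  assumes "0 \<le> m" "m \<le> n" "0 < n" "\<bar>c\<bar> \<le> n" "\<bar>d\<bar> \<le> m" "\<bar>c - d\<bar> \<le> D" "n - m \<le> D" "\<bar>\<sigma>\<bar> = 1"
    and r: "\<bar>r\<bar> \<le> \<epsilon> * n\<^sup>2" and t: "\<bar>t\<bar> \<le> \<epsilon> * m\<^sup>2" and rt: "\<bar>r - t\<bar> \<le> \<epsilon> * n * D" and \<epsilon>: "0 \<le> \<epsilon>" "\<epsilon> \<le> 1/2"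
  shows "\<bar>(sqrt (1 + \<sigma> * (r / n\<^sup>2)) * c - sqrt (1 + \<sigma> * (t / m\<^sup>2)) * d) - (c - d)\<bar> \<le> 4 * \<epsilon> * D"
proof -
  have D0: "0 \<le> D" using assms by linarith
  have a: "\<bar>r / n\<^sup>2\<bar> \<le> \<epsilon>" using r \<open>0 < n\<close> by (simp add: field_simps)
  have b: "\<bar>t / m\<^sup>2\<bar> \<le> \<epsilon>"
    using t \<epsilon> by (cases "m = 0") (auto simp: field_simps)
  let ?a = "\<sigma> * (r / n\<^sup>2)" and ?b = "\<sigma> * (t / m\<^sup>2)"
  have a': "\<bar>?a\<bar> \<le> \<epsilon>" and b': "\<bar>?b\<bar> \<le> \<epsilon>"
    using a b \<open>\<bar>\<sigma>\<bar> = 1\<close> by (auto simp: abs_mult)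
  have ab: "\<bar>?a - ?b\<bar> * m \<le> 3 * \<epsilon> * D"
  proof (cases "m = 0")
    case True
    then show ?thesis using \<epsilon> D0 by simp
  next
    case False
    then have m: "0 < m" using assms by simp
    have eq: "r / n\<^sup>2 - t / m\<^sup>2 = (r - t) / n\<^sup>2 - (t / m\<^sup>2) * ((n - m) * (n + m) / n\<^sup>2)"
      using m \<open>0 < n\<close> by (simp add: field_simps power2_eq_square)
    have 1: "\<bar>(r - t) / n\<^sup>2\<bar> \<le> \<epsilon> * D / n"
      using rt \<open>0 < n\<close> by (simp add: field_simps power2_eq_square)
    have "(n - m) * (n + m) \<le> D * (2 * n)" using assms D0 by (intro mult_mono) auto
    moreover have "0 \<le> (n - m) * (n + m)" using assms by simp
    ultimately have "\<bar>(n - m) * (n + m)\<bar> \<le> D * (2 * n)" by simp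
    then have "\<bar>(n - m) * (n + m) / n\<^sup>2\<bar> \<le> D * (2 * n) / n\<^sup>2"
      unfolding abs_divide by (intro divide_mono) (use \<open>0 < n\<close> in auto)
    also have "\<dots> = D * 2 / n" using \<open>0 < n\<close> by (simp add: power2_eq_square)
    finally have "\<bar>(n - m) * (n + m) / n\<^sup>2\<bar> \<le> D * 2 / n" .
    then have 2: "\<bar>(t / m\<^sup>2) * ((n - m) * (n + m) / n\<^sup>2)\<bar> \<le> \<epsilon> * (D * 2 / n)"
      unfolding abs_mult using b \<epsilon> by (intro mult_mono) auto
    have "\<bar>r / n\<^sup>2 - t / m\<^sup>2\<bar> \<le> \<epsilon> * D / n + \<epsilon> * (D * 2 / n)"
      unfolding eq using 1 2 by linarith
    also have "\<dots> = 3 * \<epsilon> * D / n" by (simp add: algebra_simps add_divide_distrib)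
    finally have "\<bar>r / n\<^sup>2 - t / m\<^sup>2\<bar> * m \<le> 3 * \<epsilon> * D / n * m" using m by (intro mult_right_mono) auto
    also have "\<dots> \<le> 3 * \<epsilon> * D / n * n" using assms D0 by (intro mult_left_mono) auto
    finally have "\<bar>r / n\<^sup>2 - t / m\<^sup>2\<bar> * m \<le> 3 * \<epsilon> * D" using \<open>0 < n\<close> by simp
    moreover have "\<bar>?a - ?b\<bar> = \<bar>r / n\<^sup>2 - t / m\<^sup>2\<bar>"
      using \<open>\<bar>\<sigma>\<bar> = 1\<close> by (metis abs_mult mult_1 right_diff_distrib)
    ultimately show ?thesis by simp
  qed
  have A: "\<bar>sqrt (1 + ?a) - 1\<bar> \<le> \<epsilon>"
  proof -
    have "\<bar>sqrt (1 + ?a) - sqrt (1 + 0)\<bar> \<le> \<bar>?a - 0\<bar>"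
      by (rule sqrt_one_plus_bounds) (use a' \<epsilon> in linarith)+
    then show ?thesis using a' unfolding diff_zero add_0_right real_sqrt_one by (rule order_trans)
  qed
  have B: "\<bar>sqrt (1 + ?a) - sqrt (1 + ?b)\<bar> \<le> \<bar>?a - ?b\<bar>"
    by (rule sqrt_one_plus_bounds) (use a' b' \<epsilon> in linarith)+
  have "(sqrt (1 + ?a) * c - sqrt (1 + ?b) * d) - (c - d)
      = (sqrt (1 + ?a) - 1) * (c - d) + (sqrt (1 + ?a) - sqrt (1 + ?b)) * d"
    by (simp add: algebra_simps)
  also have "\<bar>\<dots>\<bar> \<le> \<bar>sqrt (1 + ?a) - 1\<bar> * \<bar>c - d\<bar> + \<bar>sqrt (1 + ?a) - sqrt (1 + ?b)\<bar> * \<bar>d\<bar>"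
    by (metis abs_mult abs_triangle_ineq)
  also have "\<dots> \<le> \<epsilon> * D + \<bar>?a - ?b\<bar> * m"
    by (rule add_mono[OF mult_mono[OF A \<open>\<bar>c - d\<bar> \<le> D\<close> \<epsilon>(1) abs_ge_zero]
          mult_mono[OF B \<open>\<bar>d\<bar> \<le> m\<close> abs_ge_zero abs_ge_zero]])
  finally show ?thesis using ab by linarith
qed

text \<open>
  A topological Morse lemma.  In coordinates with \<open>H x x = (\<Sum>i. \<sigma> i * x\<^sub>i\<^sup>2)\<close> and
  \<open>n(x)\<^sup>2 = (\<Sum>i. x\<^sub>i\<^sup>2)\<close> write \<open>2 * G x = H x x + R x\<close> and \<open>\<rho> = R / n\<^sup>2\<close>.  Scaling the \<open>i\<close>-th coordinate by
  \<open>sqrt (1 + \<sigma> i * \<rho> x)\<close> adds \<open>\<sigma> i * \<sigma> i * \<rho> * x\<^sub>i\<^sup>2 = \<rho> * x\<^sub>i\<^sup>2\<close> to each term of the form, hence \<open>R x\<close> in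
  total.  This map \<open>M\<close> differs from the identity by a Lipschitz map with a small constant,
  and so it is injective and continuous near \<open>0\<close>; invariance of domain makes it a homeomorphism
  onto an open set of \<open>T\<close>.
\<close>

lemma morse_coordinates:
  fixes G :: "'b::euclidean_space \<Rightarrow> real" and s :: nat
  assumes U: "open U" "0 \<in> U" and dG: "\<And>x. x \<in> U \<Longrightarrow> (G has_derivative G' x) (at x)"
    and d2: "\<And>v. ((\<lambda>x. G' x v) has_derivative (\<lambda>u. H v u)) (at 0)"
    and bil: "bilinear H" and sym: "\<And>u v. H u v = H v u"
    and T: "subspace T" and G0: "G 0 = 0" and crit: "\<And>v. v \<in> T \<Longrightarrow> G' 0 v = 0"
    and b: "\<And>i. i < s \<Longrightarrow> b i \<in> T" and \<sigma>: "\<And>i. i < s \<Longrightarrow> \<sigma> i = 1 \<or> \<sigma> i = (-1::real)"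
    and Hb: "\<And>i j. i < s \<Longrightarrow> j < s \<Longrightarrow> H (b i) (b j) = (if i = j then \<sigma> i else 0)"
    and exp: "\<And>x. x \<in> T \<Longrightarrow> x = (\<Sum>i<s. (\<sigma> i * H x (b i)) *\<^sub>R b i)"
  obtains B M where "openin (top_of_set T) B" "0 \<in> B" "B \<subseteq> U" "continuous_on B M" "inj_on M B"
    "M ` B \<subseteq> T" "M 0 = 0" "\<forall>x\<in>B. H (M x) (M x) = 2 * G x"
proof -
  note add = bilinear_ladd[OF bil] bilinear_radd[OF bil]
    and mul = bilinear_lmul[OF bil] bilinear_rmul[OF bil]
    and sub = bilinear_lsub[OF bil] bilinear_rsub[OF bil]
  define c where "c i x = \<sigma> i * H x (b i)" for i x
  define n where "n x = L2_set (\<lambda>i. c i x) {..<s}" for x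
  have ex: "x = (\<Sum>i<s. c i x *\<^sub>R b i)" if "x \<in> T" for x
    using exp[OF that] by (simp add: c_def)
  have c_diff: "c i (x - y) = c i x - c i y" for i x y
    by (simp add: c_def sub algebra_simps)
  have c_sum: "c j (\<Sum>i<s. a i *\<^sub>R b i) = a j" if "j < s" for j a
  proof -
    have "linear (\<lambda>x. H x (b j))" using bil by (simp add: bilinear_def)
    then have "H (\<Sum>i<s. a i *\<^sub>R b i) (b j) = (\<Sum>i<s. a i * H (b i) (b j))"
      by (subst linear_sum) (auto simp: mul)
    also have "\<dots> = (\<Sum>i<s. if i = j then a i * \<sigma> i else 0)"
      using that by (intro sum.cong) (auto simp: Hb)
    also have "\<dots> = a j * \<sigma> j" using that by simp
    finally show ?thesis using \<sigma>[OF that] by (auto simp: c_def)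
  qed
  have H_exp: "H x x = (\<Sum>i<s. \<sigma> i * (c i x)\<^sup>2)" if "x \<in> T" for x
    unfolding diagonal_form_value[OF bil exp[OF that]]
  proof (rule sum.cong[OF refl])
    fix i assume "i \<in> {..<s}"
    then show "\<sigma> i * (H x (b i))\<^sup>2 = \<sigma> i * (c i x)\<^sup>2"
      using \<sigma>[of i] by (auto simp: c_def)
  qed
  have n0: "0 \<le> n x" for x by (simp add: n_def)
  have c_le_n: "\<bar>c i x\<bar> \<le> n x" if "i < s" for i x
    using member_le_L2_set[of "{..<s}" i "\<lambda>i. \<bar>c i x\<bar>"] that by (simp add: n_def L2_set_def)
  have n_le: "n x \<le> (\<Sum>i<s. \<bar>c i x\<bar>)" for x
    unfolding n_def by (rule L2_set_le_sum_abs)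
  have n_tri: "n (x + y) \<le> n x + n y" for x y
    using L2_set_triangle_ineq[of "\<lambda>i. c i x" "\<lambda>i. c i y" "{..<s}"]
    by (simp add: n_def c_def add algebra_simps)
  have n_scale: "n (a *\<^sub>R x) = \<bar>a\<bar> * n x" for a x
  proof -
    have "c i (a *\<^sub>R x) = a * c i x" for i by (simp add: c_def mul)
    then show ?thesis
      by (simp add: n_def L2_set_def power_mult_distrib flip: sum_distrib_left)
         (simp add: real_sqrt_mult)
  qed
  have n_sq: "(n x)\<^sup>2 = (\<Sum>i<s. (c i x)\<^sup>2)" for x
    by (simp add: n_def L2_set_def sum_nonneg)
  have n_zero: "x = 0" if "n x = 0" "x \<in> T" for x
  proof -
    have "c i x = 0" if "i < s" for i using c_le_n[OF that, of x] \<open>n x = 0\<close> by simp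
    then show ?thesis using ex[OF \<open>x \<in> T\<close>] by simp
  qed
  define K where "K = (\<Sum>i<s. norm (b i))"
  have K0: "0 \<le> K" by (simp add: K_def sum_nonneg)
  have norm_le: "norm x \<le> K * n x" if "x \<in> T" for x
  proof -
    have "norm x = norm (\<Sum>i<s. c i x *\<^sub>R b i)" using ex[OF that] by simp
    also have "\<dots> \<le> (\<Sum>i<s. n x * norm (b i))"
      by (rule sum_norm_le) (simp add: c_le_n mult_right_mono)
    finally show ?thesis by (simp add: K_def sum_distrib_left mult.commute)
  qed
  define R where "R x = 2 * G x - H x x" for x
  define R' where "R' x v = 2 * G' x v - 2 * H x v" for x v
  have dR: "(R has_derivative R' x) (at x)" if "x \<in> U" for x
  proof -
    have bb: "bounded_bilinear H" using bil by (simp add: bilinear_conv_bounded_bilinear)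
    have "((\<lambda>x. H x x) has_derivative (\<lambda>h. H x h + H h x)) (at x)"
      by (rule bounded_bilinear.FDERIV[OF bb]) auto
    then have "(R has_derivative (\<lambda>v. 2 * G' x v - (H x v + H v x))) (at x)"
      unfolding R_def by (intro derivative_intros dG[OF that])
    then show ?thesis unfolding R'_def using sym by (simp add: algebra_simps)
  qed
  \<comment> \<open>keeps the distortion \<open>4 * \<epsilon>\<close> of each coordinate, summed over all \<open>s\<close> coordinates, below one half\<close>
  define \<epsilon> where "\<epsilon> = 1 / (8 * (real s + 1))"
  have \<epsilon>: "0 < \<epsilon>" "\<epsilon> \<le> 1/2" "4 * \<epsilon> * real s < 1"
    by (auto simp: \<epsilon>_def field_simps)
  define e1 where "e1 = \<epsilon> / (2 * real s * K + 1)"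
  have e1: "0 < e1" "2 * real s * K * e1 \<le> \<epsilon>"
  proof -
    have p: "0 < 2 * real s * K + 1" using K0 by (simp add: add_nonneg_pos)
    then show "0 < e1" using \<epsilon> by (simp add: e1_def)
    have "2 * real s * K * e1 \<le> (2 * real s * K + 1) * e1" using \<open>0 < e1\<close> by (intro mult_right_mono) auto
    also have "\<dots> = \<epsilon>" using p by (simp add: e1_def)
    finally show "2 * real s * K * e1 \<le> \<epsilon>" .
  qed
  have "eventually (\<lambda>y. \<forall>i\<in>{..<s}. \<bar>G' y (b i) - H (b i) y\<bar> \<le> e1 * norm y) (nhds 0)"
  proof (intro eventually_ball_finite ballI)
    fix i assume "i \<in> {..<s}"
    then have "G' 0 (b i) = 0" using crit b by simp
    moreover obtain d where "d > 0"
      "\<And>y. norm (y - 0) < d \<Longrightarrow> norm (G' y (b i) - G' 0 (b i) - H (b i) (y - 0)) \<le> e1 * norm (y - 0)"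
      using d2[of "b i"] e1(1) unfolding has_derivative_at_alt by metis
    ultimately show "\<forall>\<^sub>F y in nhds 0. \<bar>G' y (b i) - H (b i) y\<bar> \<le> e1 * norm y"
      unfolding eventually_nhds_metric dist_norm by auto
  qed simp
  then obtain \<delta>1 where \<delta>1: "\<delta>1 > 0"
    "\<And>y i. norm y < \<delta>1 \<Longrightarrow> i < s \<Longrightarrow> \<bar>G' y (b i) - H (b i) y\<bar> \<le> e1 * norm y"
    unfolding eventually_nhds_metric dist_norm by auto
  obtain \<delta>2 where \<delta>2: "\<delta>2 > 0" "ball 0 \<delta>2 \<subseteq> U" using U open_contains_ball by blast
  define \<delta> where "\<delta> = min \<delta>1 \<delta>2"
  define B where "B = T \<inter> ball 0 \<delta>"
  have BU: "B \<subseteq> U" using \<delta>2 by (auto simp: B_def \<delta>_def)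
  have R'_le: "\<bar>R' x v\<bar> \<le> \<epsilon> * n x * n v" if "x \<in> B" "v \<in> T" for x v
  proof -
    have xU: "x \<in> U" and xT: "x \<in> T" and xd: "norm x < \<delta>1" using that BU by (auto simp: B_def \<delta>_def)
    have lin: "linear (R' x)" using dR[OF xU] has_derivative_linear by blast
    have "R' x v = R' x (\<Sum>i<s. c i v *\<^sub>R b i)" using ex[OF that(2)] by simp
    also have "\<dots> = (\<Sum>i<s. c i v * R' x (b i))"
      using lin by (simp add: linear_sum linear_scale)
    finally have "\<bar>R' x v\<bar> = \<bar>\<Sum>i<s. c i v * R' x (b i)\<bar>" by simp
    also have "\<dots> \<le> (\<Sum>i<s. n v * (2 * (e1 * (K * n x))))"
    proof (rule sum_abs[THEN order_trans], rule sum_mono)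
      fix i assume "i \<in> {..<s}"
      then have i: "i < s" by simp
      have "\<bar>R' x (b i)\<bar> = 2 * \<bar>G' x (b i) - H (b i) x\<bar>"
      proof -
        have "R' x (b i) = 2 * (G' x (b i) - H (b i) x)"
          using sym[of x "b i"] unfolding R'_def by (simp only: right_diff_distrib)
        then show ?thesis by (simp only: abs_mult abs_numeral)
      qed
      also have "\<dots> \<le> 2 * (e1 * (K * n x))"
      proof -
        have "e1 * norm x \<le> e1 * (K * n x)" using norm_le[OF xT] e1(1) by (intro mult_left_mono) auto
        from order_trans[OF \<delta>1(2)[OF xd i] this] show ?thesis by (intro mult_left_mono) auto
      qed
      finally show "\<bar>c i v * R' x (b i)\<bar> \<le> n v * (2 * (e1 * (K * n x)))"
        unfolding abs_mult by (intro mult_mono c_le_n i n0) auto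
    qed
    also have "\<dots> = (2 * real s * K * e1) * (n x * n v)" by simp
    also have "\<dots> \<le> \<epsilon> * (n x * n v)" using e1(2) n0 by (intro mult_right_mono) auto
    finally show ?thesis by (simp add: mult.assoc)
  qed
  have conv: "convex B" unfolding B_def using T by (intro convex_Int subspace_imp_convex convex_ball) auto
  have R_diff: "\<bar>R x - R y\<bar> \<le> \<epsilon> * n x * n (x - y)" if "x \<in> B" "y \<in> B" "n y \<le> n x" for x y
  proof -
    define p where "p t = y + t *\<^sub>R (x - y)" for t :: real
    have pB: "p t \<in> B" if "0 \<le> t" "t \<le> 1" for t
    proof -
      have "p t = (1 - t) *\<^sub>R y + t *\<^sub>R x" by (simp add: p_def algebra_simps)
      then show ?thesis using conv \<open>x \<in> B\<close> \<open>y \<in> B\<close> that by (simp add: convex_def)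
    qed
    have np: "n (p t) \<le> n x" if "0 \<le> t" "t \<le> 1" for t
    proof -
      have "p t = (1 - t) *\<^sub>R y + t *\<^sub>R x" by (simp add: p_def algebra_simps)
      then have "n (p t) \<le> n ((1 - t) *\<^sub>R y) + n (t *\<^sub>R x)" using n_tri by simp
      also have "\<dots> = (1 - t) * n y + t * n x" using that by (simp add: n_scale)
      also have "\<dots> \<le> (1 - t) * n x + t * n x" using that \<open>n y \<le> n x\<close> by (intro add_mono mult_left_mono) auto
      finally show ?thesis by (simp add: algebra_simps)
    qed
    have "((\<lambda>t. R (p t)) has_real_derivative R' (p t) (x - y)) (at t)" if "0 \<le> t" "t \<le> 1" for t
    proof -
      have dp: "(p has_derivative (\<lambda>h. h *\<^sub>R (x - y))) (at t)"
        unfolding p_def by (auto intro!: derivative_eq_intros)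
      have lin: "linear (R' (p t))" using dR pB[OF that] BU has_derivative_linear by blast
      have "((\<lambda>t. R (p t)) has_derivative (\<lambda>h. R' (p t) (h *\<^sub>R (x - y)))) (at t)"
        using has_derivative_compose[OF dp dR] pB[OF that] BU by blast
      then show ?thesis
        by (simp add: has_field_derivative_def linear_scale[OF lin] mult.commute[of _ "R' (p t) (x - y)"])
    qed
    then obtain t where t: "0 < t" "t < 1" "R (p 1) - R (p 0) = (1 - 0) * R' (p t) (x - y)"
      using MVT2[of 0 1 "\<lambda>t. R (p t)" "\<lambda>t. R' (p t) (x - y)"] by auto
    have "x - y \<in> T" using that T by (auto simp: B_def subspace_diff)
    then have "\<bar>R' (p t) (x - y)\<bar> \<le> \<epsilon> * n (p t) * n (x - y)" using R'_le pB t by simp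
    also have "\<dots> \<le> \<epsilon> * n x * n (x - y)" using np t \<epsilon> n0 by (intro mult_right_mono mult_left_mono) auto
    finally show ?thesis using t by (simp add: p_def)
  qed
  have zB: "0 \<in> B" using T \<delta>1 \<delta>2 by (simp add: B_def \<delta>_def subspace_0)
  have nz: "n 0 = 0" using n_scale[of 0 0] by simp
  have R0: "R 0 = 0" using G0 by (simp add: R_def bilinear_lzero[OF bil])
  have R_le: "\<bar>R x\<bar> \<le> \<epsilon> * (n x)\<^sup>2" if "x \<in> B" for x
    using R_diff[OF that zB] nz n0 R0 by (simp add: power2_eq_square)
  define \<rho> where "\<rho> x = R x / (n x)\<^sup>2" for x
  define g where "g i x = sqrt (1 + \<sigma> i * \<rho> x) * c i x" for i x
  define M where "M x = (\<Sum>i<s. g i x *\<^sub>R b i)" for x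
  have \<rho>_le: "\<bar>\<rho> x\<bar> \<le> 1/2" if "x \<in> B" for x
  proof (cases "n x = 0")
    case False
    then have "\<bar>\<rho> x\<bar> \<le> \<epsilon>" using R_le[OF that] n0[of x] by (simp add: \<rho>_def field_simps)
    then show ?thesis using \<epsilon> by simp
  qed (simp add: \<rho>_def)
  have main: "\<bar>(g i x - g i y) - (c i x - c i y)\<bar> \<le> 4 * \<epsilon> * n (x - y)"
    if "x \<in> B" "y \<in> B" "i < s" for i x y
  proof -
    have *: "\<bar>(g i x - g i y) - (c i x - c i y)\<bar> \<le> 4 * \<epsilon> * n (x - y)"
      if "x \<in> B" "y \<in> B" "n y \<le> n x" for x y
    proof (cases "n x = 0")
      case True
      then have "x = 0" "y = 0" using that n_zero n0[of y] by (auto simp: B_def)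
      then show ?thesis using nz by simp
    next
      case False
      show ?thesis unfolding g_def \<rho>_def
      proof (rule morse_scaling_estimate)
        show "\<bar>c i x - c i y\<bar> \<le> n (x - y)" using c_le_n[OF \<open>i < s\<close>, of "x - y"] by (simp add: c_diff)
        show "n x - n y \<le> n (x - y)" using n_tri[of y "x - y"] by simp
        show "\<bar>\<sigma> i\<bar> = 1" using \<sigma>[OF \<open>i < s\<close>] by auto
      qed (use that False n0 c_le_n \<open>i < s\<close> R_le R_diff \<epsilon> in \<open>auto simp: less_le\<close>)
    qed
    show ?thesis
    proof (cases "n y \<le> n x")
      case True
      then show ?thesis using * that by blast
    next
      case False
      then have "\<bar>(g i y - g i x) - (c i y - c i x)\<bar> \<le> 4 * \<epsilon> * n (y - x)" using * that by simp
      moreover have "n (y - x) = n (x - y)" using n_scale[of "-1" "x - y"] by simp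
      ultimately show ?thesis by (simp add: abs_le_iff algebra_simps)
    qed
  qed
  have MT: "M x \<in> T" for x
    unfolding M_def using T b by (intro subspace_sum subspace_mul) auto
  have cM: "c i (M x) = g i x" if "i < s" for i x
    unfolding M_def by (rule c_sum[OF that])
  have "inj_on M B"
  proof (rule inj_onI)
    fix x y assume xy: "x \<in> B" "y \<in> B" "M x = M y"
    have "n (x - y) \<le> (\<Sum>i<s. \<bar>c i (x - y)\<bar>)" by (rule n_le)
    also have "\<dots> \<le> (\<Sum>i<s. 4 * \<epsilon> * n (x - y))"
    proof (rule sum_mono)
      fix i assume "i \<in> {..<s}"
      then have i: "i < s" by simp
      have "g i x = g i y" using cM[OF i, of x] cM[OF i, of y] xy(3) by simp
      then show "\<bar>c i (x - y)\<bar> \<le> 4 * \<epsilon> * n (x - y)"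
        using main[OF xy(1,2) i] by (simp add: c_diff abs_minus_commute)
    qed
    also have "\<dots> = (4 * \<epsilon> * real s) * n (x - y)" by simp
    finally have "(1 - 4 * \<epsilon> * real s) * n (x - y) \<le> 0" by (simp add: algebra_simps)
    then have "n (x - y) \<le> 0" using \<epsilon>(3) by (simp add: mult_le_0_iff)
    then have "n (x - y) = 0" using n0 by (simp add: order_antisym)
    then show "x = y" using n_zero[of "x - y"] xy T by (auto simp: B_def subspace_diff)
  qed
  moreover have "continuous_on B M"
  proof -
    have bl: "bounded_linear (c i)" for i
      unfolding c_def using bil
      by (intro bounded_linear_const_mult) (simp add: bilinear_def linear_conv_bounded_linear)
    have cn: "continuous_on B n" unfolding n_def L2_set_def
      by (intro continuous_intros linear_continuous_on bl)
    have "continuous_on B (g i)" if "i < s" for i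
      unfolding continuous_on_def
    proof
      fix y assume y: "y \<in> B"
      have "((\<lambda>x. (g i x - g i y) - (c i x - c i y)) \<longlongrightarrow> 0) (at y within B)"
      proof (rule Lim_null_comparison)
        show "\<forall>\<^sub>F x in at y within B. norm ((g i x - g i y) - (c i x - c i y)) \<le> 4 * \<epsilon> * n (x - y)"
          using main y that by (auto simp: eventually_at_filter)
        have "((\<lambda>x. n (x - y)) \<longlongrightarrow> n (y - y)) (at y within B)"
          unfolding n_def L2_set_def
          by (intro tendsto_intros bounded_linear.tendsto[OF bl])
        then show "((\<lambda>x. 4 * \<epsilon> * n (x - y)) \<longlongrightarrow> 0) (at y within B)"
          using nz by (auto intro!: tendsto_eq_intros)
      qed
      moreover have "(c i \<longlongrightarrow> c i y) (at y within B)"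
        by (intro bounded_linear.tendsto[OF bl] tendsto_intros)
      ultimately have "((\<lambda>x. ((g i x - g i y) - (c i x - c i y)) + (c i x - c i y) + g i y)
          \<longlongrightarrow> 0 + (c i y - c i y) + g i y) (at y within B)"
        by (intro tendsto_intros)
      then show "(g i \<longlongrightarrow> g i y) (at y within B)" by simp
    qed
    then show ?thesis unfolding M_def by (intro continuous_intros) auto
  qed
  moreover have "H (M x) (M x) = 2 * G x" if x: "x \<in> B" for x
  proof -
    have xT: "x \<in> T" using x by (simp add: B_def)
    have "H (M x) (M x) = (\<Sum>i<s. \<sigma> i * ((1 + \<sigma> i * \<rho> x) * (c i x)\<^sup>2))"
      unfolding H_exp[OF MT]
    proof (rule sum.cong[OF refl])
      fix i assume "i \<in> {..<s}"
      then have i: "i < s" by simp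
      have "0 \<le> 1 + \<sigma> i * \<rho> x" using \<rho>_le[OF x] \<sigma>[OF i] by auto
      then show "\<sigma> i * (c i (M x))\<^sup>2 = \<sigma> i * ((1 + \<sigma> i * \<rho> x) * (c i x)\<^sup>2)"
        by (simp add: cM[OF i] g_def power_mult_distrib)
    qed
    also have "\<dots> = (\<Sum>i<s. \<sigma> i * (c i x)\<^sup>2 + \<rho> x * (c i x)\<^sup>2)"
    proof (rule sum.cong[OF refl])
      fix i assume "i \<in> {..<s}"
      then show "\<sigma> i * ((1 + \<sigma> i * \<rho> x) * (c i x)\<^sup>2) = \<sigma> i * (c i x)\<^sup>2 + \<rho> x * (c i x)\<^sup>2"
        using \<sigma>[of i] by (auto simp: algebra_simps)
    qed
    also have "\<dots> = H x x + \<rho> x * (n x)\<^sup>2"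
      by (simp add: sum.distrib H_exp[OF xT] n_sq sum_distrib_left)
    also have "\<rho> x * (n x)\<^sup>2 = R x"
    proof (cases "n x = 0")
      case True
      then show ?thesis using n_zero xT R0 by auto
    qed (simp add: \<rho>_def)
    finally show ?thesis by (simp add: R_def)
  qed
  moreover have "M 0 = 0"
    by (simp add: M_def g_def c_def bilinear_lzero[OF bil])
  moreover have "openin (top_of_set T) B" by (simp add: B_def openin_open_Int)
  ultimately show thesis using that[of B M] zB BU MT by blast
qed

section \<open>Symmetry of the second derivative\<close>

text \<open>
  The mixed second difference of \<open>G\<close> at scale \<open>t\<close> is \<open>t\<^sup>2 * H u v\<close> up to \<open>o(t\<^sup>2)\<close>: apply the mean value
  theorem in the direction \<open>u\<close> to \<open>G(\<cdot> + t v) - G\<close>, and expand the derivative at the origin.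
\<close>

lemma mixed_difference_estimate:
  fixes G :: "'b::euclidean_space \<Rightarrow> real"
  assumes U: "open U" "0 \<in> U" and dG: "\<And>x. x \<in> U \<Longrightarrow> (G has_derivative G' x) (at x)"
    and d2: "\<And>v. ((\<lambda>x. G' x v) has_derivative H v) (at 0)" and "0 < \<epsilon>"
  shows "\<exists>d>0. \<forall>t. 0 < t \<and> t < d \<longrightarrow>
    \<bar>G (t *\<^sub>R u + t *\<^sub>R v) - G (t *\<^sub>R u) - G (t *\<^sub>R v) + G 0 - t * t * H u v\<bar> \<le> \<epsilon> * (t * t)"
proof -
  define C where "C = norm u + norm v"
  define e1 where "e1 = \<epsilon> / (2 * C + 1)"
  have C: "0 \<le> C" by (simp add: C_def)
  then have "0 < 2 * C + 1" by linarith
  then have e1: "0 < e1" "(2 * C + 1) * e1 = \<epsilon>" using \<open>0 < \<epsilon>\<close> by (simp_all add: e1_def)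
  obtain d1 where d1: "d1 > 0"
    "\<And>y. norm (y - 0) < d1 \<Longrightarrow> norm (G' y u - G' 0 u - H u (y - 0)) \<le> e1 * norm (y - 0)"
    using d2[of u] e1(1) unfolding has_derivative_at_alt by metis
  obtain d2' where d2': "d2' > 0" "ball 0 d2' \<subseteq> U" using U open_contains_ball by blast
  have linH: "linear (H u)" using d2 has_derivative_linear by blast
  define d where "d = min d1 d2' / (C + 1)"
  have d: "0 < d" using d1 d2' C by (simp add: d_def)
  have "\<bar>G (t *\<^sub>R u + t *\<^sub>R v) - G (t *\<^sub>R u) - G (t *\<^sub>R v) + G 0 - t * t * H u v\<bar> \<le> \<epsilon> * (t * t)"
    if t: "0 < t" "t < d" for t
  proof -
    have small: "norm (r *\<^sub>R u + q *\<^sub>R v) \<le> t * C \<and> norm (r *\<^sub>R u + q *\<^sub>R v) < min d1 d2'"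
      if "0 \<le> r" "r \<le> t" "0 \<le> q" "q \<le> t" for r q
    proof -
      have "norm (r *\<^sub>R u + q *\<^sub>R v) \<le> r * norm u + q * norm v"
        using norm_triangle_ineq[of "r *\<^sub>R u" "q *\<^sub>R v"] that by simp
      also have "\<dots> \<le> t * norm u + t * norm v" using that by (intro add_mono mult_right_mono) auto
      finally have 1: "norm (r *\<^sub>R u + q *\<^sub>R v) \<le> t * C" by (simp add: C_def algebra_simps)
      have "t * C \<le> t * (C + 1)" using t C by (intro mult_left_mono) auto
      also have "\<dots> < d * (C + 1)" using t C by (intro mult_strict_right_mono) auto
      also have "\<dots> = min d1 d2'" using C by (simp add: d_def)
      finally show ?thesis using 1 by linarith
    qed
    have inU: "r *\<^sub>R u + q *\<^sub>R v \<in> U" if "0 \<le> r" "r \<le> t" "0 \<le> q" "q \<le> t" for r q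
      using small[OF that] d2' by (auto simp: subset_iff)
    define \<psi> where "\<psi> r = G (r *\<^sub>R u + t *\<^sub>R v) - G (r *\<^sub>R u + 0 *\<^sub>R v)" for r
    have der: "((\<lambda>r. G (r *\<^sub>R u + q *\<^sub>R v)) has_real_derivative G' (r *\<^sub>R u + q *\<^sub>R v) u) (at r)"
      if "0 \<le> r" "r \<le> t" "0 \<le> q" "q \<le> t" for r q
    proof -
      have dp: "((\<lambda>r. r *\<^sub>R u + q *\<^sub>R v) has_derivative (\<lambda>h. h *\<^sub>R u)) (at r)"
        by (auto intro!: derivative_eq_intros)
      have lin: "linear (G' (r *\<^sub>R u + q *\<^sub>R v))" using dG[OF inU[OF that]] has_derivative_linear by blast
      show ?thesis
        using has_derivative_compose[OF dp dG[OF inU[OF that]]]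
        by (simp add: has_field_derivative_def linear_scale[OF lin] mult.commute[of _ "G' (r *\<^sub>R u + q *\<^sub>R v) u"])
    qed
    have "(\<psi> has_real_derivative G' (r *\<^sub>R u + t *\<^sub>R v) u - G' (r *\<^sub>R u + 0 *\<^sub>R v) u) (at r)"
      if "0 \<le> r" "r \<le> t" for r
      unfolding \<psi>_def using that t by (intro DERIV_diff der) auto
    then obtain \<xi> where \<xi>: "0 < \<xi>" "\<xi> < t"
      "\<psi> t - \<psi> 0 = (t - 0) * (G' (\<xi> *\<^sub>R u + t *\<^sub>R v) u - G' (\<xi> *\<^sub>R u + 0 *\<^sub>R v) u)"
      using MVT2[of 0 t \<psi> "\<lambda>r. G' (r *\<^sub>R u + t *\<^sub>R v) u - G' (r *\<^sub>R u + 0 *\<^sub>R v) u"] t(1) by auto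
    have est: "\<bar>G' (\<xi> *\<^sub>R u + q *\<^sub>R v) u - G' 0 u - H u (\<xi> *\<^sub>R u + q *\<^sub>R v)\<bar> \<le> e1 * (t * C)"
      if "0 \<le> q" "q \<le> t" for q
    proof -
      note sm = small[of \<xi> q]
      have "\<bar>G' (\<xi> *\<^sub>R u + q *\<^sub>R v) u - G' 0 u - H u (\<xi> *\<^sub>R u + q *\<^sub>R v)\<bar> \<le> e1 * norm (\<xi> *\<^sub>R u + q *\<^sub>R v)"
        using d1(2)[of "\<xi> *\<^sub>R u + q *\<^sub>R v"] sm \<xi> that by simp
      also have "\<dots> \<le> e1 * (t * C)" using sm \<xi> that e1 by (intro mult_left_mono) auto
      finally show ?thesis .
    qed
    have Hd: "H u (\<xi> *\<^sub>R u + t *\<^sub>R v) - H u (\<xi> *\<^sub>R u + 0 *\<^sub>R v) = t * H u v"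
      by (simp add: linear_add[OF linH] linear_scale[OF linH])
    have "\<bar>(G' (\<xi> *\<^sub>R u + t *\<^sub>R v) u - G' (\<xi> *\<^sub>R u + 0 *\<^sub>R v) u) - t * H u v\<bar> \<le> 2 * (e1 * (t * C))"
      using est[of t] est[of 0] t Hd by linarith
    also have "\<dots> = (2 * C * e1) * t" by simp
    also have "\<dots> \<le> \<epsilon> * t" using e1 t C by (intro mult_right_mono) (auto simp: algebra_simps)
    finally have "t * \<bar>(G' (\<xi> *\<^sub>R u + t *\<^sub>R v) u - G' (\<xi> *\<^sub>R u + 0 *\<^sub>R v) u) - t * H u v\<bar> \<le> t * (\<epsilon> * t)"
      using t by (intro mult_left_mono) auto
    moreover have "t * \<bar>(G' (\<xi> *\<^sub>R u + t *\<^sub>R v) u - G' (\<xi> *\<^sub>R u + 0 *\<^sub>R v) u) - t * H u v\<bar>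
        = \<bar>(\<psi> t - \<psi> 0) - t * t * H u v\<bar>"
    proof -
      have "(\<psi> t - \<psi> 0) - t * t * H u v
          = t * ((G' (\<xi> *\<^sub>R u + t *\<^sub>R v) u - G' (\<xi> *\<^sub>R u + 0 *\<^sub>R v) u) - t * H u v)"
        unfolding \<xi>(3) by (simp add: algebra_simps)
      then show ?thesis using t by (simp only: abs_mult abs_of_pos)
    qed
    moreover have "\<psi> t - \<psi> 0 = G (t *\<^sub>R u + t *\<^sub>R v) - G (t *\<^sub>R u) - G (t *\<^sub>R v) + G 0"
      by (simp add: \<psi>_def)
    ultimately show ?thesis by (simp add: mult_ac)
  qed
  then show ?thesis using d by blast
qed

text \<open>
  The mixed second difference is symmetric in \<open>u\<close> and \<open>v\<close>, and so is its leading coefficient.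
\<close>

lemma second_derivative_symmetric:
  fixes G :: "'b::euclidean_space \<Rightarrow> real"
  assumes U: "open U" "0 \<in> U" and dG: "\<And>x. x \<in> U \<Longrightarrow> (G has_derivative G' x) (at x)"
    and d2: "\<And>v. ((\<lambda>x. G' x v) has_derivative H v) (at 0)"
  shows "H u v = H v u"
proof (rule ccontr)
  assume ne: "H u v \<noteq> H v u"
  define \<epsilon> where "\<epsilon> = \<bar>H u v - H v u\<bar> / 3"
  have \<epsilon>: "0 < \<epsilon>" using ne by (simp add: \<epsilon>_def)
  let ?D = "\<lambda>t::real. G (t *\<^sub>R u + t *\<^sub>R v) - G (t *\<^sub>R u) - G (t *\<^sub>R v) + G 0"
  obtain d where d: "d > 0" "\<And>t. 0 < t \<Longrightarrow> t < d \<Longrightarrow> \<bar>?D t - t * t * H u v\<bar> \<le> \<epsilon> * (t * t)"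
    using mixed_difference_estimate[OF U dG d2 \<epsilon>, of u v] by blast
  obtain d' where d': "d' > 0" "\<And>t. 0 < t \<Longrightarrow> t < d' \<Longrightarrow>
      \<bar>G (t *\<^sub>R v + t *\<^sub>R u) - G (t *\<^sub>R v) - G (t *\<^sub>R u) + G 0 - t * t * H v u\<bar> \<le> \<epsilon> * (t * t)"
    using mixed_difference_estimate[OF U dG d2 \<epsilon>, of v u] by blast
  define t where "t = min d d' / 2"
  have t: "0 < t" "t < d" "t < d'" using d d' by (auto simp: t_def)
  have "\<bar>t * t * H u v - t * t * H v u\<bar> \<le> 2 * (\<epsilon> * (t * t))"
    using d(2)[OF t(1,2)] d'(2)[OF t(1,3)] by (simp add: add.commute)
  moreover have "\<bar>t * t * H u v - t * t * H v u\<bar> = (t * t) * (3 * \<epsilon>)"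
    by (simp add: \<epsilon>_def abs_mult flip: right_diff_distrib)
  ultimately have "(t * t) * \<epsilon> \<le> 0" by (simp add: algebra_simps)
  then show False using t(1) \<epsilon> by (simp add: mult_le_0_iff)
qed

lemma second_derivative_bilinear:
  fixes G :: "'b::euclidean_space \<Rightarrow> real"
  assumes U: "open U" "0 \<in> U" and dG: "\<And>x. x \<in> U \<Longrightarrow> (G has_derivative G' x) (at x)"
    and d2: "\<And>v. ((\<lambda>x. G' x v) has_derivative H v) (at 0)"
  shows "bilinear H"
proof -
  have "linear (H v)" for v using d2 has_derivative_linear by blast
  moreover have "(\<lambda>x. H x v) = H v" for v using second_derivative_symmetric[OF assms] by blast
  ultimately show ?thesis by (simp add: bilinear_def)
qed

section \<open>An obstruction to being locally Euclidean\<close>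

lemma homeomorphic_maps_coordinates:
  fixes T :: "'b::euclidean_space set" and s :: nat
  assumes T: "subspace T" and c: "\<And>i. linear (c i)" and b: "\<And>i. i < s \<Longrightarrow> b i \<in> T"
    and cb: "\<And>i j. i < s \<Longrightarrow> j < s \<Longrightarrow> c i (b j) = (if i = j then 1 else 0 :: real)"
    and ex: "\<And>x. x \<in> T \<Longrightarrow> x = (\<Sum>i<s. c i x *\<^sub>R b i)"
  shows "homeomorphic_maps (Euclidean_space s) (top_of_set T)
    (\<lambda>y. \<Sum>i<s. y i *\<^sub>R b i) (\<lambda>x i. if i < s then c i x else 0)"
  unfolding homeomorphic_maps_def
proof (intro conjI ballI)
  have pr: "continuous_map (Euclidean_space s) euclideanreal (\<lambda>y. y i)" for i
    unfolding Euclidean_space_def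
    by (intro continuous_map_from_subtopology continuous_map_product_projection) auto
  show "continuous_map (Euclidean_space s) (top_of_set T) (\<lambda>y. \<Sum>i<s. y i *\<^sub>R b i)"
    unfolding continuous_map_in_subtopology
  proof
    show "continuous_map (Euclidean_space s) euclidean (\<lambda>y. \<Sum>i<s. y i *\<^sub>R b i)"
    proof (intro continuous_map_sum)
      fix i show "continuous_map (Euclidean_space s) euclidean (\<lambda>y. y i *\<^sub>R b i)"
        using continuous_map_compose[OF pr[of i], of euclidean "\<lambda>a. a *\<^sub>R b i"]
        by (simp add: o_def continuous_intros)
    qed simp
    show "(\<lambda>y. \<Sum>i<s. y i *\<^sub>R b i) \<in> topspace (Euclidean_space s) \<rightarrow> T"
      using T b by (auto intro!: subspace_sum subspace_mul)
  qed
  show "continuous_map (top_of_set T) (Euclidean_space s) (\<lambda>x i. if i < s then c i x else 0)"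
    unfolding Euclidean_space_def continuous_map_in_subtopology continuous_map_componentwise_UNIV
  proof (intro conjI allI)
    fix i show "continuous_map (top_of_set T) euclideanreal (\<lambda>x. if i < s then c i x else 0)"
      using c by (simp add: linear_continuous_on linear_linear)
  qed auto
  fix y assume y: "y \<in> topspace (Euclidean_space s)"
  have "c i (\<Sum>j<s. y j *\<^sub>R b j) = y i" if "i < s" for i
  proof -
    have "c i (\<Sum>j<s. y j *\<^sub>R b j) = (\<Sum>j<s. y j * c i (b j))"
      by (simp add: linear_sum[OF c] linear_scale[OF c])
    also have "\<dots> = (\<Sum>j<s. if j = i then y j else 0)"
      using that by (intro sum.cong) (auto simp: cb)
    finally show ?thesis using that by simp
  qed
  then show "(\<lambda>i. if i < s then c i (\<Sum>j<s. y j *\<^sub>R b j) else 0) = y"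
    using y by (auto simp: topspace_Euclidean_space)
next
  fix x assume "x \<in> topspace (top_of_set T)"
  then show "(\<Sum>i<s. (if i < s then c i x else 0) *\<^sub>R b i) = x" using ex by simp
qed

text \<open>
  Diagonalizing the inner product yields the coordinates of an orthonormal basis.
\<close>

lemma subspace_homeomorphic_Euclidean_space:
  fixes F :: "'b::euclidean_space set"
  assumes F: "subspace F"
  shows "top_of_set F homeomorphic_space Euclidean_space (dim F)"
proof -
  have bil: "bilinear (inner :: 'b \<Rightarrow> 'b \<Rightarrow> real)"
    by (simp add: bilinear_conv_bounded_bilinear bounded_bilinear_inner)
  have nd: "\<And>u. u \<in> F \<Longrightarrow> (\<And>v. v \<in> F \<Longrightarrow> inner u v = 0) \<Longrightarrow> u = 0"
    using inner_eq_zero_iff by blast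
  from diagonal_basis[OF bil inner_commute F nd]
  obtain s :: nat and b :: "nat \<Rightarrow> 'b" and \<sigma> :: "nat \<Rightarrow> real"
    where b: "\<forall>i<s. b i \<in> F \<and> (\<sigma> i = 1 \<or> \<sigma> i = -1)"
    "\<forall>i<s. \<forall>j<s. inner (b i) (b j) = (if i = j then \<sigma> i else 0)"
    "\<forall>x\<in>F. x = (\<Sum>i<s. (\<sigma> i * inner x (b i)) *\<^sub>R b i)"
    by blast
  have \<sigma>: "\<sigma> i = 1" if "i < s" for i
  proof -
    have "0 \<le> inner (b i) (b i)" by simp
    then show ?thesis using b(1,2) that by (metis neg_0_le_iff_le not_one_le_zero)
  qed
  have "homeomorphic_maps (Euclidean_space s) (top_of_set F)
      (\<lambda>y. \<Sum>i<s. y i *\<^sub>R b i) (\<lambda>x i. if i < s then inner x (b i) else 0)"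
  proof (rule homeomorphic_maps_coordinates[OF F])
    show "linear (\<lambda>x. inner x (b i))" for i
      by (rule linearI) (auto simp: inner_add_left)
    show "x = (\<Sum>i<s. inner x (b i) *\<^sub>R b i)" if "x \<in> F" for x
      using bspec[OF b(3) that] \<sigma> by simp
  qed (use b \<sigma> in \<open>auto\<close>)
  moreover have "s = dim F"
  proof -
    have inj: "inj_on b {..<s}"
      using b(2) \<sigma> by (intro inj_onI) (metis lessThan_iff zero_neq_one)
    have "independent (b ` {..<s})"
    proof (rule pairwise_orthogonal_independent)
      show "pairwise orthogonal (b ` {..<s})"
        using b(2) by (auto simp: pairwise_def orthogonal_def)
      show "0 \<notin> b ` {..<s}"
        using b(2) \<sigma> by (metis imageE inner_zero_left lessThan_iff zero_neq_one)
    qed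
    moreover have "b ` {..<s} \<subseteq> F" using b(1) by auto
    moreover have "F \<subseteq> span (b ` {..<s})"
    proof
      fix x assume "x \<in> F"
      then have "x = (\<Sum>i<s. (\<sigma> i * inner x (b i)) *\<^sub>R b i)" using b(3) by blast
      then show "x \<in> span (b ` {..<s})"
        by (metis (no_types, lifting) imageI span_base span_scale span_sum)
    qed
    ultimately have "dim F = card (b ` {..<s})" by (metis basis_card_eq_dim)
    then show ?thesis using inj by (simp add: card_image)
  qed
  ultimately show ?thesis
    by (meson homeomorphic_maps_sym homeomorphic_space_def)
qed

text \<open>
  A contractible sphere would be an absolute retract, hence a retract of the ball; the
  antipode of the retraction would contradict Brouwer's fixed point theorem.
\<close>

lemma sphere_in_subspace_not_contractible:
  fixes P :: "'c::euclidean_space set"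
  assumes P: "subspace P" "P \<noteq> {0}" and \<eta>: "0 < \<eta>"
  shows "\<not> contractible (sphere 0 \<eta> \<inter> P)"
proof
  let ?S = "sphere 0 \<eta> \<inter> P" and ?B = "cball 0 \<eta> \<inter> P"
  assume con: "contractible ?S"
  have "interior (cball 0 \<eta>) \<inter> P \<noteq> {}" using P \<eta> subspace_0 by force
  then have rf: "rel_frontier ?B = ?S"
    using convex_affine_rel_frontier_Int[of "cball 0 \<eta>" P] P by (simp add: subspace_imp_affine)
  have cB: "compact ?B" "convex ?B"
    using P by (auto intro: compact_Int_closed closed_subspace convex_Int subspace_imp_convex)
  obtain u where u: "u \<in> P" "u \<noteq> 0" using P subspace_0 by blast
  then have "(\<eta> / norm u) *\<^sub>R u \<in> ?S" using \<eta> P by (simp add: subspace_mul)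
  then have ne: "?S \<noteq> {}" by blast
  have "ANR (rel_frontier ?B)"
    using cB by (intro ANR_rel_frontier_convex) (auto simp: compact_imp_bounded)
  then have "AR ?S" using con ne rf by (simp add: AR_ANR)
  moreover have "closedin (top_of_set ?B) ?S"
    using P by (intro closed_subset) (auto intro: closed_Int closed_subspace)
  ultimately have "?S retract_of ?B" using AR_imp_retract by blast
  then obtain r where r: "continuous_on ?B r" "r \<in> ?B \<rightarrow> ?S" "\<And>x. x \<in> ?S \<Longrightarrow> r x = x"
    unfolding retract_of_def retraction_def by blast
  have "continuous_on ?B (\<lambda>x. - r x)" using r by (intro continuous_intros)
  moreover have "(\<lambda>x. - r x) \<in> ?B \<rightarrow> ?B"
    using r(2) P by (auto simp: Pi_iff subspace_neg)
  moreover have "?B \<noteq> {}" using ne by auto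
  ultimately obtain x where x: "x \<in> ?B" "- r x = x"
    by (metis brouwer[OF cB])
  then have "x \<in> ?S" using r(2) P by (metis Pi_iff subspace_neg Int_iff norm_minus_cancel mem_sphere_0)
  then have "- x = x" using r(3) x by metis
  then have "2 *\<^sub>R x = 0" by (metis add.right_inverse scaleR_2)
  then show False using \<open>x \<in> ?S\<close> \<eta> by auto
qed

text \<open>
  A map of the sphere of \<open>P\<close> into a punctured ball of larger dimension is null-homotopic, since
  maps into a sphere of higher dimension are inessential.  If \<open>\<kappa>\<close> were a left
  inverse of \<open>\<phi>\<close> with values in the punctured \<open>P\<close>, it would carry this homotopy to a contraction of
  the sphere of \<open>P\<close>.
\<close>

lemma retract_of_punctured_space_obstruction:
  fixes P :: "'c::euclidean_space set" and F :: "'f::euclidean_space set"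
  assumes P: "subspace P" "P \<noteq> {0}" and F: "subspace F" "dim P < dim F" and \<eta>: "0 < \<eta>" and q: "q \<in> F"
    and \<phi>: "continuous_on (sphere 0 \<eta> \<inter> P) \<phi>" "\<phi> \<in> sphere 0 \<eta> \<inter> P \<rightarrow> (ball q \<delta> \<inter> F) - {q}"
    and \<kappa>: "continuous_on ((ball q \<delta> \<inter> F) - {q}) \<kappa>" "\<kappa> \<in> (ball q \<delta> \<inter> F) - {q} \<rightarrow> P - {0}"
    and id: "\<And>x. x \<in> sphere 0 \<eta> \<inter> P \<Longrightarrow> \<kappa> (\<phi> x) = x"
  shows False
proof -
  let ?S = "sphere 0 \<eta> \<inter> P" and ?X = "(ball q \<delta> \<inter> F) - {q}"
  obtain u where u: "u \<in> P" "u \<noteq> 0" using P subspace_0 by blast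
  then have "(\<eta> / norm u) *\<^sub>R u \<in> ?S" using \<eta> P by (simp add: subspace_mul)
  then have "\<phi> ((\<eta> / norm u) *\<^sub>R u) \<in> ?X" using \<phi> by blast
  then have \<delta>: "0 < \<delta>" by (metis DiffD1 Int_iff ball_eq_empty empty_iff not_le)
  have affF: "affine F" using F by (simp add: subspace_imp_affine)
  let ?C = "cball q (\<delta>/2) \<inter> F"
  have intne: "interior (cball q (\<delta>/2)) \<inter> F \<noteq> {}" using q \<delta> by force
  have rfC: "rel_frontier ?C = sphere q (\<delta>/2) \<inter> F"
    using convex_affine_rel_frontier_Int[of "cball q (\<delta>/2)" F] affF intne by simp
  have "interior (cball 0 \<eta>) \<inter> P \<noteq> {}" using P \<eta> subspace_0 by force
  then have rfB: "rel_frontier (cball 0 \<eta> \<inter> P) = ?S"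
    using convex_affine_rel_frontier_Int[of "cball 0 \<eta>" P] P by (simp add: subspace_imp_affine)
  have "aff_dim (cball 0 \<eta> \<inter> P) \<le> aff_dim P" by (simp add: aff_dim_subset)
  also have "\<dots> < aff_dim F" using P F by (simp add: aff_dim_subspace)
  also have "aff_dim F = aff_dim ?C"
    using aff_dim_convex_Int_nonempty_interior[of F "cball q (\<delta>/2)"] intne F
    by (simp add: Int_commute subspace_imp_convex)
  finally have dim: "aff_dim (cball 0 \<eta> \<inter> P) < aff_dim ?C" .
  define \<phi>1 where "\<phi>1 x = q + (\<delta>/2 / norm (\<phi> x - q)) *\<^sub>R (\<phi> x - q)" for x
  have \<phi>ne: "\<phi> x \<noteq> q" "\<phi> x \<in> F" "norm (\<phi> x - q) < \<delta>" if "x \<in> ?S" for x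
    using \<phi>(2) that by (auto simp: Pi_iff dist_norm norm_minus_commute)
  have c1: "continuous_on ?S \<phi>1" unfolding \<phi>1_def
    using \<phi>(1) \<phi>ne(1) by (intro continuous_intros) auto
  have i1: "\<phi>1 \<in> ?S \<rightarrow> sphere q (\<delta>/2) \<inter> F"
  proof
    fix x assume x: "x \<in> ?S"
    have "\<phi>1 x \<in> F" unfolding \<phi>1_def
      using F q \<phi>ne[OF x] by (intro subspace_add subspace_mul subspace_diff) auto
    moreover have "norm (\<phi>1 x - q) = \<delta>/2" using \<phi>ne[OF x] \<delta> by (simp add: \<phi>1_def)
    ultimately show "\<phi>1 x \<in> sphere q (\<delta>/2) \<inter> F" by (simp add: dist_norm norm_minus_commute)
  qed
  obtain c where c: "homotopic_with_canon (\<lambda>z. True) ?S (sphere q (\<delta>/2) \<inter> F) \<phi>1 (\<lambda>x. c)"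
  proof (rule inessential_spheremap_lowdim_gen[of "cball 0 \<eta> \<inter> P" ?C \<phi>1])
    show "convex (cball 0 \<eta> \<inter> P)" "convex ?C"
      using P F by (auto intro: convex_Int subspace_imp_convex)
    show "bounded (cball 0 \<eta> \<inter> P)" "bounded ?C" by (auto simp: bounded_Int)
  qed (use dim c1 i1 rfB rfC in auto)
  have c': "homotopic_with_canon (\<lambda>z. True) ?S ?X \<phi>1 (\<lambda>x. c)"
    by (rule homotopic_with_subset_right[OF c]) (use \<delta> in auto)
  have "homotopic_with_canon (\<lambda>z. True) ?S ?X \<phi> \<phi>1"
  proof (rule homotopic_with_linear[OF \<phi>(1) c1])
    fix x assume x: "x \<in> ?S"
    let ?w = "\<phi> x - q" and ?a = "\<delta>/2 / norm (\<phi> x - q)"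
    have w: "0 < norm ?w" "norm ?w < \<delta>" using \<phi>ne[OF x] by auto
    show "closed_segment (\<phi> x) (\<phi>1 x) \<subseteq> ?X"
    proof
      fix y assume "y \<in> closed_segment (\<phi> x) (\<phi>1 x)"
      then obtain t where t: "0 \<le> t" "t \<le> 1" "y = (1 - t) *\<^sub>R \<phi> x + t *\<^sub>R \<phi>1 x"
        unfolding in_segment by blast
      have y: "y - q = ((1 - t) + t * ?a) *\<^sub>R ?w"
        unfolding t(3) \<phi>1_def by (simp add: algebra_simps)
      have a: "0 < ?a" using w \<delta> by simp
      have pos: "0 < (1 - t) + t * ?a"
      proof (cases "t = 1")
        case False
        moreover have "0 \<le> t * ?a" using t(1) a by (intro mult_nonneg_nonneg) auto
        ultimately show ?thesis using t(2) by linarith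
      qed (use a in simp)
      have "norm (y - q) = ((1 - t) + t * ?a) * norm ?w" unfolding y using pos by simp
      also have "\<dots> = (1 - t) * norm ?w + t * (?a * norm ?w)" by (simp only: distrib_right mult.assoc)
      also have "?a * norm ?w = \<delta>/2" using w by simp
      also have "(1 - t) * norm ?w + t * (\<delta>/2) < \<delta>"
      proof (cases "t = 1")
        case False
        then have "(1 - t) * norm ?w < (1 - t) * \<delta>" using t w by (intro mult_strict_left_mono) auto
        moreover have "t * (\<delta>/2) \<le> t * \<delta>" using t \<delta> by (intro mult_left_mono) auto
        ultimately show ?thesis by (simp add: algebra_simps)
      qed (use \<delta> in simp)
      finally have "y \<in> ball q \<delta>" by (simp add: dist_norm norm_minus_commute)
      moreover have "y \<noteq> q" using y pos w by auto
      moreover have "y \<in> F"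
        unfolding t(3) using F \<phi>ne[OF x] i1 x by (intro subspace_add subspace_mul) auto
      ultimately show "y \<in> ?X" by blast
    qed
  qed
  then have h: "homotopic_with_canon (\<lambda>z. True) ?S ?X \<phi> (\<lambda>x. c)"
    using c' homotopic_with_trans by blast
  define \<nu> where "\<nu> y = (\<eta> / norm (\<kappa> y)) *\<^sub>R \<kappa> y" for y
  have \<nu>c: "continuous_on ?X \<nu>"
    unfolding \<nu>_def using \<kappa> by (intro continuous_intros) (auto simp: Pi_iff)
  have \<nu>i: "\<nu> \<in> ?X \<rightarrow> ?S"
  proof
    fix y assume "y \<in> ?X"
    then have "\<kappa> y \<in> P" "\<kappa> y \<noteq> 0" using \<kappa>(2) by auto
    then show "\<nu> y \<in> ?S" using \<eta> P by (simp add: \<nu>_def subspace_mul)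
  qed
  have "homotopic_with_canon (\<lambda>z. True) ?S ?S (\<nu> \<circ> \<phi>) (\<nu> \<circ> (\<lambda>x. c))"
    by (rule homotopic_with_compose_continuous_left[OF h \<nu>c \<nu>i]) 
  then have "homotopic_with_canon (\<lambda>z. True) ?S ?S id (\<nu> \<circ> (\<lambda>x. c))"
    by (rule homotopic_with_eq) (use id \<eta> in \<open>auto simp: \<nu>_def\<close>)
  then have "contractible ?S" unfolding contractible_def o_def by blast
  then show False using sphere_in_subspace_not_contractible[OF P \<eta>] by blast
qed

lemma homeomorphism_iff_homeomorphic_maps:
  "homeomorphism S T f g \<longleftrightarrow> homeomorphic_maps (top_of_set S) (top_of_set T) f g"
proof
  assume "homeomorphism S T f g"
  then show "homeomorphic_maps (top_of_set S) (top_of_set T) f g"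
    unfolding homeomorphism_def homeomorphic_maps_def
    by (simp add: continuous_map_in_subtopology Pi_iff) blast
next
  assume "homeomorphic_maps (top_of_set S) (top_of_set T) f g"
  then have *: "continuous_on S f" "continuous_on T g" "f ` S \<subseteq> T" "g ` T \<subseteq> S"
    "\<And>x. x \<in> S \<Longrightarrow> g (f x) = x" "\<And>y. y \<in> T \<Longrightarrow> f (g y) = y"
    unfolding homeomorphic_maps_def by (simp_all add: continuous_map_in_subtopology image_subset_iff_funcset)
  then show "homeomorphism S T f g" by (intro homeomorphismI) (auto simp: image_subset_iff_funcset)
qed

lemma continuous_map_Euclidean_space_mono:
  assumes "m \<le> n"
  shows "continuous_map (Euclidean_space m) (Euclidean_space n) id"
  unfolding Euclidean_space_def
proof (rule continuous_map_into_subtopology[OF continuous_map_id_subt])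
  show "id \<in> topspace (subtopology (powertop_real UNIV) {x. \<forall>i\<ge>m. x i = 0}) \<rightarrow> {x. \<forall>i\<ge>n. x i = 0}"
    using assms by simp
qed

text \<open>
  Reduces the definition of a singularity to open embeddings into linear subspaces of the
  ambient type.  This loses nothing, since \<open>\<real>\<^sup>n\<close> with \<open>n\<close> larger than the dimension of the ambient
  space does not embed in it.
\<close>

lemma topological_singularityI:
  fixes X :: "'b::euclidean_space set"
  assumes "p \<in> X"
    and no: "\<And>(F::'b set) O' V h k. subspace F \<Longrightarrow> openin (top_of_set X) O' \<Longrightarrow> p \<in> O' \<Longrightarrow>
        openin (top_of_set F) V \<Longrightarrow> homeomorphism O' V h k \<Longrightarrow> False"
  shows "topological_singularity (top_of_set X) p"
  unfolding topological_singularity_def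
proof (intro conjI notI)
  show "p \<in> topspace (top_of_set X)" using \<open>p \<in> X\<close> by simp
  assume "\<exists>N O' n. openin (top_of_set X) O' \<and> p \<in> O' \<and> O' \<subseteq> N \<and> N \<subseteq> topspace (top_of_set X) \<and>
          subtopology (top_of_set X) N homeomorphic_space Euclidean_space n"
  then obtain N O' n where O': "openin (top_of_set X) O'" "p \<in> O'" "O' \<subseteq> N" and N: "N \<subseteq> X"
    and hs: "subtopology (top_of_set X) N homeomorphic_space Euclidean_space n" by auto
  have hN: "top_of_set N homeomorphic_space Euclidean_space n"
    using hs N by (simp add: subtopology_subtopology inf.absorb2)
  show False
  proof (cases "n \<le> DIM('b)")
    case True
    obtain F :: "'b set" where F: "subspace F" "dim F = n"
      using choose_subspace_of_subspace[of n "UNIV :: 'b set"] True by auto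
    have "top_of_set N homeomorphic_space top_of_set F"
      using hN subspace_homeomorphic_Euclidean_space[OF F(1)] F(2)
        homeomorphic_space_sym homeomorphic_space_trans by metis
    then obtain h k where hk: "homeomorphism N F h k"
      unfolding homeomorphic_space_def homeomorphism_iff_homeomorphic_maps by blast
    have "openin (top_of_set N) O'" using O' N openin_subset_trans by blast
    then have "openin (top_of_set F) (h ` O')" using hk homeomorphism_imp_open_map by blast
    moreover have "homeomorphism O' (h ` O') h k"
      by (rule homeomorphism_of_subsets[OF hk]) (use O' hk in \<open>auto simp: homeomorphism_def\<close>)
    ultimately show False using no F O' by blast
  next
    case False
    let ?U = "UNIV :: ('b \<times> real) set"
    have "top_of_set ?U homeomorphic_space Euclidean_space (DIM('b) + 1)"
      using subspace_homeomorphic_Euclidean_space[of ?U] by simp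
    then obtain a where a: "homeomorphic_map (top_of_set ?U) (Euclidean_space (DIM('b) + 1)) a"
      unfolding homeomorphic_space by blast
    obtain g where g: "homeomorphic_map (Euclidean_space n) (top_of_set N) g"
      using hN homeomorphic_space homeomorphic_space_sym by blast
    have le: "DIM('b) + 1 \<le> n" using False by simp
    have "continuous_map (top_of_set ?U) (top_of_set N) (g \<circ> (id \<circ> a))"
      using a g continuous_map_Euclidean_space_mono[OF le]
      by (meson continuous_map_compose homeomorphic_imp_continuous_map)
    then have c: "continuous_on ?U (g \<circ> a)" by (simp add: continuous_map_in_subtopology)
    have sub: "topspace (Euclidean_space (DIM('b) + 1)) \<subseteq> topspace (Euclidean_space n)"
      using le by (auto simp: topspace_Euclidean_space)
    have "inj_on a ?U" "a ` ?U = topspace (Euclidean_space (DIM('b) + 1))"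
      using homeomorphic_imp_injective_map[OF a] homeomorphic_imp_surjective_map[OF a] by auto
    moreover have "inj_on g (topspace (Euclidean_space n))"
      using homeomorphic_imp_injective_map[OF g] .
    ultimately have "inj_on (g \<circ> a) ?U" using sub by (metis comp_inj_on inj_on_subset)
    then have "DIM('b \<times> real) \<le> DIM('b)"
      using invariance_of_dimension[OF c open_UNIV] by blast
    then show False by simp
  qed
qed

text \<open>
  The obstruction.  \<open>Y\<close> contains a copy \<open>i ` P\<close> of the Euclidean space \<open>P\<close> and retracts to it by \<open>r\<close> such
  that only \<open>p\<close> is mapped to the origin, but \<open>Y\<close> has points off the copy arbitrarily close to
  \<open>p\<close>.  If \<open>Y\<close> were locally \<open>F\<close> at \<open>p\<close>, then \<open>dim F < dim P\<close> would contradict the invariance of dimension,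
  \<open>dim F = dim P\<close> would make the copy of \<open>P\<close> a neighbourhood of \<open>p\<close> by invariance of domain, and
  \<open>dim F > dim P\<close> would make a small sphere of \<open>P\<close> contractible in the punctured \<open>P\<close>.
\<close>

lemma not_locally_euclidean_if_retracts:
  fixes Y :: "'b::euclidean_space set" and P :: "'c::euclidean_space set" and F :: "'f::euclidean_space set"
  assumes P: "subspace P" "P \<noteq> {0}"
    and i: "continuous_on P i" "i \<in> P \<rightarrow> Y" "i 0 = p" and r: "continuous_on Y r" "r \<in> Y \<rightarrow> P"
    and ri: "\<And>u. u \<in> P \<Longrightarrow> r (i u) = u" and r0: "\<And>y. y \<in> Y \<Longrightarrow> r y = 0 \<Longrightarrow> y = p"
    and lim: "\<And>N. openin (top_of_set Y) N \<Longrightarrow> p \<in> N \<Longrightarrow> \<exists>y\<in>N. y \<notin> i ` P"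
    and O': "openin (top_of_set Y) O'" "p \<in> O'" and F: "subspace F" "openin (top_of_set F) V"
    and hk: "homeomorphism O' V h k"
  shows False
proof -
  have O'Y: "O' \<subseteq> Y" using O' openin_imp_subset by blast
  have VF: "V \<subseteq> F" using F openin_imp_subset by blast
  have hc: "continuous_on O' h" and kc: "continuous_on V k" and hV: "h ` O' = V" and kO: "k ` V = O'"
    and kh: "\<And>y. y \<in> O' \<Longrightarrow> k (h y) = y" and hk': "\<And>z. z \<in> V \<Longrightarrow> h (k z) = z"
    using hk by (auto simp: homeomorphism_def)
  define P0 where "P0 = {u \<in> P. i u \<in> O'}"
  have P0: "openin (top_of_set P) P0"
    using continuous_openin_preimage[OF i(1,2) O'(1)] by (simp add: P0_def Int_def vimage_def)
  have P0P: "P0 \<subseteq> P" by (auto simp: P0_def)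
  have z: "0 \<in> P0" using P i O' subspace_0 by (auto simp: P0_def)
  have ci: "continuous_on P0 (h \<circ> i)"
  proof (rule continuous_on_compose)
    show "continuous_on P0 i" using i(1) P0P continuous_on_subset by blast
    show "continuous_on (i ` P0) h" using hc by (rule continuous_on_subset) (auto simp: P0_def)
  qed
  have im: "h \<circ> i \<in> P0 \<rightarrow> F" using hV VF by (auto simp: P0_def)
  have inj: "inj_on (h \<circ> i) P0"
  proof (rule inj_onI)
    fix u v assume u: "u \<in> P0" "v \<in> P0" "(h \<circ> i) u = (h \<circ> i) v"
    have m: "u \<in> P" "v \<in> P" "i u \<in> O'" "i v \<in> O'" using u(1,2) by (auto simp: P0_def)
    have "r (k (h (i u))) = r (k (h (i v)))" using u(3) by (simp only: o_apply)
    then show "u = v" unfolding kh[OF m(3)] kh[OF m(4)] ri[OF m(1)] ri[OF m(2)] .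
  qed
  have le: "dim P \<le> dim F"
    using invariance_of_dimension_subspaces[OF P0 P(1) F(1) ci im inj] z by blast
  show False
  proof (cases "dim F \<le> dim P")
    case True
    have "openin (top_of_set F) ((h \<circ> i) ` P0)"
      by (rule invariance_of_domain_subspaces[OF P0 P(1) F(1) True ci im inj])
    moreover have "(h \<circ> i) ` P0 \<subseteq> V" using hV by (auto simp: P0_def)
    ultimately have "openin (top_of_set V) ((h \<circ> i) ` P0)" using VF openin_subset_trans by blast
    then have "openin (top_of_set O') (k ` (h \<circ> i) ` P0)"
      using homeomorphism_imp_open_map[OF homeomorphism_symD[OF hk]] by blast
    moreover have "k ` (h \<circ> i) ` P0 = i ` P0" using kh by (force simp: P0_def image_comp)
    ultimately have "openin (top_of_set Y) (i ` P0)" using O' openin_trans by metis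
    moreover have "p \<in> i ` P0" using z i(3) by force
    ultimately show False using lim[of "i ` P0"] P0P by blast
  next
    case False
    then have lt: "dim P < dim F" by simp
    have hpV: "h p \<in> V" using hV O' by blast
    obtain \<delta> where \<delta>: "0 < \<delta>" "ball (h p) \<delta> \<inter> F \<subseteq> V"
      using F(2) hpV unfolding openin_contains_ball by blast
    have "openin (top_of_set P0) (P0 \<inter> (h \<circ> i) -` (ball (h p) \<delta> \<inter> F))"
      by (rule continuous_openin_preimage[OF ci im]) (simp add: openin_open_Int Int_commute[of "ball (h p) \<delta>"])
    then have "openin (top_of_set P) (P0 \<inter> (h \<circ> i) -` (ball (h p) \<delta> \<inter> F))"
      using P0 openin_trans by blast
    moreover have "0 \<in> P0 \<inter> (h \<circ> i) -` (ball (h p) \<delta> \<inter> F)"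
      using z i(3) \<delta> hpV VF by auto
    ultimately obtain \<eta> where \<eta>: "0 < \<eta>" "cball 0 \<eta> \<inter> P \<subseteq> P0 \<inter> (h \<circ> i) -` (ball (h p) \<delta> \<inter> F)"
      unfolding openin_contains_cball by blast
    let ?S = "sphere 0 \<eta> \<inter> P" and ?X = "(ball (h p) \<delta> \<inter> F) - {h p}"
    have SP0: "?S \<subseteq> P0" and Sb: "\<And>u. u \<in> ?S \<Longrightarrow> h (i u) \<in> ball (h p) \<delta> \<inter> F" using \<eta>(2) by auto
    show False
    proof (rule retract_of_punctured_space_obstruction[OF P F(1) lt \<eta>(1), of "h p" "h \<circ> i" \<delta> "r \<circ> k"])
      show "h p \<in> F" using hpV VF by blast
      show "continuous_on ?S (h \<circ> i)" using ci SP0 continuous_on_subset by blast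
      show "h \<circ> i \<in> ?S \<rightarrow> ?X"
      proof
        fix u assume u: "u \<in> ?S"
        then have uO: "i u \<in> O'" "u \<in> P" using SP0 by (auto simp: P0_def)
        have "h (i u) \<noteq> h p"
        proof
          assume "h (i u) = h p"
          then have "i u = i 0" using kh uO O'(2) i(3) by metis
          then have "u = 0" using ri uO(2) P subspace_0 by metis
          then show False using u \<eta>(1) by simp
        qed
        then show "(h \<circ> i) u \<in> ?X" using Sb[OF u] by simp
      qed
      have XV: "?X \<subseteq> V" using \<delta> by blast
      have "continuous_on ?X k" using kc XV continuous_on_subset by blast
      moreover have "continuous_on (k ` ?X) r" 
        using r(1) XV kO O'Y by (intro continuous_on_subset[OF r(1)]) blast
      ultimately show "continuous_on ?X (r \<circ> k)" by (rule continuous_on_compose)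
      show "r \<circ> k \<in> ?X \<rightarrow> P - {0}"
      proof
        fix y assume y: "y \<in> ?X"
        then have yV: "y \<in> V" using XV by blast
        then have kY: "k y \<in> Y" using kO O'Y by blast
        have "r (k y) \<noteq> 0"
        proof
          assume "r (k y) = 0"
          then have "k y = p" using r0 kY by blast
          then have "y = h p" using hk' yV by metis
          then show False using y by blast
        qed
        then show "(r \<circ> k) y \<in> P - {0}" using r(2) kY by auto
      qed
      show "(r \<circ> k) ((h \<circ> i) u) = u" if "u \<in> ?S" for u
        using that SP0 kh ri by (auto simp: P0_def)
    qed
  qed
qed

text \<open>
  The cone of an indefinite form consists of the points \<open>u + w\<close> with \<open>\<bar>u\<bar> = \<bar>w\<bar>\<close>, where \<open>u\<close> lies in the
  positive and \<open>w\<close> in the negative part.  With \<open>w0\<close> a negative unit vector, \<open>u \<mapsto> u + \<bar>u\<bar> w0\<close> embeds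
  the positive part, the projection to \<open>u\<close> is a retraction that vanishes at the apex only, and
  the points \<open>u - \<bar>u\<bar> w0\<close> lie off the copy.  The factor \<open>A\<close> is carried along.
\<close>

lemma indefinite_cone_not_locally_euclidean:
  fixes A :: "'a::euclidean_space set" and T :: "'b::euclidean_space set" and F :: "'f::euclidean_space set"
    and s :: nat and H :: "'b \<Rightarrow> 'b \<Rightarrow> real"
  assumes A: "subspace A" and bil: "bilinear H" and sym: "\<And>u v. H u v = H v u"
    and T: "subspace T" 
    and b: "\<And>i. i < s \<Longrightarrow> b i \<in> T" and \<sigma>: "\<And>i. i < s \<Longrightarrow> \<sigma> i = 1 \<or> \<sigma> i = (-1::real)"
    and Hb: "\<And>i j. i < s \<Longrightarrow> j < s \<Longrightarrow> H (b i) (b j) = (if i = j then \<sigma> i else 0)"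
    and exp: "\<And>x. x \<in> T \<Longrightarrow> x = (\<Sum>i<s. (\<sigma> i * H x (b i)) *\<^sub>R b i)"
    and ind: "i0 < s" "\<sigma> i0 = 1" "j0 < s" "\<sigma> j0 = -1"
    and O': "openin (top_of_set (A \<times> {x \<in> T. H x x = 0})) O'" "(0, 0) \<in> O'"
    and F: "subspace F" "openin (top_of_set F) V" and hk: "homeomorphism O' V h k"
  shows False
proof -
  note add = bilinear_ladd[OF bil] bilinear_radd[OF bil]
    and mul = bilinear_lmul[OF bil] bilinear_rmul[OF bil]
    and sub = bilinear_lsub[OF bil] bilinear_rsub[OF bil]
    and zero = bilinear_lzero[OF bil] bilinear_rzero[OF bil]
  have bb: "bounded_bilinear H" using bil by (simp add: bilinear_conv_bounded_bilinear)
  define T1 where "T1 = {x \<in> T. \<forall>i<s. \<sigma> i = -1 \<longrightarrow> H x (b i) = 0}"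
  define I where "I = {i. i < s \<and> \<sigma> i = 1}"
  define \<pi> where "\<pi> x = (\<Sum>i\<in>I. H x (b i) *\<^sub>R b i)" for x
  have T1: "subspace T1" using T unfolding T1_def subspace_def by (auto simp: add mul zero)
  have fI: "finite I" by (simp add: I_def)
  have decomp: "H x x = (\<Sum>i<s. \<sigma> i * (H x (b i))\<^sup>2)" if "x \<in> T" for x
    by (rule diagonal_form_value[OF bil exp[OF that]])
  have \<pi>T1: "\<pi> x \<in> T1" for x
    unfolding \<pi>_def
  proof (intro subspace_sum[OF T1] subspace_mul[OF T1])
    fix i assume "i \<in> I"
    then show "b i \<in> T1" using b Hb by (auto simp: T1_def I_def)
  qed
  have \<pi>id: "\<pi> u = u" if "u \<in> T1" for u
  proof -
    have "u = (\<Sum>i<s. (\<sigma> i * H u (b i)) *\<^sub>R b i)" using exp that by (simp add: T1_def)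
    also have "\<dots> = (\<Sum>i\<in>I. (\<sigma> i * H u (b i)) *\<^sub>R b i)"
      using \<sigma> that by (intro sum.mono_neutral_right) (auto simp: I_def T1_def)
    also have "\<dots> = \<pi> u" unfolding \<pi>_def by (intro sum.cong) (auto simp: I_def)
    finally show ?thesis by simp
  qed
  have pos: "0 \<le> H u u" if "u \<in> T1" for u
  proof -
    have "u \<in> T" using that by (simp add: T1_def)
    then have "H u u = (\<Sum>i<s. \<sigma> i * (H u (b i))\<^sup>2)" by (rule decomp)
    also have "0 \<le> \<dots>"
    proof (rule sum_nonneg)
      fix i assume "i \<in> {..<s}"
      then show "0 \<le> \<sigma> i * (H u (b i))\<^sup>2" using \<sigma>[of i] that by (auto simp: T1_def)
    qed
    finally show ?thesis .
  qed
  have \<pi>b: "\<pi> (x + t *\<^sub>R b j0) = \<pi> x" for x t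
    unfolding \<pi>_def using Hb ind by (intro sum.cong) (auto simp: add mul I_def)
  \<comment> \<open>the embedding and the retraction; \<open>b j0\<close> is the negative unit vector \<open>w0\<close>\<close>
  define i where "i = (\<lambda>(z::'a, u). (z, u + sqrt (H u u) *\<^sub>R b j0))"
  define r where "r = (\<lambda>(z::'a, x). (z, \<pi> x))"
  let ?P = "A \<times> T1" and ?Y = "A \<times> {x \<in> T. H x x = 0}"
  show False
  proof (rule not_locally_euclidean_if_retracts[of ?P i ?Y "(0,0)" r O' F V h k])
    show "subspace ?P" using A T1 by (rule subspace_Times)
    have "b i0 \<in> T1" using b Hb ind by (auto simp: T1_def)
    moreover have "b i0 \<noteq> 0" using Hb[of i0 i0] ind zero by fastforce
    ultimately show "?P \<noteq> {0}" using subspace_0[OF A] by (auto simp: zero_prod_def)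
    show "continuous_on ?P i"
      unfolding i_def split_beta
      by (intro continuous_intros bounded_bilinear.continuous_on[OF bb])
    show "i \<in> ?P \<rightarrow> ?Y"
    proof (clarify, simp only: i_def prod.case, intro SigmaI, assumption, intro CollectI conjI)
      fix u assume u: "u \<in> T1"
      then have uT: "u \<in> T" and uj: "H u (b j0) = 0" using ind by (auto simp: T1_def)
      then show "u + sqrt (H u u) *\<^sub>R b j0 \<in> T" using T b ind by (simp add: subspace_add subspace_mul)
      have "H (b j0) u = 0" using uj sym by metis
      then show "H (u + sqrt (H u u) *\<^sub>R b j0) (u + sqrt (H u u) *\<^sub>R b j0) = 0"
        using uj Hb[OF ind(3,3)] ind pos[OF u] by (simp add: add mul)
    qed
    show "i 0 = (0, 0)" by (simp add: i_def zero_prod_def zero)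
    show "continuous_on ?Y r"
      unfolding r_def split_beta \<pi>_def
      by (intro continuous_intros bounded_bilinear.continuous_on[OF bb])
    show "r \<in> ?Y \<rightarrow> ?P" using \<pi>T1 by (auto simp: r_def)
    show "r (i u) = u" if "u \<in> ?P" for u
      using that \<pi>id \<pi>b by (auto simp: r_def i_def)
    show "y = (0, 0)" if "y \<in> ?Y" "r y = 0" for y
    proof -
      obtain z x where y: "y = (z, x)" by (cases y)
      have x: "x \<in> T" "H x x = 0" "\<pi> x = 0" "z = 0" using that y by (auto simp: r_def zero_prod_def)
      have c1: "H x (b l) = 0" if "l \<in> I" for l
      proof -
        have "linear (\<lambda>x. H x (b l))" using bil by (simp add: bilinear_def)
        then have "H (\<pi> x) (b l) = (\<Sum>i\<in>I. H x (b i) * H (b i) (b l))"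
          unfolding \<pi>_def by (subst linear_sum) (auto simp: mul)
        also have "\<dots> = (\<Sum>i\<in>I. if i = l then H x (b i) else 0)"
          using that by (intro sum.cong) (auto simp: Hb I_def)
        also have "\<dots> = H x (b l)" using that fI by simp
        finally show ?thesis using x zero by simp
      qed
      have sg: "\<sigma> l * (H x (b l))\<^sup>2 = - (H x (b l))\<^sup>2" if "l < s" for l
        using \<sigma>[OF that] c1[of l] that by (auto simp: I_def)
      have "0 = (\<Sum>l<s. \<sigma> l * (H x (b l))\<^sup>2)" using decomp x by simp
      also have "\<dots> = - (\<Sum>l<s. (H x (b l))\<^sup>2)" using sg by (simp add: sum_negf)
      finally have "(\<Sum>l<s. (H x (b l))\<^sup>2) = 0" by simp
      then have "\<forall>l\<in>{..<s}. (H x (b l))\<^sup>2 = 0" by (subst (asm) sum_nonneg_eq_0_iff) auto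
      then have "x = 0" using exp[OF x(1)] by simp
      then show ?thesis using y x by simp
    qed
    show "\<exists>y\<in>N. y \<notin> i ` ?P" if N: "openin (top_of_set ?Y) N" "(0, 0) \<in> N" for N
    proof -
      \<comment> \<open>a null vector whose negative coordinate has the wrong sign for the image of \<open>i\<close>\<close>
      define d where "d = b i0 - b j0"
      have dT: "d \<in> T" using T b ind by (simp add: d_def subspace_diff)
      have "H d d = 0" using Hb ind by (auto simp: d_def sub)
      obtain \<epsilon> where \<epsilon>: "0 < \<epsilon>" "ball (0, 0) \<epsilon> \<inter> ?Y \<subseteq> N"
        using N unfolding openin_contains_ball by blast
      define t where "t = \<epsilon> / (2 * (norm d + 1))"
      have t: "0 < t" using \<epsilon> by (simp add: t_def add_nonneg_pos)
      have "t * norm d < \<epsilon>"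
      proof -
        have "t * norm d \<le> t * (norm d + 1)" using t by simp
        also have "\<dots> = \<epsilon> / 2" using add_nonneg_pos[of "norm d" 1] by (simp add: t_def field_simps)
        finally show ?thesis using \<epsilon> by simp
      qed
      then have "(0, t *\<^sub>R d) \<in> ball (0::'a, 0) \<epsilon>" using t by (simp add: dist_norm norm_Pair)
      moreover have "(0, t *\<^sub>R d) \<in> ?Y"
        using subspace_0[OF A] subspace_mul[OF T dT] \<open>H d d = 0\<close> by (simp add: mul)
      ultimately have "(0, t *\<^sub>R d) \<in> N" using \<epsilon> by blast
      moreover have "(0, t *\<^sub>R d) \<notin> i ` ?P"
      proof
        assume "(0, t *\<^sub>R d) \<in> i ` ?P"
        then obtain u where u: "u \<in> T1" "t *\<^sub>R d = u + sqrt (H u u) *\<^sub>R b j0" by (auto simp: i_def)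
        have td: "t *\<^sub>R d = t *\<^sub>R b i0 + (- t) *\<^sub>R b j0" by (simp add: d_def algebra_simps)
        have "H (t *\<^sub>R d) (b j0) = t" unfolding td using Hb ind by (auto simp: add sub mul)
        moreover have "H (u + sqrt (H u u) *\<^sub>R b j0) (b j0) = - sqrt (H u u)"
          using u(1) Hb ind by (auto simp: add mul T1_def)
        ultimately have "t = - sqrt (H u u)" using u(2) by simp
        then show False using t pos[OF u(1)] by (metis neg_0_less_iff_less not_less real_sqrt_ge_0_iff)
      qed
      ultimately show ?thesis by blast
    qed
  qed (use O' F hk in auto)
qed

section \<open>Non-transversality forces the chain to be aligned\<close>

text \<open>
  All tangent vectors below are velocities of curves of this one shape, a class of curves
  that is closed under differentiation.
\<close>

lemma smooth_map_on_trigonometric: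
  fixes A B C :: "'b::euclidean_space"
  shows "smooth_map_on S (\<lambda>t::real. A + cos (\<omega> * t) *\<^sub>R B + sin (\<omega> * t) *\<^sub>R C)"
  unfolding smooth_map_on_def
proof
  fix n
  show "Ck_on n S (\<lambda>t. A + cos (\<omega> * t) *\<^sub>R B + sin (\<omega> * t) *\<^sub>R C)"
  proof (induction n arbitrary: A B C)
    case 0
    show ?case by (auto intro!: continuous_intros)
  next
    case (Suc n)
    have der: "((\<lambda>t. A + cos (\<omega> * t) *\<^sub>R B + sin (\<omega> * t) *\<^sub>R C) has_derivative
        (\<lambda>h. h *\<^sub>R (cos (\<omega> * t) *\<^sub>R (\<omega> *\<^sub>R C) + sin (\<omega> * t) *\<^sub>R (- \<omega> *\<^sub>R B)))) (at t)" for t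
      by (auto intro!: derivative_eq_intros simp: algebra_simps fun_eq_iff)
    have "frechet_derivative (\<lambda>t. A + cos (\<omega> * t) *\<^sub>R B + sin (\<omega> * t) *\<^sub>R C) (at t) v
        = 0 + cos (\<omega> * t) *\<^sub>R (v *\<^sub>R \<omega> *\<^sub>R C) + sin (\<omega> * t) *\<^sub>R (v *\<^sub>R - \<omega> *\<^sub>R B)" for t v
      unfolding frechet_derivative_at[OF der, symmetric] by (simp add: algebra_simps)
    then show ?case
      using Suc.IH[of 0] der unfolding Ck_on.simps differentiable_def by (metis (no_types, lifting) ext)
  qed
qed

lemma tangent_space_trigonometric:
  fixes A B C :: "'b::euclidean_space"
  assumes "0 < \<epsilon>" "A + B = p"
    and "\<And>t. \<bar>t\<bar> < \<epsilon> \<Longrightarrow> A + cos (\<omega> * t) *\<^sub>R B + sin (\<omega> * t) *\<^sub>R C \<in> S"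
  shows "\<omega> *\<^sub>R C \<in> tangent_space S p"
proof -
  let ?\<gamma> = "\<lambda>t::real. A + cos (\<omega> * t) *\<^sub>R B + sin (\<omega> * t) *\<^sub>R C"
  have "(?\<gamma> has_vector_derivative \<omega> *\<^sub>R C) (at 0)"
    by (auto intro!: derivative_eq_intros simp: has_vector_derivative_def algebra_simps fun_eq_iff)
  then show ?thesis
    unfolding tangent_space_def mem_Collect_eq
    using assms smooth_map_on_trigonometric[of "{-\<epsilon><..<\<epsilon>}" A \<omega> B C]
    by (intro exI[of _ ?\<gamma>] exI[of _ \<epsilon>]) (auto simp: abs_less_iff)
qed

lemma image_differential_work_map:
  fixes S :: "('a::euclidean_space ^ 'v::finite) set"
  shows
  "image_differential S (work_map xe) p = (\<lambda>w. w $ xe) ` tangent_space S p"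
proof -
  have "((\<lambda>w::'a ^ 'v. w $ xe) has_derivative (\<lambda>w. w $ xe)) (at p)"
    by (rule bounded_linear_imp_has_derivative) (rule bounded_linear_vec_nth)
  from frechet_derivative_at[OF this]
  have "frechet_derivative (work_map xe) (at p) = (\<lambda>w. w $ xe)"
    by (simp add: work_map_def[abs_def])
  then show ?thesis by (simp add: image_differential_def)
qed

lemma pointed_config_space_isometry:
  fixes R :: "'a::euclidean_space \<Rightarrow> 'a" and \<phi> :: "'a ^ 'v::finite"
  assumes R: "linear R" "\<And>u. norm (R u) = norm u" and \<phi>: "\<phi> \<in> pointed_config_space \<Gamma> xs"
  shows "(\<chi> v. R (\<phi> $ v)) \<in> pointed_config_space \<Gamma> xs"
proof -
  have R0: "R 0 = 0" using R(1) by (rule linear_0)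
  have eq: "R u = R v \<longleftrightarrow> u = v" for u v
    using R(2)[of "u - v"] linear_diff[OF R(1), of u v] by (metis norm_eq_zero right_minus_eq)
  have nd: "norm (R u - R v) = norm (u - v)" for u v
    using R(2)[of "u - v"] linear_diff[OF R(1), of u v] by simp
  show ?thesis
    using \<phi> by (simp add: pointed_config_space_def config_space_def embeddings_def inj_on_def eq nd R0)
qed

text \<open>
  The rotation by the angle \<open>t\<close> in the oriented plane of \<open>p\<close> and \<open>q\<close>, which fixes the orthogonal
  complement of the plane.
\<close>

lemma plane_rotation_isometry:
  fixes p q :: "'a::euclidean_space"
  assumes pq: "norm p = 1" "norm q = 1" "inner p q = 0"
  shows "norm (u + (cos t - 1) *\<^sub>R (inner u p *\<^sub>R p + inner u q *\<^sub>R q)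
      + sin t *\<^sub>R (inner u p *\<^sub>R q - inner u q *\<^sub>R p)) = norm u"
proof -
  define \<alpha> \<beta> where "\<alpha> = inner u p" and "\<beta> = inner u q"
  define A B where "A = (cos t - 1) * \<alpha> - sin t * \<beta>" and "B = (cos t - 1) * \<beta> + sin t * \<alpha>"
  have pp: "inner p p = 1" "inner q q = 1" using pq by (simp_all add: dot_square_norm)
  have qp: "inner q p = 0" using pq by (simp add: inner_commute)
  have e: "u + (cos t - 1) *\<^sub>R (inner u p *\<^sub>R p + inner u q *\<^sub>R q)
      + sin t *\<^sub>R (inner u p *\<^sub>R q - inner u q *\<^sub>R p) = u + A *\<^sub>R p + B *\<^sub>R q"
    by (simp add: A_def B_def \<alpha>_def \<beta>_def algebra_simps)
  have sc: "sin t * sin t = 1 - cos t * cos t"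
    using sin_cos_squared_add[of t] by (simp add: power2_eq_square algebra_simps)
  have "inner (u + A *\<^sub>R p + B *\<^sub>R q) (u + A *\<^sub>R p + B *\<^sub>R q)
      = inner u u + 2 * A * \<alpha> + 2 * B * \<beta> + A * A + B * B"
    by (simp add: inner_simps pp qp pq(3) \<alpha>_def \<beta>_def inner_commute[of p u] inner_commute[of q u])
       (simp add: algebra_simps)
  moreover have "2 * A * \<alpha> + 2 * B * \<beta> + A * A + B * B
      = (\<alpha> * \<alpha> + \<beta> * \<beta>) * (2 * (cos t - 1) + (cos t - 1) * (cos t - 1) + sin t * sin t)"
    unfolding A_def B_def by algebra
  moreover have "2 * (cos t - 1) + (cos t - 1) * (cos t - 1) + sin t * sin t = 0"
    unfolding sc by (simp add: algebra_simps)
  ultimately have "inner (u + A *\<^sub>R p + B *\<^sub>R q) (u + A *\<^sub>R p + B *\<^sub>R q) = inner u u"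
    by simp
  then show ?thesis unfolding e by (simp add: norm_eq_sqrt_inner)
qed

text \<open>
  Rotating the whole configuration about the base-point moves the end-effector in every
  direction perpendicular to its position.
\<close>

lemma rotation_in_image_differential:
  fixes \<phi> :: "'a::euclidean_space ^ 'v::finite"
  assumes \<phi>: "\<phi> \<in> pointed_config_space \<Gamma> xs" and ne: "\<phi> $ xe \<noteq> 0" and a: "inner a (\<phi> $ xe) = 0"
  shows "a \<in> image_differential (pointed_config_space \<Gamma> xs) (work_map xe) \<phi>"
proof (cases "a = 0")
  case True
  have "0 *\<^sub>R 0 \<in> tangent_space (pointed_config_space \<Gamma> xs) \<phi>"
    by (rule tangent_space_trigonometric[of 1 \<phi> 0]) (use \<phi> in auto)
  then show ?thesis using True unfolding image_differential_work_map by (force simp: image_iff)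
next
  case False
  define p q where "p = sgn (\<phi> $ xe)" and "q = sgn a"
  have pq: "norm p = 1" "norm q = 1" "inner p q = 0"
    using ne False a by (auto simp: p_def q_def norm_sgn sgn_div_norm inner_commute)
  define \<omega> where "\<omega> = norm a / norm (\<phi> $ xe)"
  define B where "B = (\<chi> v. inner (\<phi> $ v) p *\<^sub>R p + inner (\<phi> $ v) q *\<^sub>R q)"
  define C where "C = (\<chi> v. inner (\<phi> $ v) p *\<^sub>R q - inner (\<phi> $ v) q *\<^sub>R p)"
  have "\<omega> *\<^sub>R C \<in> tangent_space (pointed_config_space \<Gamma> xs) \<phi>"
  proof (rule tangent_space_trigonometric[of 1 "\<phi> - B" B])
    fix t :: real
    let ?R = "\<lambda>u. u + (cos (\<omega> * t) - 1) *\<^sub>R (inner u p *\<^sub>R p + inner u q *\<^sub>R q)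
      + sin (\<omega> * t) *\<^sub>R (inner u p *\<^sub>R q - inner u q *\<^sub>R p)"
    have "linear ?R" by (rule linearI) (simp_all add: inner_simps algebra_simps)
    then have "(\<chi> v. ?R (\<phi> $ v)) \<in> pointed_config_space \<Gamma> xs"
      using plane_rotation_isometry[OF pq] \<phi> by (rule pointed_config_space_isometry)
    moreover have "(\<chi> v. ?R (\<phi> $ v)) = \<phi> - B + cos (\<omega> * t) *\<^sub>R B + sin (\<omega> * t) *\<^sub>R C"
      by (simp add: vec_eq_iff B_def C_def algebra_simps)
    ultimately show "\<phi> - B + cos (\<omega> * t) *\<^sub>R B + sin (\<omega> * t) *\<^sub>R C \<in> pointed_config_space \<Gamma> xs" by simp
  qed auto
  moreover have "(\<omega> *\<^sub>R C) $ xe = a"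
  proof -
    have "inner (\<phi> $ xe) p = norm (\<phi> $ xe)"
      using ne by (simp add: p_def sgn_div_norm dot_square_norm power2_eq_square)
    moreover have "inner (\<phi> $ xe) q = 0" using a by (simp add: q_def sgn_div_norm inner_commute)
    ultimately show ?thesis using ne False by (simp add: C_def \<omega>_def q_def sgn_div_norm)
  qed
  ultimately show ?thesis unfolding image_differential_work_map by (metis imageI)
qed

text \<open>
  Turning the single link \<open>j\<close> translates the vertices behind it and fixes those before it.
  Distinct vertices of the chain remain distinct for a short time.
\<close>

lemma chain_link_rotation_in_image_differential:
  fixes \<phi> :: "'a::euclidean_space ^ 'v::finite"
  assumes \<phi>: "\<phi> \<in> pointed_config_space (chain_linkage \<Gamma> x k) (x 0)" and inj: "inj_on x {..k}" and j: "j < k"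
    and b: "inner b (\<phi> $ x (Suc j) - \<phi> $ x j) = 0"
  shows "b \<in> image_differential (pointed_config_space (chain_linkage \<Gamma> x k) (x 0)) (work_map (x k)) \<phi>"
proof (cases "b = 0")
  case True
  have "0 *\<^sub>R 0 \<in> tangent_space (pointed_config_space (chain_linkage \<Gamma> x k) (x 0)) \<phi>"
    by (rule tangent_space_trigonometric[of 1 \<phi> 0]) (use \<phi> in auto)
  then show ?thesis using True unfolding image_differential_work_map by (force simp: image_iff)
next
  case False
  let ?S = "pointed_config_space (chain_linkage \<Gamma> x k) (x 0) :: ('a ^ 'v) set"
  define w where "w = \<phi> $ x (Suc j) - \<phi> $ x j"
  have xeq: "x i = x i' \<longleftrightarrow> i = i'" if "i \<le> k" "i' \<le> k" for i i'
    using inj that by (auto simp: inj_on_def)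
  have emb: "inj_on (\<lambda>v. \<phi> $ v) (x ` {..k})" "\<And>v. v \<notin> x ` {..k} \<Longrightarrow> \<phi> $ v = 0" "\<phi> $ x 0 = 0"
    and len: "\<And>u v. {u, v} \<in> chain_links x k \<Longrightarrow> (norm (\<phi> $ u - \<phi> $ v))\<^sup>2 = (len \<Gamma> {u, v})\<^sup>2"
    using \<phi> by (auto simp: pointed_config_space_def config_space_def embeddings_def chain_linkage_def)
  have w0: "w \<noteq> 0"
  proof
    assume "w = 0"
    then have "x (Suc j) = x j" using j emb(1) by (auto simp: w_def inj_on_def)
    then show False using xeq[of "Suc j" j] j by simp
  qed
  define \<omega> where "\<omega> = norm b / norm w"
  have \<omega>: "0 < \<omega>" using False w0 by (simp add: \<omega>_def)
  define Z where "Z = x ` {j<..k}"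
  \<comment> \<open>the turned link is \<open>cos (\<omega> * t) *\<^sub>R w + sin (\<omega> * t) *\<^sub>R (1 / \<omega>) *\<^sub>R b\<close>, with initial velocity \<open>b\<close>\<close>
  define B :: "'a ^ 'v" where "B = (\<chi> v. if v \<in> Z then w else 0)"
  define C :: "'a ^ 'v" where "C = (\<chi> v. if v \<in> Z then (1 / \<omega>) *\<^sub>R b else 0)"
  define \<gamma> where "\<gamma> t = \<phi> - B + cos (\<omega> * t) *\<^sub>R B + sin (\<omega> * t) *\<^sub>R C" for t
  have xZ: "x i \<in> Z \<longleftrightarrow> j < i" if "i \<le> k" for i using that xeq by (auto simp: Z_def)
  have cont: "isCont (\<lambda>t. \<gamma> t $ v) 0" for v unfolding \<gamma>_def by (intro continuous_intros)
  have \<gamma>0: "\<gamma> 0 = \<phi>" by (simp add: \<gamma>_def)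
  have "eventually (\<lambda>t. \<forall>u\<in>x ` {..k}. \<forall>v\<in>x ` {..k}. u \<noteq> v \<longrightarrow> \<gamma> t $ u \<noteq> \<gamma> t $ v) (nhds 0)"
  proof (intro eventually_ball_finite ballI)
    fix u v assume uv: "u \<in> x ` {..k}" "v \<in> x ` {..k}"
    show "\<forall>\<^sub>F t in nhds 0. u \<noteq> v \<longrightarrow> \<gamma> t $ u \<noteq> \<gamma> t $ v"
    proof (cases "u = v")
      case False
      have "((\<lambda>t. \<gamma> t $ u - \<gamma> t $ v) \<longlongrightarrow> \<gamma> 0 $ u - \<gamma> 0 $ v) (nhds 0)"
      proof (rule tendsto_diff)
        show "((\<lambda>t. \<gamma> t $ u) \<longlongrightarrow> \<gamma> 0 $ u) (nhds 0)"
          using cont[of u] tendsto_at_iff_tendsto_nhds[of "\<lambda>t. \<gamma> t $ u" 0] by (simp add: isCont_def)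
        show "((\<lambda>t. \<gamma> t $ v) \<longlongrightarrow> \<gamma> 0 $ v) (nhds 0)"
          using cont[of v] tendsto_at_iff_tendsto_nhds[of "\<lambda>t. \<gamma> t $ v" 0] by (simp add: isCont_def)
      qed
      moreover have "\<gamma> 0 $ u - \<gamma> 0 $ v \<noteq> 0" using False uv emb(1) by (auto simp: \<gamma>0 inj_on_def)
      ultimately have "\<forall>\<^sub>F t in nhds 0. \<gamma> t $ u - \<gamma> t $ v \<noteq> 0" by (rule tendsto_imp_eventually_ne)
      then show ?thesis by (rule eventually_mono) auto
    qed simp
  qed auto
  then obtain \<epsilon> where \<epsilon>: "0 < \<epsilon>"
    "\<And>t u v. \<bar>t\<bar> < \<epsilon> \<Longrightarrow> u \<in> x ` {..k} \<Longrightarrow> v \<in> x ` {..k} \<Longrightarrow> u \<noteq> v \<Longrightarrow> \<gamma> t $ u \<noteq> \<gamma> t $ v"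
    unfolding eventually_nhds_metric dist_norm by auto
  have "\<omega> *\<^sub>R C \<in> tangent_space ?S \<phi>"
  proof (rule tangent_space_trigonometric[OF \<epsilon>(1), of "\<phi> - B" B])
    fix t :: real assume t: "\<bar>t\<bar> < \<epsilon>"
    have link: "norm (\<gamma> t $ x (Suc i) - \<gamma> t $ x i) = norm (\<phi> $ x (Suc i) - \<phi> $ x i)" if "i < k" for i
    proof (cases "i = j")
      case True
      have "\<gamma> t $ x (Suc i) - \<gamma> t $ x i = cos (\<omega> * t) *\<^sub>R w + sin (\<omega> * t) *\<^sub>R (1 / \<omega>) *\<^sub>R b"
        using j by (simp add: True \<gamma>_def B_def C_def xZ w_def)
      moreover have "(norm (cos (\<omega> * t) *\<^sub>R w + sin (\<omega> * t) *\<^sub>R (1 / \<omega>) *\<^sub>R b))\<^sup>2 = (norm w)\<^sup>2"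
      proof -
        have "inner b w = 0" "inner w b = 0" using b by (simp_all add: w_def inner_commute)
        then have "(norm (cos (\<omega> * t) *\<^sub>R w + sin (\<omega> * t) *\<^sub>R (1 / \<omega>) *\<^sub>R b))\<^sup>2
            = (cos (\<omega> * t))\<^sup>2 * (norm w)\<^sup>2 + (sin (\<omega> * t))\<^sup>2 * ((norm b)\<^sup>2 / \<omega>\<^sup>2)"
          using \<omega> unfolding power2_norm_eq_inner by (simp add: inner_simps power2_eq_square)
        also have "(norm b)\<^sup>2 / \<omega>\<^sup>2 = (norm w)\<^sup>2"
          using False w0 by (simp add: \<omega>_def power_divide)
        finally show ?thesis by (simp flip: distrib_right)
      qed
      ultimately show ?thesis by (simp add: True w_def)
    next
      case False
      then have "\<gamma> t $ x (Suc i) - \<gamma> t $ x i = \<phi> $ x (Suc i) - \<phi> $ x i"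
        using that by (simp add: \<gamma>_def B_def C_def xZ less_Suc_eq)
      then show ?thesis by simp
    qed
    have "(norm (\<gamma> t $ u - \<gamma> t $ v))\<^sup>2 = (len \<Gamma> {u, v})\<^sup>2" if uv: "{u, v} \<in> chain_links x k" for u v
    proof -
      obtain i where i: "i < k" "{u, v} = {x i, x (Suc i)}" using uv by (auto simp: chain_links_def)
      then have "norm (\<gamma> t $ u - \<gamma> t $ v) = norm (\<phi> $ u - \<phi> $ v)"
        using link[OF i(1)] by (auto simp: doubleton_eq_iff norm_minus_commute)
      then show ?thesis using len[OF uv] by simp
    qed
    moreover have "inj_on (\<lambda>v. \<gamma> t $ v) (x ` {..k})" using \<epsilon>(2)[OF t] by (meson inj_onI)
    moreover have "\<gamma> t $ v = 0" if "v \<notin> x ` {..k}" for v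
      using that emb(2) by (auto simp: \<gamma>_def B_def C_def Z_def)
    moreover have "\<gamma> t $ x 0 = 0" using emb(3) xZ[of 0] by (simp add: \<gamma>_def B_def C_def)
    ultimately have "\<gamma> t \<in> ?S"
      by (simp add: pointed_config_space_def config_space_def embeddings_def chain_linkage_def)
    then show "\<phi> - B + cos (\<omega> * t) *\<^sub>R B + sin (\<omega> * t) *\<^sub>R C \<in> ?S" by (simp add: \<gamma>_def)
  qed simp
  moreover have "(\<omega> *\<^sub>R C) $ x k = b" using \<omega> xZ[of k] j by (simp add: C_def)
  ultimately show ?thesis unfolding image_differential_work_map by (metis imageI)
qed

text \<open>
  The images of the two differentials contain all vectors perpendicular to \<open>v0 = \<V> $ x k\<close>, and
  all vectors perpendicular to the link \<open>w\<close>.  If \<open>w\<close> is not parallel to \<open>v0\<close>, these span the whole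
  space: the component \<open>b\<close> of \<open>v0\<close> perpendicular to \<open>w\<close> is not perpendicular to \<open>v0\<close>.
\<close>

lemma nontransverse_chain_aligned:
  fixes \<V> :: "'a::euclidean_space ^ 'v::finite"
  assumes lk: "is_linkage \<Gamma>" and ch: "is_open_chain_in \<Gamma> x k"
    and \<V>: "\<V> \<in> pointed_config_space \<Gamma> (x 0)"
    and nt: "\<not> transverse_configuration \<Gamma> x k \<V>" and ne: "\<V> $ x k \<noteq> 0" and j: "j < k"
  shows "\<exists>\<epsilon>. (\<epsilon> = 1 \<or> \<epsilon> = -1) \<and>
    \<V> $ x (Suc j) - \<V> $ x j = (\<epsilon> * len \<Gamma> {x j, x (Suc j)}) *\<^sub>R sgn (\<V> $ x k)"
proof -
  define v0 where "v0 = \<V> $ x k"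
  define w where "w = \<V> $ x (Suc j) - \<V> $ x j"
  let ?S1 = "pointed_config_space (chain_linkage \<Gamma> x k) (x 0) :: ('a ^ 'v) set"
  let ?S2 = "pointed_config_space (complementary_linkage \<Gamma> x k) (x 0) :: ('a ^ 'v) set"
  have parts: "complement_part \<Gamma> x k \<V> \<in> ?S2" "chain_part \<Gamma> x k \<V> \<in> ?S1"
    using pointed_config_space_pullback[OF lk ch, of \<V>] \<V> by auto
  have inj: "inj_on x {..k}" and sub: "x ` {..k} \<subseteq> verts \<Gamma>" and cl: "chain_links x k \<subseteq> links \<Gamma>"
    using ch by (auto simp: is_open_chain_in_def)
  have cp: "chain_part \<Gamma> x k \<V> $ x i = \<V> $ x i" if "i \<le> k" for i
    using that by (simp add: chain_part_def restrict_config_def chain_linkage_def)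
  have "x k \<notin> x ` {0<..<k}" by (auto dest!: inj_onD[OF inj])
  then have kp: "complement_part \<Gamma> x k \<V> $ x k = v0"
    using sub by (auto simp: complement_part_def restrict_config_def complementary_linkage_def v0_def)
  have inlinks: "{x (Suc j), x j} \<in> links \<Gamma>"
    using cl j by (auto simp: chain_links_def insert_commute)
  then have "0 < len \<Gamma> {x (Suc j), x j}" using lk unfolding is_linkage_def by blast
  moreover have "(norm w)\<^sup>2 = (len \<Gamma> {x (Suc j), x j})\<^sup>2"
    using \<V> inlinks by (simp add: pointed_config_space_def config_space_def w_def)
  ultimately have nw: "norm w = len \<Gamma> {x j, x (Suc j)}" and l0: "0 < len \<Gamma> {x j, x (Suc j)}"
    by (simp_all add: insert_commute power2_eq_iff_nonneg)
  then have w0: "w \<noteq> 0" by auto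
  define b where "b = v0 - (inner v0 w / (norm w)\<^sup>2) *\<^sub>R w"
  have bw: "inner b w = 0" using w0 by (simp add: b_def inner_simps power2_norm_eq_inner)
  have bv: "inner b v0 = (norm b)\<^sup>2"
  proof -
    have "inner b b = inner b v0 - (inner v0 w / (norm w)\<^sup>2) * inner b w"
      by (subst (2) b_def) (simp add: inner_simps)
    then show ?thesis using bw by (simp add: power2_norm_eq_inner)
  qed
  have "b = 0"
  proof (rule ccontr)
    assume b0: "b \<noteq> 0"
    have "z \<in> {a + b |a b. a \<in> image_differential ?S1 (work_map (x k)) (chain_part \<Gamma> x k \<V>) \<and>
        b \<in> image_differential ?S2 (work_map (x k)) (complement_part \<Gamma> x k \<V>)}" for z
    proof -
      \<comment> \<open>chosen such that \<open>z - c *\<^sub>R b\<close> is perpendicular to \<open>v0\<close>\<close>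
      define c where "c = inner z v0 / inner b v0"
      have "c *\<^sub>R b \<in> image_differential ?S1 (work_map (x k)) (chain_part \<Gamma> x k \<V>)"
        by (rule chain_link_rotation_in_image_differential[OF parts(2) inj j])
           (use j bw in \<open>simp add: cp w_def\<close>)
      moreover have "z - c *\<^sub>R b \<in> image_differential ?S2 (work_map (x k)) (complement_part \<Gamma> x k \<V>)"
        by (rule rotation_in_image_differential[OF parts(1)])
           (use ne b0 bv in \<open>simp_all add: kp v0_def c_def inner_simps\<close>)
      moreover have "z = c *\<^sub>R b + (z - c *\<^sub>R b)" by simp
      ultimately show ?thesis by blast
    qed
    then have "transverse_configuration \<Gamma> x k \<V>" unfolding transverse_configuration_def by blast
    then show False using nt by blast
  qed
  define t where "t = inner v0 w / (norm w)\<^sup>2"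
  have v0: "v0 = t *\<^sub>R w" using \<open>b = 0\<close> by (simp add: b_def t_def)
  have t0: "t \<noteq> 0" using v0 ne by (auto simp: v0_def)
  have "sgn v0 = (sgn t / norm w) *\<^sub>R w"
    unfolding v0 by (simp add: sgn_scaleR) (simp add: sgn_div_norm divide_inverse)
  then have "(sgn t * norm w) *\<^sub>R sgn v0 = w"
    using t0 w0 by (simp add: sgn_if)
  moreover have "sgn t = 1 \<or> sgn t = -1" using t0 by (simp add: sgn_if)
  ultimately show ?thesis using nw by (metis v0_def w_def)
qed

section \<open>The length of a chain near an aligned configuration\<close>

lemma smooth_map_on_imp_twice_differentiable:
  assumes "smooth_map_on U f"
  shows "x \<in> U \<Longrightarrow> f differentiable (at x)"
    and "x \<in> U \<Longrightarrow> (\<lambda>y. frechet_derivative f (at y) v) differentiable (at x)"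
proof -
  have "Ck_on (Suc (Suc 0)) U f" using assms unfolding smooth_map_on_def by blast
  then show "x \<in> U \<Longrightarrow> f differentiable (at x)"
    "x \<in> U \<Longrightarrow> (\<lambda>y. frechet_derivative f (at y) v) differentiable (at x)"
    unfolding Ck_on.simps by blast+
qed

text \<open>
  \<open>\<Psi>\<close> takes values in a space of several dimensions, so the derivative of the composition is
  expanded in a basis before it is differentiated again.
\<close>

lemma second_derivative_compose:
  fixes f :: "'b::euclidean_space \<Rightarrow> real" and \<Psi> :: "'c::euclidean_space \<Rightarrow> 'b"
  assumes f: "smooth_map_on U f" and \<Psi>: "smooth_map_on W \<Psi>" and W: "open W" "\<Psi> ` W \<subseteq> U"
  shows "x \<in> W \<Longrightarrow> (f \<circ> \<Psi> has_derivative frechet_derivative (f \<circ> \<Psi>) (at x)) (at x)"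
    and "x \<in> W \<Longrightarrow> ((\<lambda>y. frechet_derivative (f \<circ> \<Psi>) (at y) v) has_derivative
           second_derivative (f \<circ> \<Psi>) x v) (at x)"
proof -
  have chain: "(f \<circ> \<Psi> has_derivative frechet_derivative f (at (\<Psi> x)) \<circ> frechet_derivative \<Psi> (at x)) (at x)"
    if "x \<in> W" for x
    using smooth_map_on_imp_twice_differentiable(1)[OF f, of "\<Psi> x"]
      smooth_map_on_imp_twice_differentiable(1)[OF \<Psi> that] W that
    by (intro diff_chain_at) (auto simp: frechet_derivative_works)
  show "(f \<circ> \<Psi> has_derivative frechet_derivative (f \<circ> \<Psi>) (at x)) (at x)" if "x \<in> W"
    using chain[OF that] by (metis frechet_derivative_at)
  have eq: "frechet_derivative (f \<circ> \<Psi>) (at y) v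
      = (\<Sum>b\<in>Basis. inner (frechet_derivative \<Psi> (at y) v) b * frechet_derivative f (at (\<Psi> y)) b)"
    if y: "y \<in> W" for y
  proof -
    let ?D = "frechet_derivative f (at (\<Psi> y))"
    have "(f has_derivative ?D) (at (\<Psi> y))"
      using smooth_map_on_imp_twice_differentiable(1)[OF f, of "\<Psi> y"] W y
      by (auto simp: frechet_derivative_works)
    then have lin: "linear ?D" by (rule has_derivative_linear)
    have "frechet_derivative (f \<circ> \<Psi>) (at y) v = ?D (frechet_derivative \<Psi> (at y) v)"
      unfolding frechet_derivative_at[OF chain[OF y], symmetric] by simp
    also have "\<dots> = ?D (\<Sum>b\<in>Basis. inner (frechet_derivative \<Psi> (at y) v) b *\<^sub>R b)"
      by (simp add: euclidean_representation)
    also have "\<dots> = (\<Sum>b\<in>Basis. inner (frechet_derivative \<Psi> (at y) v) b * ?D b)"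
      by (subst linear_sum[OF lin]) (simp add: linear_scale[OF lin])
    finally show ?thesis .
  qed
  show "((\<lambda>y. frechet_derivative (f \<circ> \<Psi>) (at y) v) has_derivative
           second_derivative (f \<circ> \<Psi>) x v) (at x)" if x: "x \<in> W"
  proof -
    have "(\<lambda>y. \<Sum>b\<in>Basis. inner (frechet_derivative \<Psi> (at y) v) b * frechet_derivative f (at (\<Psi> y)) b)
        differentiable (at x)"
    proof (intro differentiable_sum ballI differentiable_mult differentiable_inner differentiable_const)
      show "(\<lambda>y. frechet_derivative \<Psi> (at y) v) differentiable (at x)"
        by (rule smooth_map_on_imp_twice_differentiable(2)[OF \<Psi> x])
      fix b
      have "(\<lambda>z. frechet_derivative f (at z) b) differentiable (at (\<Psi> x))"
        using smooth_map_on_imp_twice_differentiable(2)[OF f, of "\<Psi> x"] W x by blast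
      then have "(\<lambda>z. frechet_derivative f (at z) b) \<circ> \<Psi> differentiable (at x)"
        using differentiable_chain_at smooth_map_on_imp_twice_differentiable(1)[OF \<Psi> x] by blast
      then show "(\<lambda>y. frechet_derivative f (at (\<Psi> y)) b) differentiable (at x)" by (simp add: o_def)
    qed simp
    then obtain D where "((\<lambda>y. \<Sum>b\<in>Basis. inner (frechet_derivative \<Psi> (at y) v) b
        * frechet_derivative f (at (\<Psi> y)) b) has_derivative D) (at x)"
      unfolding differentiable_def by blast
    then have D: "((\<lambda>y. frechet_derivative (f \<circ> \<Psi>) (at y) v) has_derivative D) (at x)"
      by (rule has_derivative_transform_within_open[OF _ W(1) x]) (simp add: eq)
    then have "second_derivative (f \<circ> \<Psi>) x v = D"
      unfolding second_derivative_def fun_eq_iff using frechet_derivative_at[OF D] by metis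
    then show ?thesis using D by simp
  qed
qed

text \<open>
  Coordinates for open chains close to a chain aligned with \<open>e\<close>.  The component of link \<open>j\<close>
  perpendicular to \<open>e\<close> is stored at the far end \<open>x (Suc j)\<close> of the link.  These components add up to
  \<open>0\<close> because the ends of the chain lie on a line in the direction \<open>e\<close>.
\<close>

definition chain_tangent :: "'a::euclidean_space \<Rightarrow> (nat \<Rightarrow> 'v) \<Rightarrow> nat \<Rightarrow> ('a ^ 'v::finite) set" where
  "chain_tangent e x k = {y. (\<forall>v. inner (y $ v) e = 0) \<and> (\<forall>v. v \<notin> x ` {0<..k} \<longrightarrow> y $ v = 0) \<and>
     (\<Sum>j<k. y $ x (Suc j)) = 0}"

text \<open>
  The signed distance of the ends of the chain with link lengths \<open>l j\<close> whose links have the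
  perpendicular components \<open>y\<close>; the sign \<open>\<epsilon> j\<close> tells whether link \<open>j\<close> points forwards or backwards.
\<close>

definition chain_reach ::
    "(nat \<Rightarrow> real) \<Rightarrow> (nat \<Rightarrow> real) \<Rightarrow> (nat \<Rightarrow> 'v) \<Rightarrow> nat \<Rightarrow> 'a::euclidean_space ^ 'v::finite \<Rightarrow> real" where
  "chain_reach \<epsilon> l x k y = (\<Sum>j<k. \<epsilon> j * sqrt ((l j)\<^sup>2 - inner (y $ x (Suc j)) (y $ x (Suc j))))"

definition chain_reach_deriv ::
    "(nat \<Rightarrow> real) \<Rightarrow> (nat \<Rightarrow> real) \<Rightarrow> (nat \<Rightarrow> 'v) \<Rightarrow> nat \<Rightarrow> 'a::euclidean_space ^ 'v::finite \<Rightarrow> 'a ^ 'v \<Rightarrow> real" where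
  "chain_reach_deriv \<epsilon> l x k y v = - (\<Sum>j<k. \<epsilon> j * inner (y $ x (Suc j)) (v $ x (Suc j))
     / sqrt ((l j)\<^sup>2 - inner (y $ x (Suc j)) (y $ x (Suc j))))"

definition chain_hessian ::
    "(nat \<Rightarrow> real) \<Rightarrow> (nat \<Rightarrow> real) \<Rightarrow> (nat \<Rightarrow> 'v) \<Rightarrow> nat \<Rightarrow> 'a::euclidean_space ^ 'v::finite \<Rightarrow> 'a ^ 'v \<Rightarrow> real" where
  "chain_hessian \<epsilon> l x k u v = - (\<Sum>j<k. \<epsilon> j / l j * inner (u $ x (Suc j)) (v $ x (Suc j)))"

lemma subspace_chain_tangent: "subspace (chain_tangent e x k)"
  unfolding subspace_def chain_tangent_def
  by (auto simp: inner_add_left sum.distrib simp flip: scaleR_sum_right)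

lemma chain_reach_has_derivative:
  fixes y :: "'a::euclidean_space ^ 'v::finite"
  assumes "\<And>j. j < k \<Longrightarrow> norm (y $ x (Suc j)) < l j"
  shows "(chain_reach \<epsilon> l x k has_derivative chain_reach_deriv \<epsilon> l x k y) (at y)"
proof -
  have bl: "((\<lambda>y::'a ^ 'v. y $ w) has_derivative (\<lambda>h. h $ w)) (at y)" for w
    by (rule bounded_linear_imp_has_derivative) (rule bounded_linear_vec_nth)
  have "((\<lambda>y. \<epsilon> j * sqrt ((l j)\<^sup>2 - inner (y $ x (Suc j)) (y $ x (Suc j)))) has_derivative
      (\<lambda>v. - (\<epsilon> j * inner (y $ x (Suc j)) (v $ x (Suc j))
     / sqrt ((l j)\<^sup>2 - inner (y $ x (Suc j)) (y $ x (Suc j)))))) (at y)" if "j < k" for j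
  proof -
    have "(norm (y $ x (Suc j)))\<^sup>2 < (l j)\<^sup>2"
      using assms[OF that] by (intro power_strict_mono) auto
    then have pos: "0 < (l j)\<^sup>2 - inner (y $ x (Suc j)) (y $ x (Suc j))"
      by (simp add: power2_norm_eq_inner)
    show ?thesis
      by (rule derivative_eq_intros bl has_derivative_real_sqrt pos refl)+
         (auto simp: field_simps inner_commute fun_eq_iff pos)
  qed
  then show ?thesis
    unfolding chain_reach_def[abs_def] chain_reach_deriv_def[abs_def] sum_negf[symmetric]
    by (intro has_derivative_sum) auto
qed

lemma chain_reach_has_second_derivative:
  fixes v :: "'a::euclidean_space ^ 'v::finite"
  assumes "\<And>j. j < k \<Longrightarrow> 0 < l j"
  shows "((\<lambda>y. chain_reach_deriv \<epsilon> l x k y v) has_derivative chain_hessian \<epsilon> l x k v) (at 0)"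
proof -
  have bl: "((\<lambda>y::'a ^ 'v. y $ w) has_derivative (\<lambda>h. h $ w)) (at y)" for w y
    by (rule bounded_linear_imp_has_derivative) (rule bounded_linear_vec_nth)
  have "((\<lambda>y. \<epsilon> j * inner (y $ x (Suc j)) (v $ x (Suc j))
     / sqrt ((l j)\<^sup>2 - inner (y $ x (Suc j)) (y $ x (Suc j)))) has_derivative
      (\<lambda>u. \<epsilon> j / l j * inner (v $ x (Suc j)) (u $ x (Suc j)))) (at 0)" if "j < k" for j
  proof -
    have pos: "0 < l j" using assms that by blast
    have nd: "((\<lambda>y::'a ^ 'v. sqrt ((l j)\<^sup>2 - inner (y $ x (Suc j)) (y $ x (Suc j)))) has_derivative (\<lambda>_. 0)) (at 0)"
    proof -
      have "((\<lambda>y::'a ^ 'v. (l j)\<^sup>2 - inner (y $ x (Suc j)) (y $ x (Suc j))) has_derivative (\<lambda>_. 0)) (at 0)"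
        by (rule has_derivative_eq_rhs, (rule derivative_intros bl)+) simp
      from has_derivative_real_sqrt[OF _ this] show ?thesis using pos by simp
    qed
    have num: "((\<lambda>y. \<epsilon> j * inner (y $ x (Suc j)) (v $ x (Suc j))) has_derivative
        (\<lambda>u. \<epsilon> j * inner (u $ x (Suc j)) (v $ x (Suc j)))) (at 0)"
      by (rule derivative_eq_intros bl refl)+ auto
    show ?thesis
      by (rule has_derivative_eq_rhs[OF has_derivative_divide[OF num nd]])
         (use pos in \<open>auto simp: fun_eq_iff field_simps inner_commute\<close>)
  qed
  then show ?thesis
    unfolding chain_reach_deriv_def[abs_def] chain_hessian_def[abs_def] 
    by (intro has_derivative_minus has_derivative_sum) auto
qed

text \<open>
  On the hyperplane where the components add up to \<open>0\<close>, the form \<open>(\<Sum>j. \<epsilon> j / l j * \<bar>u\<^sub>j\<bar>\<^sup>2)\<close> has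
  a kernel only if all \<open>(\<epsilon> j / l j) *\<^sub>R u\<^sub>j\<close> are one vector \<open>c\<close>, and then \<open>(\<Sum>j. \<epsilon> j * l j) *\<^sub>R c = 0\<close>.  Up to sign,
  the factor is the distance of the ends of the aligned chain, so this is where \<open>x 0\<close> and \<open>x k\<close> have to be
  at different positions.
\<close>

lemma chain_hessian_nondegenerate:
  fixes u :: "'a::euclidean_space ^ 'v::finite"
  assumes inj: "inj_on x {..k}" and l: "\<And>j. j < k \<Longrightarrow> 0 < l j" and \<epsilon>: "\<And>j. j < k \<Longrightarrow> \<epsilon> j = 1 \<or> \<epsilon> j = -1"
    and r0: "(\<Sum>j<k. \<epsilon> j * l j) \<noteq> 0" and u: "u \<in> chain_tangent e x k"
    and deg: "\<And>v. v \<in> chain_tangent e x k \<Longrightarrow> chain_hessian \<epsilon> l x k u v = 0"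
  shows "u = 0"
proof -
  define c where "c j = (\<epsilon> j / l j) *\<^sub>R u $ x (Suc j)" for j
  have xeq: "x (Suc i) = x (Suc j) \<longleftrightarrow> i = j" if "i < k" "j < k" for i j
    using that by (auto dest!: inj_onD[OF inj])
  have ue: "inner (u $ v) e = 0" and u0: "v \<notin> x ` {0<..k} \<Longrightarrow> u $ v = 0"
    and us: "(\<Sum>j<k. u $ x (Suc j)) = 0" for v
    using u by (auto simp: chain_tangent_def)
  have ceq: "c i = c m" if im: "i < k" "m < k" "i \<noteq> m" for i m
  proof -
    \<comment> \<open>test the form against the vector that moves links \<open>i\<close> and \<open>m\<close> in opposite directions\<close>
    define h where "h = c i - c m"
    define v :: "'a ^ 'v" where "v = (\<chi> w. (if w = x (Suc i) then h else 0) - (if w = x (Suc m) then h else 0))"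
    have vj: "v $ x (Suc j) = (if j = i then h else 0) - (if j = m then h else 0)" if "j < k" for j
      using that im xeq by (simp add: v_def)
    have "inner h e = 0" using ue by (simp add: h_def c_def inner_simps)
    moreover have "(\<Sum>j<k. v $ x (Suc j)) = 0"
      using im by (simp add: vj sum_subtractf)
    moreover have "v $ w = 0" if "w \<notin> x ` {0<..k}" for w
      using that im by (auto simp: v_def)
    ultimately have "v \<in> chain_tangent e x k" by (auto simp: chain_tangent_def v_def inner_simps)
    then have "0 = (\<Sum>j<k. \<epsilon> j / l j * inner (u $ x (Suc j)) (v $ x (Suc j)))"
      using deg by (simp add: chain_hessian_def)
    also have "\<dots> = (\<Sum>j<k. inner (c j) (v $ x (Suc j)))" by (simp add: c_def)
    also have "\<dots> = (\<Sum>j<k. (if j = i then inner (c j) h else 0) - (if j = m then inner (c j) h else 0))"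
      by (intro sum.cong) (auto simp: vj inner_simps)
    also have "\<dots> = inner (c i) h - inner (c m) h" using im by (simp add: sum_subtractf)
    also have "\<dots> = inner h h" by (simp add: h_def inner_simps)
    finally show ?thesis by (simp add: h_def)
  qed
  have ul: "u $ x (Suc j) = (\<epsilon> j * l j) *\<^sub>R c j" if "j < k" for j
    using \<epsilon>[OF that] l[OF that] by (auto simp: c_def)
  have "c j = 0" if "j < k" for j
  proof -
    have "(\<Sum>i<k. u $ x (Suc i)) = (\<Sum>i<k. (\<epsilon> i * l i) *\<^sub>R c j)"
      using ceq[of _ j] that by (intro sum.cong refl) (metis lessThan_iff ul)
    also have "\<dots> = (\<Sum>i<k. \<epsilon> i * l i) *\<^sub>R c j" by (simp add: scaleR_sum_left)
    finally show ?thesis using us r0 by simp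
  qed
  then have "u $ x (Suc j) = 0" if "j < k" for j using ul that by simp
  then have "u $ v = 0" for v
  proof (cases "v \<in> x ` {0<..k}")
    case True
    then obtain i where "0 < i" "i \<le> k" "v = x i" by auto
    then show ?thesis using \<open>\<And>j. j < k \<Longrightarrow> u $ x (Suc j) = 0\<close>[of "i - 1"] by simp
  qed (use u0 in auto)
  then show ?thesis by (simp add: vec_eq_iff)
qed

section \<open>The reduced configuration space as a zero set\<close>

lemma complement_part_nth:
  "complement_part \<Gamma> x k \<phi> $ v = (if v \<in> verts \<Gamma> - x ` {0<..<k} then \<phi> $ v else 0)"
  by (simp add: complement_part_def restrict_config_def complementary_linkage_def)

lemma open_chain_inD:
  assumes "is_linkage \<Gamma>" and "is_open_chain_in \<Gamma> x k"
  shows "inj_on x {..k}" "i \<le> k \<Longrightarrow> x i \<in> verts \<Gamma>" "j < k \<Longrightarrow> {x j, x (Suc j)} \<in> links \<Gamma>"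
    "j < k \<Longrightarrow> 0 < len \<Gamma> {x j, x (Suc j)}"
    "x 0 \<notin> x ` {0<..<k}" "x k \<notin> x ` {0<..<k}" "i \<le> k \<Longrightarrow> j \<le> k \<Longrightarrow> x i = x j \<longleftrightarrow> i = j"
proof -
  show inj: "inj_on x {..k}" and "i \<le> k \<Longrightarrow> x i \<in> verts \<Gamma>"
    using assms(2) by (auto simp: is_open_chain_in_def)
  show l: "j < k \<Longrightarrow> {x j, x (Suc j)} \<in> links \<Gamma>"
    using assms(2) by (auto simp: is_open_chain_in_def chain_links_def)
  show "j < k \<Longrightarrow> 0 < len \<Gamma> {x j, x (Suc j)}"
    using l assms(1) unfolding is_linkage_def by blast
  show "x 0 \<notin> x ` {0<..<k}" "x k \<notin> x ` {0<..<k}" by (auto dest!: inj_onD[OF inj])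
  show "i \<le> k \<Longrightarrow> j \<le> k \<Longrightarrow> x i = x j \<longleftrightarrow> i = j" by (auto dest!: inj_onD[OF inj])
qed

lemma reduced_config_space_pullback:
  fixes \<phi> :: "'a::euclidean_space ^ 'v::finite"
  assumes lk: "is_linkage \<Gamma>" and ch: "is_open_chain_in \<Gamma> x k"
  shows "\<phi> \<in> reduced_config_space \<Gamma> (x 0) (x k) e \<longleftrightarrow> \<phi> \<in> embeddings \<Gamma> \<and>
     complement_part \<Gamma> x k \<phi> \<in> reduced_config_space (complementary_linkage \<Gamma> x k) (x 0) (x k) e \<and>
     (\<forall>j<k. norm (\<phi> $ x (Suc j) - \<phi> $ x j) = len \<Gamma> {x j, x (Suc j)})"
proof -
  note ch' = open_chain_inD[OF lk ch]
  have cp: "complement_part \<Gamma> x k \<phi> $ x 0 = \<phi> $ x 0" "complement_part \<Gamma> x k \<phi> $ x k = \<phi> $ x k"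
    using ch'(2)[of 0] ch'(2)[of k] ch'(5,6) by (simp_all add: complement_part_nth)
  have chp: "chain_part \<Gamma> x k \<phi> $ x i = \<phi> $ x i" if "i \<le> k" for i
    using that by (simp add: chain_part_def restrict_config_def chain_linkage_def)
  have "chain_part \<Gamma> x k \<phi> \<in> pointed_config_space (chain_linkage \<Gamma> x k) (x 0) \<longleftrightarrow>
      (\<forall>j<k. norm (\<phi> $ x (Suc j) - \<phi> $ x j) = len \<Gamma> {x j, x (Suc j)})"
    if emb: "\<phi> \<in> embeddings \<Gamma>" and base: "\<phi> $ x 0 = 0"
  proof
    assume c: "chain_part \<Gamma> x k \<phi> \<in> pointed_config_space (chain_linkage \<Gamma> x k) (x 0)"
    show "\<forall>j<k. norm (\<phi> $ x (Suc j) - \<phi> $ x j) = len \<Gamma> {x j, x (Suc j)}"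
    proof (intro allI impI)
      fix j assume j: "j < k"
      then have "{x (Suc j), x j} \<in> chain_links x k" by (auto simp: chain_links_def)
      then have "(norm (chain_part \<Gamma> x k \<phi> $ x (Suc j) - chain_part \<Gamma> x k \<phi> $ x j))\<^sup>2 = (len \<Gamma> {x (Suc j), x j})\<^sup>2"
        using c by (simp add: pointed_config_space_def config_space_def chain_linkage_def)
      then show "norm (\<phi> $ x (Suc j) - \<phi> $ x j) = len \<Gamma> {x j, x (Suc j)}"
        using j ch'(4)[OF j] by (simp add: chp insert_commute power2_eq_iff_nonneg)
    qed
  next
    assume l: "\<forall>j<k. norm (\<phi> $ x (Suc j) - \<phi> $ x j) = len \<Gamma> {x j, x (Suc j)}"
    have "(norm (chain_part \<Gamma> x k \<phi> $ u - chain_part \<Gamma> x k \<phi> $ v))\<^sup>2 = (len \<Gamma> {u, v})\<^sup>2"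
      if uv: "{u, v} \<in> chain_links x k" for u v
    proof -
      obtain j where j: "j < k" "{u, v} = {x j, x (Suc j)}" using uv by (auto simp: chain_links_def)
      then have "u = x j \<and> v = x (Suc j) \<or> u = x (Suc j) \<and> v = x j" by (auto simp: doubleton_eq_iff)
      then have "norm (chain_part \<Gamma> x k \<phi> $ u - chain_part \<Gamma> x k \<phi> $ v) = len \<Gamma> {x j, x (Suc j)}"
        using j(1) l chp[of j] chp[of "Suc j"] by (auto simp: norm_minus_commute)
      then show ?thesis using j(2) by simp
    qed
    moreover have "inj_on (\<lambda>v. chain_part \<Gamma> x k \<phi> $ v) (x ` {..k})"
    proof (rule inj_onI)
      fix u v assume uv: "u \<in> x ` {..k}" "v \<in> x ` {..k}" "chain_part \<Gamma> x k \<phi> $ u = chain_part \<Gamma> x k \<phi> $ v"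
      then have "\<phi> $ u = \<phi> $ v" "u \<in> verts \<Gamma>" "v \<in> verts \<Gamma>" using chp ch'(2) by auto
      then show "u = v" using emb by (auto simp: embeddings_def inj_on_def)
    qed
    ultimately show "chain_part \<Gamma> x k \<phi> \<in> pointed_config_space (chain_linkage \<Gamma> x k) (x 0)"
      using base chp[of 0]
      by (simp add: pointed_config_space_def config_space_def embeddings_def chain_linkage_def)
         (simp add: chain_part_def restrict_config_def chain_linkage_def)
  qed
  moreover have "work_map (x k) (complement_part \<Gamma> x k \<phi>) = work_map (x k) (chain_part \<Gamma> x k \<phi>)"
    using cp chp[of k] by (simp add: work_map_def)
  moreover have "complement_part \<Gamma> x k \<phi> \<in> pointed_config_space (complementary_linkage \<Gamma> x k) (x 0)
      \<Longrightarrow> \<phi> $ x 0 = 0"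
    using cp(1) by (simp add: pointed_config_space_def)
  ultimately show ?thesis
    unfolding reduced_config_space_def mem_Collect_eq pointed_config_space_pullback[OF lk ch, of \<phi>] cp
    by blast
qed

lemma open_inj_on_vec:
  fixes A :: "'v::finite set"
  shows "open {\<phi> :: 'a::euclidean_space ^ 'v. inj_on (\<lambda>v. \<phi> $ v) A}"
proof -
  have "{\<phi> :: 'a ^ 'v. inj_on (\<lambda>v. \<phi> $ v) A} = (\<Inter>(u, v)\<in>{(u, v). u \<in> A \<and> v \<in> A \<and> u \<noteq> v}. {\<phi>. \<phi> $ u \<noteq> \<phi> $ v})"
    by (auto simp: inj_on_def)
  also have "open \<dots>"
    by (intro open_INT) (auto intro!: open_Collect_neq continuous_intros)
  finally show ?thesis .
qed

text \<open>
  The link \<open>j\<close> of length \<open>l j\<close> recovered from its component perpendicular to \<open>e\<close>.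
\<close>

definition chain_vector ::
    "'a::euclidean_space \<Rightarrow> (nat \<Rightarrow> real) \<Rightarrow> (nat \<Rightarrow> real) \<Rightarrow> (nat \<Rightarrow> 'v) \<Rightarrow> 'a ^ 'v::finite \<Rightarrow> nat \<Rightarrow> 'a" where
  "chain_vector e \<epsilon> l x y j = y $ x (Suc j) +
     (\<epsilon> j * sqrt ((l j)\<^sup>2 - inner (y $ x (Suc j)) (y $ x (Suc j)))) *\<^sub>R e"

lemma chain_vector_properties:
  fixes y :: "'a::euclidean_space ^ 'v::finite"
  assumes e: "norm e = 1" and y: "inner (y $ x (Suc j)) e = 0" and l: "norm (y $ x (Suc j)) < l j"
    and \<epsilon>: "\<epsilon> j = 1 \<or> \<epsilon> j = -1"
  shows "norm (chain_vector e \<epsilon> l x y j) = l j"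
    and "inner (chain_vector e \<epsilon> l x y j) e = \<epsilon> j * sqrt ((l j)\<^sup>2 - inner (y $ x (Suc j)) (y $ x (Suc j)))"
    and "0 < \<epsilon> j * inner (chain_vector e \<epsilon> l x y j) e"
    and "chain_vector e \<epsilon> l x y j - inner (chain_vector e \<epsilon> l x y j) e *\<^sub>R e = y $ x (Suc j)"
proof -
  have ee: "inner e e = 1" using e by (simp add: dot_square_norm)
  let ?r = "(l j)\<^sup>2 - inner (y $ x (Suc j)) (y $ x (Suc j))"
  have "(norm (y $ x (Suc j)))\<^sup>2 < (l j)\<^sup>2" using l by (intro power_strict_mono) auto
  then have r: "0 < ?r" by (simp add: power2_norm_eq_inner)
  show i: "inner (chain_vector e \<epsilon> l x y j) e = \<epsilon> j * sqrt ?r"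
    using y ee by (simp add: chain_vector_def inner_simps)
  then show "0 < \<epsilon> j * inner (chain_vector e \<epsilon> l x y j) e" using \<epsilon> r by auto
  show "chain_vector e \<epsilon> l x y j - inner (chain_vector e \<epsilon> l x y j) e *\<^sub>R e = y $ x (Suc j)"
    unfolding i by (simp add: chain_vector_def)
  have "(norm (chain_vector e \<epsilon> l x y j))\<^sup>2 = inner (y $ x (Suc j)) (y $ x (Suc j)) + (\<epsilon> j * \<epsilon> j) * (sqrt ?r * sqrt ?r)"
    using y ee inner_commute[of e "y $ x (Suc j)"]
    by (simp add: chain_vector_def power2_norm_eq_inner inner_simps mult_ac)
  also have "\<dots> = (l j)\<^sup>2" using \<epsilon> r by auto
  finally show "norm (chain_vector e \<epsilon> l x y j) = l j"
    using l by (simp add: power2_eq_iff_nonneg order.trans[OF norm_ge_zero less_imp_le])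
qed

lemma chain_vector_of_link:
  fixes y :: "'a::euclidean_space ^ 'v::finite"
  assumes e: "norm e = 1" and y: "y $ x (Suc j) = \<delta> - inner \<delta> e *\<^sub>R e" and l: "norm \<delta> = l j"
    and \<epsilon>: "\<epsilon> j = 1 \<or> \<epsilon> j = -1" and pos: "0 < \<epsilon> j * inner \<delta> e"
  shows "chain_vector e \<epsilon> l x y j = \<delta>" "norm (y $ x (Suc j)) < l j"
    "\<epsilon> j * sqrt ((l j)\<^sup>2 - inner (y $ x (Suc j)) (y $ x (Suc j))) = inner \<delta> e"
proof -
  have ee: "inner e e = 1" using e by (simp add: dot_square_norm)
  have yy: "inner (y $ x (Suc j)) (y $ x (Suc j)) = (l j)\<^sup>2 - (inner \<delta> e)\<^sup>2"
    unfolding y l[symmetric] power2_norm_eq_inner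
    by (simp add: inner_simps ee inner_commute[of e \<delta>] power2_eq_square)
  show *: "\<epsilon> j * sqrt ((l j)\<^sup>2 - inner (y $ x (Suc j)) (y $ x (Suc j))) = inner \<delta> e"
    unfolding yy using \<epsilon> pos by auto
  then show "chain_vector e \<epsilon> l x y j = \<delta>" unfolding chain_vector_def by (simp add: y)
  have "inner \<delta> e \<noteq> 0" using pos by auto
  then have "(norm (y $ x (Suc j)))\<^sup>2 < (l j)\<^sup>2"
    unfolding power2_norm_eq_inner[of "y $ x (Suc j)"] yy by simp
  moreover have "0 \<le> l j" using l norm_ge_zero by metis
  ultimately show "norm (y $ x (Suc j)) < l j" by (rule power2_less_imp_less)
qed

text \<open>
  A configuration near \<open>\<phi>0\<close> is determined by the slice coordinates of its complementary part and
  the perpendicular components of its chain links; the two parts fit together exactly when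
  both give the same distance between \<open>x 0\<close> and \<open>x k\<close>.  The vertices of the two parts are distinct on an
  open set, which is absorbed into \<open>O2\<close>.
\<close>

lemma reduced_config_space_chart:
  fixes \<phi>0 :: "'a::euclidean_space ^ 'v::finite"
  assumes lk: "is_linkage \<Gamma>" and ch: "is_open_chain_in \<Gamma> x k" and e: "norm e = 1"
    and \<phi>0: "\<phi>0 \<in> reduced_config_space \<Gamma> (x 0) (x k) e"
    and l: "\<And>j. l j = len \<Gamma> {x j, x (Suc j)}" and \<epsilon>: "\<And>j. j < k \<Longrightarrow> \<epsilon> j = 1 \<or> \<epsilon> j = -1"
    and al: "\<And>j. j < k \<Longrightarrow> \<phi>0 $ x (Suc j) - \<phi>0 $ x j = (\<epsilon> j * l j) *\<^sub>R e"
    and sc: "slice_chart (reduced_config_space (complementary_linkage \<Gamma> x k) (x 0) (x k) e)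
      (complement_part \<Gamma> x k \<phi>0) L U W \<Phi> \<Psi>"
  obtains O2 N F P where "open O2" "0 \<in> O2" "O2 \<subseteq> W \<times> {y. \<forall>j<k. norm (y $ x (Suc j)) < l j}"
    "openin (top_of_set (reduced_config_space \<Gamma> (x 0) (x k) e)) N" "\<phi>0 \<in> N" "F \<phi>0 = 0"
    "homeomorphism N {z \<in> (L \<times> chain_tangent e x k) \<inter> O2.
        reduced_work_map (x 0) (x k) (\<Psi> (fst z)) - chain_reach \<epsilon> l x k (snd z) = 0} F P"
proof -
  note ch' = open_chain_inD[OF lk ch]
  let ?R = "reduced_config_space \<Gamma> (x 0) (x k) e :: ('a ^ 'v) set"
  let ?R' = "reduced_config_space (complementary_linkage \<Gamma> x k) (x 0) (x k) e :: ('a ^ 'v) set"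
  let ?cp = "complement_part \<Gamma> x k :: 'a ^ 'v \<Rightarrow> 'a ^ 'v"
  have ee: "inner e e = 1" using e by (simp add: dot_square_norm)
  have U: "open U" "open W" "?cp \<phi>0 \<in> U" "\<Phi> (?cp \<phi>0) = 0" "subspace L" and hom: "homeomorphism U W \<Phi> \<Psi>"
    and img: "\<Phi> ` (?R' \<inter> U) = L \<inter> W"
    using sc by (auto simp: slice_chart_def)
  have \<Phi>\<Psi>: "\<And>u. u \<in> U \<Longrightarrow> \<Psi> (\<Phi> u) = u" "\<And>w. w \<in> W \<Longrightarrow> \<Phi> (\<Psi> w) = w"
    "continuous_on U \<Phi>" "continuous_on W \<Psi>"
    using hom by (auto simp: homeomorphism_def)
  have \<Psi>R: "\<Psi> a \<in> ?R' \<inter> U" if "a \<in> L" "a \<in> W" for a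
  proof -
    have "a \<in> \<Phi> ` (?R' \<inter> U)" using that img by blast
    then show ?thesis using \<Phi>\<Psi>(1) by auto
  qed
  \<comment> \<open>the interior chain vertex \<open>v\<close> is the sum of the first \<open>idx v\<close> links, as \<open>x 0\<close> is the origin\<close>
  define idx where "idx v = inv_into {..k} x v" for v
  have idx: "idx (x i) = i" if "i \<le> k" for i using that ch'(1) by (simp add: idx_def)
  define D :: "('a ^ 'v) set" where "D = {y. \<forall>j<k. norm (y $ x (Suc j)) < l j}"
  have "D = (\<Inter>j\<in>{..<k}. {y. norm (y $ x (Suc j)) < l j})" by (auto simp: D_def)
  then have D: "open D" by (auto intro!: open_INT open_Collect_less continuous_intros)
  define P :: "('a ^ 'v) \<times> ('a ^ 'v) \<Rightarrow> 'a ^ 'v" where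
    "P z = (\<chi> v. if v \<in> x ` {0<..<k} then \<Sum>j<idx v. chain_vector e \<epsilon> l x (snd z) j else \<Psi> (fst z) $ v)" for z
  define F :: "'a ^ 'v \<Rightarrow> ('a ^ 'v) \<times> ('a ^ 'v)" where
    "F \<phi> = (\<Phi> (?cp \<phi>), \<chi> v. if v \<in> x ` {0<..k} then (\<phi> $ v - \<phi> $ x (idx v - 1))
       - inner (\<phi> $ v - \<phi> $ x (idx v - 1)) e *\<^sub>R e else 0)" for \<phi>
  have cPsi: "continuous_on (W \<times> D) (\<lambda>z. \<Psi> (fst z))"
    by (rule continuous_on_compose2[OF \<Phi>\<Psi>(4)]) (auto intro: continuous_intros)
  have cP: "continuous_on (W \<times> D) P"
    unfolding P_def chain_vector_def
  proof (rule continuous_on_vec_lambda)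
    fix v
    show "continuous_on (W \<times> D) (\<lambda>z. if v \<in> x ` {0<..<k} then \<Sum>j<idx v. snd z $ x (Suc j) +
      (\<epsilon> j * sqrt ((l j)\<^sup>2 - inner (snd z $ x (Suc j)) (snd z $ x (Suc j)))) *\<^sub>R e else \<Psi> (fst z) $ v)"
      by (cases "v \<in> x ` {0<..<k}") (auto intro!: continuous_intros cPsi)
  qed
  define O2 where "O2 = (W \<times> D) \<inter> P -` {\<phi>. inj_on (\<lambda>v. \<phi> $ v) (verts \<Gamma>)}"
  have O2: "open O2" unfolding O2_def
    by (rule continuous_open_preimage[OF cP _ open_inj_on_vec]) (intro open_Times U D)
  define N where "N = ?R \<inter> {\<phi>. ?cp \<phi> \<in> U \<and> (\<forall>j<k. 0 < \<epsilon> j * inner (\<phi> $ x (Suc j) - \<phi> $ x j) e)}"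
  have ccp: "continuous_on A ?cp" for A
    unfolding complement_part_def[abs_def] restrict_config_def
  proof (rule continuous_on_vec_lambda)
    fix v show "continuous_on A (\<lambda>\<phi>. if v \<in> verts (complementary_linkage \<Gamma> x k) then \<phi> $ v else 0)"
      by (cases "v \<in> verts (complementary_linkage \<Gamma> x k)") (auto intro!: continuous_intros)
  qed
  have oN: "openin (top_of_set ?R) N"
  proof -
    have "{\<phi>. ?cp \<phi> \<in> U \<and> (\<forall>j<k. 0 < \<epsilon> j * inner (\<phi> $ x (Suc j) - \<phi> $ x j) e)}
        = (?cp -` U) \<inter> (\<Inter>j\<in>{..<k}. {\<phi>. 0 < \<epsilon> j * inner (\<phi> $ x (Suc j) - \<phi> $ x j) e})" by auto
    moreover have "open (?cp -` U)" using ccp U(1) by (intro open_vimage) auto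
    moreover have "open (\<Inter>j\<in>{..<k}. {\<phi>::'a ^ 'v. 0 < \<epsilon> j * inner (\<phi> $ x (Suc j) - \<phi> $ x j) e})"
      by (intro open_INT) (auto intro!: open_Collect_less continuous_intros)
    ultimately show ?thesis unfolding N_def by (auto intro: openin_open_Int)
  qed
  define Z where "Z = {z \<in> (L \<times> chain_tangent e x k) \<inter> O2.
        reduced_work_map (x 0) (x k) (\<Psi> (fst z)) - chain_reach \<epsilon> l x k (snd z) = 0}"
  have ends: "\<phi> $ x k = norm (\<phi> $ x k) *\<^sub>R e" "\<phi> $ x 0 = 0" if "\<phi> \<in> reduced_config_space G (x 0) (x k) e"
    for \<phi> :: "'a ^ 'v" and G
  proof -
    show "\<phi> $ x 0 = 0" using that by (simp add: reduced_config_space_def pointed_config_space_def)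
    then have "\<phi> $ x k \<noteq> 0" "e = sgn (\<phi> $ x k)" using that by (auto simp: reduced_config_space_def)
    then show "\<phi> $ x k = norm (\<phi> $ x k) *\<^sub>R e" by (simp add: sgn_div_norm)
  qed
  have FN: "F \<phi> \<in> Z \<and> P (F \<phi>) = \<phi>" if \<phi>: "\<phi> \<in> N" for \<phi>
  proof -
    have R: "\<phi> \<in> ?R" and cU: "?cp \<phi> \<in> U" and pos: "\<And>j. j < k \<Longrightarrow> 0 < \<epsilon> j * inner (\<phi> $ x (Suc j) - \<phi> $ x j) e"
      using \<phi> by (auto simp: N_def)
    have emb: "\<phi> \<in> embeddings \<Gamma>" and cR: "?cp \<phi> \<in> ?R'"
      and len: "\<And>j. j < k \<Longrightarrow> norm (\<phi> $ x (Suc j) - \<phi> $ x j) = l j"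
      using reduced_config_space_pullback[OF lk ch, of \<phi> e] R l by auto
    define y where "y = snd (F \<phi>)"
    have yj: "y $ x (Suc j) = (\<phi> $ x (Suc j) - \<phi> $ x j) - inner (\<phi> $ x (Suc j) - \<phi> $ x j) e *\<^sub>R e" if "j < k" for j
      using that idx[of "Suc j"] by (auto simp: y_def F_def)
    have cv: "chain_vector e \<epsilon> l x y j = \<phi> $ x (Suc j) - \<phi> $ x j" "norm (y $ x (Suc j)) < l j"
      "\<epsilon> j * sqrt ((l j)\<^sup>2 - inner (y $ x (Suc j)) (y $ x (Suc j))) = inner (\<phi> $ x (Suc j) - \<phi> $ x j) e"
      if "j < k" for j
      by (rule chain_vector_of_link[where l = l and \<epsilon> = \<epsilon> and x = x and y = y and j = j,
            OF e yj[OF that] len[OF that] \<epsilon>[OF that] pos[OF that]])+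
    have tel: "(\<Sum>j<i. \<phi> $ x (Suc j) - \<phi> $ x j) = \<phi> $ x i" for i
      using sum_lessThan_telescope[of "\<lambda>j. \<phi> $ x j" i] ends(2)[OF R] by simp
    have xk: "inner (\<phi> $ x k) e = norm (\<phi> $ x k)" "\<phi> $ x k - inner (\<phi> $ x k) e *\<^sub>R e = 0"
      using ends(1)[OF R] ee by (metis inner_scaleR_left mult.right_neutral, simp)
         (metis ends(1)[OF R] ee inner_scaleR_left mult.right_neutral right_minus_eq)
    have sumcv: "(\<Sum>j<i. chain_vector e \<epsilon> l x y j) = \<phi> $ x i" if "i \<le> k" for i
    proof -
      have "(\<Sum>j<i. chain_vector e \<epsilon> l x y j) = (\<Sum>j<i. \<phi> $ x (Suc j) - \<phi> $ x j)"
        using that by (intro sum.cong refl cv(1)) auto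
      then show ?thesis using tel by simp
    qed
    have yT: "y \<in> chain_tangent e x k"
      unfolding chain_tangent_def mem_Collect_eq
    proof (intro conjI allI impI)
      show "inner (y $ v) e = 0" for v by (simp add: y_def F_def inner_simps ee)
      show "y $ v = 0" if "v \<notin> x ` {0<..k}" for v using that by (auto simp: y_def F_def)
      define \<delta> where "\<delta> j = \<phi> $ x (Suc j) - \<phi> $ x j" for j
      have "(\<Sum>j<k. y $ x (Suc j)) = (\<Sum>j<k. \<delta> j - inner (\<delta> j) e *\<^sub>R e)"
        by (intro sum.cong refl) (simp add: yj \<delta>_def)
      also have "\<dots> = (\<Sum>j<k. \<delta> j) - inner (\<Sum>j<k. \<delta> j) e *\<^sub>R e"
        by (simp add: sum_subtractf inner_sum_left scaleR_sum_left)
      finally show "(\<Sum>j<k. y $ x (Suc j)) = 0" unfolding \<delta>_def tel using xk(2) by simp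
    qed
    have aLW: "\<Phi> (?cp \<phi>) \<in> L \<inter> W" using img cR cU by blast
    have yD: "y \<in> D" using cv(2) by (simp add: D_def)
    have PF: "P (F \<phi>) = \<phi>"
    proof (simp only: vec_eq_iff, rule allI)
      fix v
      show "P (F \<phi>) $ v = \<phi> $ v"
      proof (cases "v \<in> x ` {0<..<k}")
        case True
        then obtain i where i: "0 < i" "i < k" "v = x i" by auto
        then show ?thesis using True sumcv[of i] idx[of i] by (simp add: P_def y_def)
      next
        case False
        then have "P (F \<phi>) $ v = ?cp \<phi> $ v" using \<Phi>\<Psi>(1)[OF cU] by (simp add: P_def F_def)
        also have "\<dots> = \<phi> $ v" using False emb by (auto simp: complement_part_nth embeddings_def)
        finally show ?thesis .
      qed
    qed
    have "chain_reach \<epsilon> l x k y = (\<Sum>j<k. inner (\<phi> $ x (Suc j) - \<phi> $ x j) e)"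
      unfolding chain_reach_def by (intro sum.cong refl cv(3)) auto
    also have "\<dots> = inner (\<phi> $ x k) e" by (simp only: inner_sum_left[symmetric] tel)
    also have "\<dots> = norm (\<phi> $ x k)" by (rule xk(1))
    also have "\<dots> = reduced_work_map (x 0) (x k) (?cp \<phi>)"
      using ends(2)[OF R] ch'(2)[of k] ch'(6) by (simp add: reduced_work_map_def complement_part_nth)
    finally have G: "reduced_work_map (x 0) (x k) (\<Psi> (fst (F \<phi>))) - chain_reach \<epsilon> l x k (snd (F \<phi>)) = 0"
      using \<Phi>\<Psi>(1)[OF cU] by (simp add: y_def) (simp add: F_def)
    have "F \<phi> = (\<Phi> (?cp \<phi>), y)" by (simp add: F_def y_def)
    then have "F \<phi> \<in> (L \<times> chain_tangent e x k) \<inter> (W \<times> D)" using aLW yT yD by simp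
    moreover have "inj_on (\<lambda>v. P (F \<phi>) $ v) (verts \<Gamma>)" using emb by (simp add: PF embeddings_def)
    ultimately show ?thesis using G PF by (auto simp: Z_def O2_def)
  qed
  have PZ: "P z \<in> N \<and> F (P z) = z" if z: "z \<in> Z" for z
  proof -
    obtain a y where zay: "z = (a, y)" by (cases z)
    have a: "a \<in> L" "a \<in> W" and y: "y \<in> chain_tangent e x k" "y \<in> D"
      and inj: "inj_on (\<lambda>v. P z $ v) (verts \<Gamma>)"
      and G: "reduced_work_map (x 0) (x k) (\<Psi> a) = chain_reach \<epsilon> l x k y"
      using z by (auto simp: zay Z_def O2_def)
    have \<psi>: "\<Psi> a \<in> ?R'" "\<Psi> a \<in> U" using \<Psi>R[OF a] by auto
    have ye: "inner (y $ v) e = 0" and yl: "\<And>j. j < k \<Longrightarrow> norm (y $ x (Suc j)) < l j" for v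
      using y by (auto simp: chain_tangent_def D_def)
    note cv = chain_vector_properties[where y = y and x = x and l = l and \<epsilon> = \<epsilon>, OF e ye yl \<epsilon>]
    have \<psi>0: "\<Psi> a $ v = 0" if "v \<notin> verts \<Gamma> - x ` {0<..<k}" for v
      using \<psi>(1) that
      by (auto simp: reduced_config_space_def pointed_config_space_def config_space_def
            embeddings_def complementary_linkage_def)
    have Pk: "P z $ x k = \<Psi> a $ x k" and P0: "P z $ x 0 = 0"
      using ch'(5,6) ends(2)[OF \<psi>(1)] by (simp_all add: P_def zay)
    have sumk: "(\<Sum>j<k. chain_vector e \<epsilon> l x y j) = \<Psi> a $ x k"
    proof -
      have "(\<Sum>j<k. chain_vector e \<epsilon> l x y j) = (\<Sum>j<k. y $ x (Suc j)) + chain_reach \<epsilon> l x k y *\<^sub>R e"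
        by (simp add: chain_vector_def sum.distrib chain_reach_def scaleR_sum_left)
      also have "\<dots> = reduced_work_map (x 0) (x k) (\<Psi> a) *\<^sub>R e" using y G by (simp add: chain_tangent_def)
      also have "\<dots> = \<Psi> a $ x k" using ends[OF \<psi>(1)] by (simp add: reduced_work_map_def)
      finally show ?thesis .
    qed
    have Px: "P z $ x i = (\<Sum>j<i. chain_vector e \<epsilon> l x y j)" if ik: "i \<le> k" for i
    proof -
      consider "i = 0" | "i = k" | "0 < i" "i < k" using ik by linarith
      then show ?thesis
      proof cases
        case 3
        then show ?thesis using idx[OF ik] by (auto simp: P_def zay)
      qed (use P0 Pk sumk in auto)
    qed
    have Pd: "P z $ x (Suc j) - P z $ x j = chain_vector e \<epsilon> l x y j" if "j < k" for j
      using that by (simp add: Px)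
    have cpP: "?cp (P z) = \<Psi> a"
      using \<psi>0 by (auto simp: vec_eq_iff complement_part_nth P_def zay)
    have "P z \<in> embeddings \<Gamma>"
    proof -
      have "P z $ v = 0" if "v \<notin> verts \<Gamma>" for v
        using that \<psi>0 ch'(2) by (auto simp: P_def zay)
      then show ?thesis using inj by (simp add: embeddings_def)
    qed
    then have "P z \<in> ?R"
      unfolding reduced_config_space_pullback[OF lk ch] using cpP \<psi>(1) Pd cv(1) l by auto
    then have "P z \<in> N" using \<psi>(2) cpP Pd cv(3) by (simp add: N_def)
    moreover have "F (P z) = z"
    proof -
      have "snd (F (P z)) $ v = y $ v" for v
      proof (cases "v \<in> x ` {0<..k}")
        case True
        then obtain i where i: "0 < i" "i \<le> k" "v = x i" by auto
        then obtain j where j: "i = Suc j" "j < k" by (cases i) auto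
        have "snd (F (P z)) $ v = chain_vector e \<epsilon> l x y j - inner (chain_vector e \<epsilon> l x y j) e *\<^sub>R e"
          using True i j idx[of i] Pd[OF j(2)] by (simp add: F_def)
        then show ?thesis using cv(4)[OF j(2) j(2)] i j by simp
      next
        case False
        then show ?thesis using y(1) by (auto simp: F_def chain_tangent_def)
      qed
      then have "snd (F (P z)) = y" by (simp add: vec_eq_iff)
      moreover have "fst (F (P z)) = a" using cpP \<Phi>\<Psi>(2)[OF a(2)] by (simp add: F_def)
      ultimately show ?thesis by (simp add: zay prod_eq_iff)
    qed
    ultimately show ?thesis by blast
  qed
  have cF: "continuous_on N F"
    unfolding F_def
  proof (intro continuous_on_Pair continuous_on_vec_lambda)
    show "continuous_on N (\<lambda>\<phi>. \<Phi> (?cp \<phi>))"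
      by (rule continuous_on_compose2[OF \<Phi>\<Psi>(3) ccp]) (auto simp: N_def)
    fix v
    show "continuous_on N (\<lambda>\<phi>. if v \<in> x ` {0<..k} then (\<phi> $ v - \<phi> $ x (idx v - 1))
       - inner (\<phi> $ v - \<phi> $ x (idx v - 1)) e *\<^sub>R e else 0)"
      by (cases "v \<in> x ` {0<..k}") (auto intro!: continuous_intros)
  qed
  have homNZ: "homeomorphism N Z F P"
  proof (rule homeomorphismI)
    show "continuous_on Z P" using cP by (rule continuous_on_subset) (auto simp: Z_def O2_def)
  qed (use cF FN PZ in auto)
  have \<phi>N: "\<phi>0 \<in> N"
    using \<phi>0 U(3) al \<epsilon> ch'(4) l by (force simp: N_def ee)
  have F0: "F \<phi>0 = 0"
  proof -
    have "snd (F \<phi>0) $ v = 0" for v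
    proof (cases "v \<in> x ` {0<..k}")
      case True
      then obtain i where i: "0 < i" "i \<le> k" "v = x i" by auto
      then obtain j where j: "i = Suc j" "j < k" by (cases i) auto
      show ?thesis using True i j idx[of i] al[OF j(2)] ee by (simp add: F_def)
    qed (auto simp: F_def)
    then show ?thesis using U(4) by (simp add: F_def prod_eq_iff vec_eq_iff)
  qed
  show thesis
  proof (rule that[OF O2])
    show "0 \<in> O2" using FN[OF \<phi>N] F0 by (simp add: Z_def)
    show "O2 \<subseteq> W \<times> {y. \<forall>j<k. norm (y $ x (Suc j)) < l j}" by (auto simp: O2_def D_def)
  qed (use oN \<phi>N F0 homNZ in \<open>auto simp: Z_def\<close>)
qed

text \<open>
  The function of the previous lemma, the difference of the two distances, has a critical
  point at the origin: on the slice by hypothesis, on the chain because it is aligned.  Its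
  Hessian is the orthogonal sum of two non-degenerate forms, so the Morse lemma turns its zero
  set into the cone of this Hessian.
\<close>

lemma reduced_config_space_cone_chart:
  fixes \<phi>0 :: "'a::euclidean_space ^ 'v::finite"
  assumes lk: "is_linkage \<Gamma>" and ch: "is_open_chain_in \<Gamma> x k" and e: "norm e = 1"
    and \<phi>0: "\<phi>0 \<in> reduced_config_space \<Gamma> (x 0) (x k) e"
    and al: "\<And>j. j < k \<Longrightarrow> \<exists>\<epsilon>. (\<epsilon> = 1 \<or> \<epsilon> = -1) \<and>
      \<phi>0 $ x (Suc j) - \<phi>0 $ x j = (\<epsilon> * len \<Gamma> {x j, x (Suc j)}) *\<^sub>R e"
    and nd: "nondegenerate_critical_point (reduced_config_space (complementary_linkage \<Gamma> x k) (x 0) (x k) e)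
      (reduced_work_map (x 0) (x k)) (complement_part \<Gamma> x k \<phi>0)"
  obtains T :: "(('a ^ 'v) \<times> ('a ^ 'v)) set" and H s b \<sigma> N K F P where
    "subspace T" "bilinear H" "\<forall>u v. H u v = H v u"
    "\<forall>i<s. b i \<in> T \<and> (\<sigma> i = 1 \<or> \<sigma> i = (-1::real))"
    "\<forall>i<s. \<forall>j<s. H (b i) (b j) = (if i = j then \<sigma> i else 0)"
    "\<forall>z\<in>T. z = (\<Sum>i<(s::nat). (\<sigma> i * H z (b i)) *\<^sub>R b i)"
    "openin (top_of_set (reduced_config_space \<Gamma> (x 0) (x k) e)) N" "\<phi>0 \<in> N"
    "openin (top_of_set {z \<in> T. H z z = 0}) K" "homeomorphism N K F P" "F \<phi>0 = 0"
proof -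
  note ch' = open_chain_inD[OF lk ch]
  let ?R = "reduced_config_space \<Gamma> (x 0) (x k) e :: ('a ^ 'v) set"
  let ?f = "reduced_work_map (x 0) (x k) :: 'a ^ 'v \<Rightarrow> real"
  define l where "l j = len \<Gamma> {x j, x (Suc j)}" for j
  have lpos: "0 < l j" if "j < k" for j using ch'(4)[OF that] by (simp add: l_def)
  obtain \<epsilon> where \<epsilon>: "\<And>j. j < k \<Longrightarrow> \<epsilon> j = 1 \<or> \<epsilon> j = (-1::real)"
    and al': "\<And>j. j < k \<Longrightarrow> \<phi>0 $ x (Suc j) - \<phi>0 $ x j = (\<epsilon> j * l j) *\<^sub>R e"
    using al unfolding l_def by metis
  obtain L U W \<Phi> \<Psi> where
    sc: "slice_chart (reduced_config_space (complementary_linkage \<Gamma> x k) (x 0) (x k) e)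
      (complement_part \<Gamma> x k \<phi>0) L U W \<Phi> \<Psi>"
    and sf: "smooth_map_on U ?f" and cr: "\<And>u. u \<in> L \<Longrightarrow> frechet_derivative (?f \<circ> \<Psi>) (at 0) u = 0"
    and ndg: "\<And>u. u \<in> L \<Longrightarrow> (\<And>v. v \<in> L \<Longrightarrow> second_derivative (?f \<circ> \<Psi>) 0 u v = 0) \<Longrightarrow> u = 0"
    using nd unfolding nondegenerate_critical_point_def by blast
  have W: "open W" "\<Psi> ` W \<subseteq> U" "smooth_map_on W \<Psi>" and L: "subspace L"
    using sc by (auto simp: slice_chart_def homeomorphism_def)
  obtain O2 N F P where O2: "open O2" "0 \<in> O2" "O2 \<subseteq> W \<times> {y. \<forall>j<k. norm (y $ x (Suc j)) < l j}"
    and N: "openin (top_of_set ?R) N" "\<phi>0 \<in> N" "F \<phi>0 = 0"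
    and hom: "homeomorphism N {z \<in> (L \<times> chain_tangent e x k) \<inter> O2.
        ?f (\<Psi> (fst z)) - chain_reach \<epsilon> l x k (snd z) = 0} F P"
    by (rule reduced_config_space_chart[OF lk ch e \<phi>0 l_def \<epsilon> al' sc])
  define T where "T = L \<times> chain_tangent e x k"
  have T: "subspace T" unfolding T_def by (intro subspace_Times L subspace_chain_tangent)
  define g where "g = ?f \<circ> \<Psi>"
  define G where "G z = g (fst z) - chain_reach \<epsilon> l x k (snd z)" for z :: "('a ^ 'v) \<times> ('a ^ 'v)"
  define G' where "G' z v = frechet_derivative g (at (fst z)) (fst v)
      - chain_reach_deriv \<epsilon> l x k (snd z) (snd v)" for z v :: "('a ^ 'v) \<times> ('a ^ 'v)"
  define H where "H v u = second_derivative g 0 (fst v) (fst u) - chain_hessian \<epsilon> l x k (snd v) (snd u)" for v u :: "('a ^ 'v) \<times> ('a ^ 'v)"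
  note g_deriv = second_derivative_compose[OF sf W(3,1,2), folded g_def]
  have dG: "(G has_derivative G' z) (at z)" if "z \<in> O2" for z
  proof -
    have "fst z \<in> W" "\<And>j. j < k \<Longrightarrow> norm (snd z $ x (Suc j)) < l j" using that O2(3) by auto
    then show ?thesis unfolding G_def[abs_def] G'_def[abs_def]
      by (intro has_derivative_diff
          has_derivative_compose[OF has_derivative_fst[OF has_derivative_ident] g_deriv(1)]
          has_derivative_compose[OF has_derivative_snd[OF has_derivative_ident] chain_reach_has_derivative]) auto
  qed
  have zW: "fst (0 :: ('a ^ 'v) \<times> ('a ^ 'v)) \<in> W"
    using subsetD[OF O2(3,2)] by (simp add: mem_Times_iff)
  have d2: "((\<lambda>z. G' z v) has_derivative H v) (at 0)" for v
    unfolding G'_def H_def[abs_def]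
  proof (rule has_derivative_diff)
    have "((\<lambda>a. frechet_derivative g (at a) (fst v)) has_derivative second_derivative g 0 (fst v))
        (at (fst (0 :: ('a ^ 'v) \<times> ('a ^ 'v))))"
      using g_deriv(2)[OF zW, of "fst v"] by simp
    from has_derivative_compose[OF has_derivative_fst[OF has_derivative_ident] this]
    show "((\<lambda>z. frechet_derivative g (at (fst z)) (fst v)) has_derivative
        (\<lambda>u. second_derivative g 0 (fst v) (fst u))) (at (0 :: ('a ^ 'v) \<times> ('a ^ 'v)))" .
    have "((\<lambda>y. chain_reach_deriv \<epsilon> l x k y (snd v)) has_derivative chain_hessian \<epsilon> l x k (snd v))
        (at (snd (0 :: ('a ^ 'v) \<times> ('a ^ 'v))))"
      using chain_reach_has_second_derivative[OF lpos] by simp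
    from has_derivative_compose[OF has_derivative_snd[OF has_derivative_ident] this]
    show "((\<lambda>z. chain_reach_deriv \<epsilon> l x k (snd z) (snd v)) has_derivative
        (\<lambda>u. chain_hessian \<epsilon> l x k (snd v) (snd u))) (at (0 :: ('a ^ 'v) \<times> ('a ^ 'v)))" .
  qed
  have bil: "bilinear H" and sym: "\<And>u v. H u v = H v u"
    using second_derivative_bilinear[OF O2(1,2) dG d2] second_derivative_symmetric[OF O2(1,2) dG d2] by auto
  have crit: "G' 0 v = 0" if "v \<in> T" for v
    using that cr by (auto simp: G'_def T_def g_def chain_reach_deriv_def)
  have "(\<Sum>j<k. \<epsilon> j * l j) \<noteq> 0"
  proof
    assume "(\<Sum>j<k. \<epsilon> j * l j) = 0"
    then have "(\<Sum>j<k. (\<epsilon> j * l j) *\<^sub>R e) = 0" by (simp flip: scaleR_sum_left)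
    then have "(\<Sum>j<k. \<phi>0 $ x (Suc j) - \<phi>0 $ x j) = 0" using al' by simp
    then have "\<phi>0 $ x k = \<phi>0 $ x 0" using sum_lessThan_telescope[of "\<lambda>j. \<phi>0 $ x j" k] by simp
    then show False using \<phi>0 by (simp add: reduced_config_space_def)
  qed
  note cnd = chain_hessian_nondegenerate[OF ch'(1) lpos \<epsilon> this]
  have nondeg: "u = 0" if u: "u \<in> T" "\<And>v. v \<in> T \<Longrightarrow> H u v = 0" for u
  proof -
    have u12: "fst u \<in> L" "snd u \<in> chain_tangent e x k" using u(1) by (auto simp: T_def)
    have z0: "0 \<in> L" "0 \<in> chain_tangent e x k"
      using L subspace_chain_tangent by (auto intro: subspace_0)
    have s0: "second_derivative g 0 (fst u) 0 = 0"
    proof -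
      have "linear (second_derivative g 0 (fst u))"
        using g_deriv(2)[OF zW, of "fst u"] has_derivative_linear by auto
      then show ?thesis by (rule linear_0)
    qed
    have "fst u = 0"
    proof (rule ndg[OF u12(1)])
      fix v assume "v \<in> L"
      then have "H u (v, 0) = 0" using u(2) z0 by (simp add: T_def)
      then show "second_derivative (?f \<circ> \<Psi>) 0 (fst u) v = 0" by (simp add: H_def chain_hessian_def g_def)
    qed
    moreover have "snd u = 0"
    proof (rule cnd[OF _ _ u12(2)])
      fix v assume "v \<in> chain_tangent e x k"
      then have "H u (0, v) = 0" using u(2) z0 by (simp add: T_def)
      then show "chain_hessian \<epsilon> l x k (snd u) v = 0" using s0 by (simp add: H_def)
    qed
    ultimately show ?thesis by (simp add: prod_eq_iff)
  qed
  from diagonal_basis[OF bil sym T nondeg]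
  obtain s :: nat and b and \<sigma> :: "nat \<Rightarrow> real" where
    bs: "\<forall>i<s. b i \<in> T \<and> (\<sigma> i = 1 \<or> \<sigma> i = -1)"
     "\<forall>i<s. \<forall>j<s. H (b i) (b j) = (if i = j then \<sigma> i else 0)"
     "\<forall>z\<in>T. z = (\<Sum>i<s. (\<sigma> i * H z (b i)) *\<^sub>R b i)"
    by blast
  define Z where "Z = {z \<in> T \<inter> O2. G z = 0}"
  have homZ: "homeomorphism N Z F P"
    using hom by (simp add: Z_def T_def G_def g_def)
  have "0 \<in> Z" using homZ N(2,3) unfolding homeomorphism_def by (metis imageI)
  then have G0: "G 0 = 0" by (simp add: Z_def)
  have bT: "b i \<in> T" and b\<sigma>: "\<sigma> i = 1 \<or> \<sigma> i = - 1" if "i < s" for i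
    using bs(1) that by auto
  have bb: "H (b i) (b j) = (if i = j then \<sigma> i else 0)" if "i < s" "j < s" for i j
    using bs(2) that by blast
  have bz: "z = (\<Sum>i<s. (\<sigma> i * H z (b i)) *\<^sub>R b i)" if "z \<in> T" for z
    using bs(3) that by blast
  obtain B M where B: "openin (top_of_set T) B" "0 \<in> B" "B \<subseteq> O2" and M: "continuous_on B M" "inj_on M B"
    "M ` B \<subseteq> T" "M 0 = 0" "\<forall>z\<in>B. H (M z) (M z) = 2 * G z"
    by (rule morse_coordinates[OF O2(1,2) dG d2 bil sym T G0 crit bT b\<sigma> bb bz])
  have BT: "B \<subseteq> T" using B(1) openin_imp_subset by blast
  have openM: "openin (top_of_set T) (M ` C)" if "openin (top_of_set T) C" "C \<subseteq> B" for C
    by (rule invariance_of_domain_subspaces[OF that(1) T T])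
       (use M that(2) in \<open>auto intro: continuous_on_subset inj_on_subset\<close>)
  have openM': "openin (top_of_set (M ` B)) (M ` C)" if "openin (top_of_set B) C" for C
  proof -
    have "openin (top_of_set T) C" "C \<subseteq> B" using that B(1) openin_trans openin_imp_subset by blast+
    then show ?thesis using openM M(3) by (meson image_mono openin_subset_trans)
  qed
  obtain M' where homM: "homeomorphism B (M ` B) M M'"
    by (rule homeomorphism_injective_open_map[OF M(1) refl M(2) openM'])
  define K where "K = M ` (B \<inter> Z)"
  have "K = M ` B \<inter> {z \<in> T. H z z = 0}"
    using M(3,5) B(3) BT by (auto simp: K_def Z_def)
  then have K: "openin (top_of_set {z \<in> T. H z z = 0}) K"
    using openM[OF B(1) order.refl] unfolding openin_open by auto
  have BZ: "openin (top_of_set Z) (B \<inter> Z)"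
    using B(1) unfolding openin_open Z_def by auto
  define N' where "N' = P ` (B \<inter> Z)"
  have hPF: "homeomorphism Z N P F" using homZ by (rule homeomorphism_symD)
  have "openin (top_of_set N) N'" unfolding N'_def by (rule homeomorphism_imp_open_map[OF hPF BZ])
  then have N': "openin (top_of_set ?R) N'" using N(1) openin_trans by blast
  have PF: "P 0 = \<phi>0" using homZ N(2,3) unfolding homeomorphism_def by metis
  have "0 \<in> B \<inter> Z" using B(2) \<open>0 \<in> Z\<close> by blast
  then have \<phi>N': "\<phi>0 \<in> N'" unfolding N'_def using PF by force
  have h1: "homeomorphism (B \<inter> Z) N' P F"
    by (rule homeomorphism_of_subsets[OF hPF]) (use hPF in \<open>auto simp: N'_def homeomorphism_def\<close>)
  have h2: "homeomorphism (B \<inter> Z) K M M'"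
    by (rule homeomorphism_of_subsets[OF homM]) (use homM in \<open>auto simp: K_def homeomorphism_def\<close>)
  have h: "homeomorphism N' K (M \<circ> F) (P \<circ> M')"
    using homeomorphism_compose[OF homeomorphism_symD[OF h1] h2] .
  have "(M \<circ> F) \<phi>0 = 0" using N(3) M(4) by simp
  moreover have "\<forall>u v. H u v = H v u" using sym by blast
  ultimately show thesis using that[OF T bil _ bs N' \<phi>N' K h] by blast
qed

section \<open>Splitting off the direction of the end-effector\<close>

text \<open>
  The rotation by the angle \<open>\<pi>\<close> about the axis \<open>n + e\<close>.  It exchanges the unit vectors \<open>n\<close> and \<open>e\<close> and
  depends continuously on \<open>n \<noteq> - e\<close>.
\<close>

definition half_turn :: "'a::euclidean_space \<Rightarrow> 'a \<Rightarrow> 'a \<Rightarrow> 'a" where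
  "half_turn n e v = (2 * inner v (n + e) / inner (n + e) (n + e)) *\<^sub>R (n + e) - v"

lemma half_turn:
  fixes n e :: "'a::euclidean_space"
  assumes n: "norm n = 1" and e: "norm e = 1" and ne: "n \<noteq> - e"
  shows "linear (half_turn n e)" "norm (half_turn n e v) = norm v"
    "half_turn n e (half_turn n e v) = v" "half_turn n e n = e" "half_turn n e e = n"
proof -
  define w where "w = n + e"
  have w0: "inner w w \<noteq> 0" using ne by (simp add: w_def eq_neg_iff_add_eq_0)
  have h: "half_turn n e u = (2 * inner u w / inner w w) *\<^sub>R w - u" for u
    by (simp add: half_turn_def w_def)
  show "linear (half_turn n e)"
    unfolding h by (rule linearI) (simp_all add: inner_simps algebra_simps add_divide_distrib)
  have hw: "inner (half_turn n e v) w = inner v w" for v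
    using w0 by (simp add: h inner_simps)
  show "half_turn n e (half_turn n e v) = v"
    unfolding h[of "half_turn n e v"] hw by (simp add: h)
  have "inner (half_turn n e v) (half_turn n e v) = inner v v"
  proof -
    have "inner (half_turn n e v) (half_turn n e v)
        = (2 * inner v w / inner w w) * inner w (half_turn n e v) - inner v (half_turn n e v)"
      by (subst (1) h) (simp add: inner_simps)
    also have "inner w (half_turn n e v) = inner v w" using hw[of v] by (simp add: inner_commute)
    also have "inner v (half_turn n e v) = (2 * inner v w / inner w w) * inner v w - inner v v"
      by (simp add: h inner_simps)
    finally show ?thesis by simp
  qed
  then show "norm (half_turn n e v) = norm v" by (simp add: norm_eq_sqrt_inner)
  have nn: "inner n n = 1" "inner e e = 1" using n e by (simp_all add: dot_square_norm)
  have ww: "inner w w = 2 + 2 * inner n e" by (simp add: w_def inner_simps nn inner_commute[of e n])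
  have "inner n w = 1 + inner n e" "inner e w = 1 + inner n e"
    by (simp_all add: w_def inner_simps nn inner_commute[of e n])
  then have "2 * inner n w / inner w w = 1" "2 * inner e w / inner w w = 1"
    using w0 ww by (simp_all add: field_simps)
  then show "half_turn n e n = e" "half_turn n e e = n" by (simp_all add: h w_def)
qed

text \<open>
  A configuration whose end-effector has the direction \<open>n\<close>, after the fixed transformation \<open>R\<close>, is
  turned into the reduced space by \<open>half_turn n e\<close>.  The additional \<open>half_turn e e\<close> makes the
  composition the identity for \<open>n = e\<close>, such that \<open>\<V>\<close> corresponds to \<open>\<chi> v. R (\<V> $ v)\<close>.
\<close>

lemma pointed_config_space_direction_splitting:
  fixes R :: "'a::euclidean_space \<Rightarrow> 'a" and \<V> :: "'a ^ 'v::finite"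
  assumes R: "orthogonal_transformation R" and e: "norm e = 1"
    and \<V>: "\<V> \<in> pointed_config_space \<Gamma> xs" "\<V> $ xe \<noteq> 0" and RV: "R (\<V> $ xe) = norm (\<V> $ xe) *\<^sub>R e"
  obtains N A B where "openin (top_of_set (pointed_config_space \<Gamma> xs)) N" "\<V> \<in> N"
    "homeomorphism N ((sphere 0 1 - {- e}) \<times> reduced_config_space \<Gamma> xs xe e) A B"
    "A \<V> = (e, \<chi> v. R (\<V> $ v))"
proof -
  let ?C = "pointed_config_space \<Gamma> xs :: ('a ^ 'v) set" and ?D = "reduced_config_space \<Gamma> xs xe e :: ('a ^ 'v) set"
  let ?S = "sphere 0 1 - {- e}"
  have lin: "linear R" and nR: "\<And>u. norm (R u) = norm u"
    using R by (auto simp: orthogonal_transformation)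
  have R': "orthogonal_transformation (inv R)" using R by (rule orthogonal_transformation_inv)
  have lin': "linear (inv R)" and nR': "\<And>u. norm (inv R u) = norm u"
    using R' by (auto simp: orthogonal_transformation)
  have RR': "R (inv R u) = u" and R'R: "inv R (R u) = u" for u
    using orthogonal_transformation_bij[OF R] by (simp_all add: bij_is_surj surj_f_inv_f bij_is_inj)
  have cR: "continuous_on X R" "continuous_on X (inv R)" for X
    using lin lin' by (simp_all add: linear_continuous_on linear_linear)
  have e': "e \<noteq> - e"
  proof
    assume "e = - e"
    then have "2 *\<^sub>R e = 0" by (metis add.right_inverse scaleR_2)
    then show False using e by simp
  qed
  define N where "N = {\<phi> \<in> ?C. R (\<phi> $ xe) \<noteq> - (norm (\<phi> $ xe) *\<^sub>R e)}"
  define n where "n \<phi> = sgn (R (\<phi> $ xe))" for \<phi> :: "'a ^ 'v"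
  define A where "A \<phi> = (n \<phi>, \<chi> v. half_turn e e (half_turn (n \<phi>) e (R (\<phi> $ v))))" for \<phi>
  define B :: "'a \<times> ('a ^ 'v) \<Rightarrow> 'a ^ 'v" where
    "B z = (\<chi> v. inv R (half_turn (fst z) e (half_turn e e (snd z $ v))))" for z
  have cn: "continuous_on N (\<lambda>\<phi>. \<phi> $ v)" for v by (intro continuous_intros)
  have "N = ?C \<inter> {\<phi>. R (\<phi> $ xe) \<noteq> - (norm (\<phi> $ xe) *\<^sub>R e)}" by (auto simp: N_def)
  moreover have "open {\<phi> :: 'a ^ 'v. R (\<phi> $ xe) \<noteq> - (norm (\<phi> $ xe) *\<^sub>R e)}"
    by (intro open_Collect_neq continuous_intros continuous_on_compose2[OF cR(1)[of UNIV]]) auto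
  ultimately have oN: "openin (top_of_set ?C) N" by (auto intro: openin_open_Int)
  have nS: "n \<phi> \<in> ?S" "\<phi> $ xe \<noteq> 0" "R (\<phi> $ xe) = norm (\<phi> $ xe) *\<^sub>R n \<phi>" if "\<phi> \<in> N" for \<phi>
  proof -
    show x0: "\<phi> $ xe \<noteq> 0" using that linear_0[OF lin] by (auto simp: N_def)
    then have r0: "R (\<phi> $ xe) \<noteq> 0" using nR by (metis norm_eq_zero)
    show eq: "R (\<phi> $ xe) = norm (\<phi> $ xe) *\<^sub>R n \<phi>" using x0 by (simp add: n_def sgn_div_norm nR)
    have "n \<phi> \<noteq> - e" using that eq by (auto simp: N_def)
    then show "n \<phi> \<in> ?S" using r0 by (simp add: n_def norm_sgn)
  qed
  have AN: "A \<phi> \<in> ?S \<times> ?D \<and> B (A \<phi>) = \<phi>" if \<phi>: "\<phi> \<in> N" for \<phi>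
  proof -
    have n1: "norm (n \<phi>) = 1" "n \<phi> \<noteq> - e" using nS[OF \<phi>] by auto
    note h1 = half_turn[OF n1(1) e n1(2)] and h2 = half_turn[OF e e e']
    let ?Q = "\<lambda>u. half_turn e e (half_turn (n \<phi>) e (R u))"
    have lQ: "linear ?Q"
      using linear_compose[OF linear_compose[OF lin h1(1)] h2(1)] by (simp add: o_def)
    have a: "(\<chi> v. ?Q (\<phi> $ v)) \<in> ?C"
      by (rule pointed_config_space_isometry[OF lQ]) (use h1 h2 nR \<phi> in \<open>auto simp: N_def\<close>)
    have "?Q (\<phi> $ xe) = norm (\<phi> $ xe) *\<^sub>R e"
      unfolding nS(3)[OF \<phi>] linear_scale[OF h1(1)] linear_scale[OF h2(1)] h1(4) h2(4) ..
    then have "(\<chi> v. ?Q (\<phi> $ v)) \<in> ?D"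
      using a nS(2)[OF \<phi>] e by (auto simp: reduced_config_space_def pointed_config_space_def sgn_scaleR sgn_div_norm)
    moreover have "B (A \<phi>) = \<phi>" by (simp add: B_def A_def vec_eq_iff h1 h2 R'R)
    ultimately show ?thesis using nS[OF \<phi>] by (simp add: A_def)
  qed
  have BN: "B z \<in> N \<and> A (B z) = z" if z: "z \<in> ?S \<times> ?D" for z
  proof -
    obtain m a where za: "z = (m, a)" by (cases z)
    have m: "norm m = 1" "m \<noteq> - e" and a: "a \<in> ?D" using z za by auto
    note h1 = half_turn[OF m(1) e m(2)] and h2 = half_turn[OF e e e']
    let ?Q = "\<lambda>u. inv R (half_turn m e (half_turn e e u))"
    have lQ: "linear ?Q"
      using linear_compose[OF linear_compose[OF h2(1) h1(1)] lin'] by (simp add: o_def)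
    have aC: "a \<in> ?C" and a0: "a $ xs = 0" and axe: "a $ xe \<noteq> 0" "sgn (a $ xe) = e"
      using a by (auto simp: reduced_config_space_def pointed_config_space_def)
    have "a $ xe = norm (a $ xe) *\<^sub>R e" using axe by (metis sgn_div_norm norm_eq_zero scaleR_scaleR right_inverse scaleR_one)
    moreover have "half_turn m e (half_turn e e (t *\<^sub>R e)) = t *\<^sub>R m" for t
      unfolding linear_scale[OF h2(1)] h2(4) linear_scale[OF h1(1)] h1(5) ..
    ultimately have "half_turn m e (half_turn e e (a $ xe)) = norm (a $ xe) *\<^sub>R m" by metis
    then have Bxe: "R (B z $ xe) = norm (a $ xe) *\<^sub>R m" by (simp add: B_def za RR')
    have BC: "B z \<in> ?C" unfolding B_def za fst_conv snd_conv
      by (rule pointed_config_space_isometry[OF lQ _ aC]) (simp add: nR' h1 h2)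
    have nB: "norm (B z $ xe) = norm (a $ xe)" using nR[of "B z $ xe"] Bxe m by simp
    have "norm (a $ xe) *\<^sub>R m \<noteq> norm (a $ xe) *\<^sub>R (- e)"
      unfolding scaleR_cancel_left using m axe by simp
    then have "B z \<in> N" using BC Bxe nB by (simp add: N_def)
    moreover have nz: "n (B z) = m" using Bxe axe m by (simp add: n_def sgn_scaleR sgn_div_norm)
    moreover have "A (B z) = z"
      unfolding A_def nz by (simp add: za B_def vec_eq_iff RR' h1 h2)
    ultimately show ?thesis by blast
  qed
  have cA: "continuous_on N A"
  proof -
    have c1: "continuous_on N (\<lambda>\<phi>. R (\<phi> $ v))" for v
      by (rule continuous_on_compose2[OF cR(1)[of UNIV] cn]) auto
    have r0: "R (\<phi> $ xe) \<noteq> 0" if "\<phi> \<in> N" for \<phi> using nS(2)[OF that] nR by (metis norm_eq_zero)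
    have cn': "continuous_on N n" unfolding n_def[abs_def] sgn_div_norm
      using r0 by (intro continuous_intros c1) auto
    have "inner (n \<phi> + e) (n \<phi> + e) \<noteq> 0" if "\<phi> \<in> N" for \<phi>
      using nS(1)[OF that] by (auto simp: eq_neg_iff_add_eq_0)
    moreover have "inner (e + e) (e + e) \<noteq> 0" using e' by (auto simp: eq_neg_iff_add_eq_0)
    ultimately show ?thesis unfolding A_def half_turn_def
      by (intro continuous_on_Pair cn' continuous_on_vec_lambda continuous_intros c1) auto
  qed
  have cB: "continuous_on (?S \<times> ?D) B"
  proof -
    have "inner (fst z + e) (fst z + e) \<noteq> 0" if "z \<in> ?S \<times> ?D" for z
      using that by (auto simp: eq_neg_iff_add_eq_0)
    moreover have "inner (e + e) (e + e) \<noteq> 0" using e' by (auto simp: eq_neg_iff_add_eq_0)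
    ultimately show ?thesis unfolding B_def half_turn_def
      by (intro continuous_on_vec_lambda continuous_on_compose2[OF cR(2)[of UNIV]] continuous_intros) auto
  qed
  have hom: "homeomorphism N (?S \<times> ?D) A B"
    by (rule homeomorphismI[OF cA cB]) (use AN BN in blast)+
  have VN: "\<V> \<in> N"
  proof -
    have "norm (\<V> $ xe) *\<^sub>R e \<noteq> norm (\<V> $ xe) *\<^sub>R (- e)"
      unfolding scaleR_cancel_left using e' \<V>(2) by simp
    then show ?thesis using \<V>(1) RV by (simp add: N_def)
  qed
  have AV: "A \<V> = (e, \<chi> v. R (\<V> $ v))"
  proof -
    have nV: "n \<V> = e" using RV \<V>(2) e by (simp add: n_def sgn_scaleR sgn_div_norm)
    show ?thesis unfolding A_def nV by (simp add: half_turn[OF e e e'])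
  qed
  show thesis by (rule that[OF oN VN hom AV])
qed

section \<open>Quadratic cones in coordinates\<close>

text \<open>
  If \<open>s = 0\<close> there is no non-zero quadratic polynomial in \<open>s\<close> variables, and the one-point cone
  is realized as the zero set of \<open>y\<^sup>2\<close> in one variable.
\<close>

lemma cone_homeomorphic_quadratic_cone:
  fixes T :: "'b::euclidean_space set" and H :: "'b \<Rightarrow> 'b \<Rightarrow> real" and s :: nat
  assumes T: "subspace T" and bil: "bilinear H"
    and b: "\<And>i. i < s \<Longrightarrow> b i \<in> T" and \<sigma>: "\<And>i. i < s \<Longrightarrow> \<sigma> i = 1 \<or> \<sigma> i = (-1::real)"
    and Hb: "\<And>i j. i < s \<Longrightarrow> j < s \<Longrightarrow> H (b i) (b j) = (if i = j then \<sigma> i else 0)"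
    and exp: "\<And>x. x \<in> T \<Longrightarrow> x = (\<Sum>i<s. (\<sigma> i * H x (b i)) *\<^sub>R b i)"
    and K: "openin (top_of_set {x \<in> T. H x x = 0}) K" "0 \<in> K"
  obtains s' c K' \<kappa> where "nonzero_coefficients s' c" "openin (quadratic_cone s' c) K'" "(\<lambda>_. 0) \<in> K'"
    "homeomorphic_map (top_of_set K) (subtopology (quadratic_cone s' c) K') \<kappa>" "\<kappa> 0 = (\<lambda>_. 0)"
proof (cases "s = 0")
  case True
  then have T0: "T \<subseteq> {0}" using exp by auto
  then have K0: "K = {0}" using K openin_imp_subset by blast
  let ?z = "\<lambda>_::nat. 0::real" and ?c = "\<lambda>(_::nat) (_::nat). 1::real"
  have q: "topspace (quadratic_cone 1 ?c) = {?z}"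
    by (auto simp: quadratic_cone_def quadratic_polynomial_def topspace_Euclidean_space fun_eq_iff Suc_le_eq)
      (metis gr0I)
  have "homeomorphic_maps (top_of_set {0::'b}) (subtopology (quadratic_cone 1 ?c) {?z}) (\<lambda>_. ?z) (\<lambda>_. 0)"
    unfolding homeomorphic_maps_def using q by auto
  then have h: "homeomorphic_map (top_of_set K) (subtopology (quadratic_cone 1 ?c) {?z}) (\<lambda>_. ?z)"
    unfolding K0 homeomorphic_map_maps by blast
  show thesis
  proof (rule that[OF _ _ _ h])
    show "nonzero_coefficients 1 ?c" by (simp add: nonzero_coefficients_def)
    show "openin (quadratic_cone 1 ?c) {?z}" using q openin_topspace by metis
  qed auto
next
  case False
  define c where "c i j = (if i = j then \<sigma> i else 0)" for i j :: nat
  have lin: "linear (\<lambda>x. H x u)" "linear (H u)" for u using bil by (simp_all add: bilinear_def)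
  let ?f = "\<lambda>y. \<Sum>i<s. y i *\<^sub>R b i" and ?g = "\<lambda>x i. if i < s then \<sigma> i * H x (b i) else 0"
  have fg: "homeomorphic_maps (Euclidean_space s) (top_of_set T) ?f ?g"
  proof (rule homeomorphic_maps_coordinates[OF T])
    show "linear (\<lambda>x. \<sigma> i * H x (b i))" for i
      using linear_compose[OF lin(1)[of "b i"] linear_times[of "\<sigma> i"]] by (simp add: o_def)
    show "\<sigma> i * H (b j) (b i) = (if i = j then 1 else 0)" if "i < s" "j < s" for i j
      using \<sigma>[OF that(1)] Hb[OF that(2,1)] by auto
  qed (use b exp in auto)
  have qp: "quadratic_polynomial s c y = H (?f y) (?f y)" for y
  proof -
    have l1: "H (?f y) w = (\<Sum>i<s. y i * H (b i) w)" for w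
      by (simp add: linear_sum[OF lin(1)] linear_scale[OF lin(1)])
    have l2: "H w (?f y) = (\<Sum>i<s. y i * H w (b i))" for w
      by (simp add: linear_sum[OF lin(2)] linear_scale[OF lin(2)])
    have "H (?f y) (?f y) = (\<Sum>i<s. y i * H (b i) (?f y))" by (rule l1)
    also have "\<dots> = (\<Sum>i<s. \<Sum>j<s. y i * (y j * H (b i) (b j)))"
      by (simp only: l2 sum_distrib_left)
    also have "\<dots> = (\<Sum>i<s. \<Sum>j<s. if j = i then \<sigma> i * y i * y i else 0)"
      by (intro sum.cong refl) (auto simp: Hb)
    also have "\<dots> = (\<Sum>i<s. \<sigma> i * y i * y i)" by simp
    also have "\<dots> = quadratic_polynomial s c y"
      unfolding quadratic_polynomial_def
    proof (rule sum.cong[OF refl])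
      fix j
      have "(\<Sum>i\<le>j. c i j * y i * y j) = (\<Sum>i\<le>j. if i = j then \<sigma> j * y j * y j else 0)"
        by (intro sum.cong) (auto simp: c_def)
      then show "\<sigma> j * y j * y j = (\<Sum>i\<le>j. c i j * y i * y j)" by simp
    qed
    finally show ?thesis by simp
  qed
  have "homeomorphic_maps (subtopology (Euclidean_space s) {y. quadratic_polynomial s c y = 0})
      (subtopology (top_of_set T) {x. H x x = 0}) ?f ?g"
  proof (rule homeomorphic_maps_subtopologies_alt[OF fg])
    show "?f ` (topspace (Euclidean_space s) \<inter> {y. quadratic_polynomial s c y = 0}) \<subseteq> {x. H x x = 0}"
      using qp by auto
    show "?g ` (topspace (top_of_set T) \<inter> {x. H x x = 0}) \<subseteq> {y. quadratic_polynomial s c y = 0}"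
    proof clarify
      fix x assume x: "x \<in> topspace (top_of_set T)" "H x x = 0"
      then have "?f (?g x) = x" using fg unfolding homeomorphic_maps_def by blast
      then show "quadratic_polynomial s c (?g x) = 0" unfolding qp using x(2) by simp
    qed
  qed
  moreover have "subtopology (top_of_set T) {x. H x x = 0} = top_of_set {x \<in> T. H x x = 0}"
    by (simp add: subtopology_subtopology Int_def)
  ultimately have "homeomorphic_maps (quadratic_cone s c) (top_of_set {x \<in> T. H x x = 0}) ?f ?g"
    by (simp only: quadratic_cone_def)
  then have hm: "homeomorphic_maps (top_of_set {x \<in> T. H x x = 0}) (quadratic_cone s c) ?g ?f"
    by (rule homeomorphic_maps_sym[THEN iffD1])
  have KT: "K \<subseteq> {x \<in> T. H x x = 0}" using K(1) openin_imp_subset by blast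
  define K' where "K' = ?g ` K"
  have hg: "homeomorphic_map (top_of_set {x \<in> T. H x x = 0}) (quadratic_cone s c) ?g"
    using hm homeomorphic_map_maps by blast
  have oK': "openin (quadratic_cone s c) K'"
    unfolding K'_def using hg K(1) homeomorphic_map_openness_eq by blast
  have "homeomorphic_map (subtopology (top_of_set {x \<in> T. H x x = 0}) K) (subtopology (quadratic_cone s c) K') ?g"
  proof (rule homeomorphic_map_subtopologies[OF hg])
    have "K' \<subseteq> topspace (quadratic_cone s c)" using oK' openin_subset by blast
    then show "?g ` (topspace (top_of_set {x \<in> T. H x x = 0}) \<inter> K) = topspace (quadratic_cone s c) \<inter> K'"
      using KT by (simp add: K'_def inf.absorb2)
  qed
  moreover have "subtopology (top_of_set {x \<in> T. H x x = 0}) K = top_of_set K"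
    using KT by (simp add: subtopology_subtopology inf.absorb2)
  ultimately have h: "homeomorphic_map (top_of_set K) (subtopology (quadratic_cone s c) K') ?g" by simp
  have g0: "?g 0 = (\<lambda>_. 0)" by (simp add: bilinear_lzero[OF bil] fun_eq_iff)
  show thesis
  proof (rule that[OF _ oK' _ h g0])
    have "c 0 0 \<noteq> 0" using False \<sigma>[of 0] by (auto simp: c_def)
    then show "nonzero_coefficients s c"
      using False unfolding nonzero_coefficients_def by blast
    have "?g 0 \<in> K'" unfolding K'_def using K(2) by (rule imageI)
    then show "(\<lambda>_. 0) \<in> K'" by (simp only: g0)
  qed
qed

section \<open>The local structure\<close>

lemma homeomorphism_Times:
  assumes "homeomorphism A A' f f'" "homeomorphism B B' g g'"
  shows "homeomorphism (A \<times> B) (A' \<times> B') (\<lambda>z. (f (fst z), g (snd z))) (\<lambda>z. (f' (fst z), g' (snd z)))"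
proof -
  have c: "continuous_on A f" "continuous_on A' f'" "continuous_on B g" "continuous_on B' g'"
    and i: "f ` A = A'" "f' ` A' = A" "g ` B = B'" "g' ` B' = B"
    and inv: "\<forall>x\<in>A. f' (f x) = x" "\<forall>y\<in>A'. f (f' y) = y" "\<forall>x\<in>B. g' (g x) = x" "\<forall>y\<in>B'. g (g' y) = y"
    using assms by (simp_all add: homeomorphism_def)
  have 1: "continuous_on (A \<times> B) (\<lambda>z. (f (fst z), g (snd z)))"
    by (intro continuous_on_Pair continuous_on_compose2[OF c(1) continuous_on_fst[OF continuous_on_id]]
        continuous_on_compose2[OF c(3) continuous_on_snd[OF continuous_on_id]]) auto
  have 2: "continuous_on (A' \<times> B') (\<lambda>z. (f' (fst z), g' (snd z)))"
    by (intro continuous_on_Pair continuous_on_compose2[OF c(2) continuous_on_fst[OF continuous_on_id]]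
        continuous_on_compose2[OF c(4) continuous_on_snd[OF continuous_on_id]]) auto
  show ?thesis
    by (rule homeomorphismI[OF 1 2]) (use i inv in auto)
qed

lemma homeomorphism_subspace_translation:
  fixes E :: "'b::euclidean_space set"
  assumes "subspace E" "z0 \<in> E"
  shows "homeomorphism E E (\<lambda>z. z - z0) (\<lambda>z. z + z0)"
proof (rule homeomorphismI)
  show "continuous_on E (\<lambda>z. z - z0)" by (intro continuous_intros)
  show "continuous_on E (\<lambda>z. z + z0)" by (intro continuous_intros)
qed (use assms in \<open>auto simp: subspace_diff subspace_add\<close>)

theorem proposition4p8:
  fixes \<Gamma> :: "'v::finite linkage"
    and x :: "nat \<Rightarrow> 'v"
    and k :: nat
    and e :: "'a::euclidean_space"
    and \<V> :: "'a ^ 'v"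
  assumes "is_linkage \<Gamma>"
    and "is_open_chain_in \<Gamma> x k"
    and "norm e = 1"
    and "\<V> \<in> pointed_config_space \<Gamma> (x 0)"
    and "generically_nontransverse \<Gamma> x k e \<V>"
  shows "locally_euclidean_times_quadratic_cone (top_of_set (pointed_config_space \<Gamma> (x 0))) \<V> \<and>
    (\<not> isolated_in_reduced_space \<Gamma> (x 0) (x k) e \<V> \<longrightarrow>
       topological_singularity (top_of_set (pointed_config_space \<Gamma> (x 0))) \<V>)"
proof -
  note lk = assms(1) and ch = assms(2) and e = assms(3) and \<V> = assms(4)
  note ch' = open_chain_inD[OF lk ch]
  let ?C = "pointed_config_space \<Gamma> (x 0) :: ('a ^ 'v) set"
  let ?R = "reduced_config_space \<Gamma> (x 0) (x k) e :: ('a ^ 'v) set"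
  have nt: "\<not> transverse_configuration \<Gamma> x k \<V>" and "\<V> $ x 0 \<noteq> \<V> $ x k"
    using assms(5) by (auto simp: generically_nontransverse_def)
  have \<V>0: "\<V> $ x 0 = 0" using \<V> by (simp add: pointed_config_space_def)
  with \<open>\<V> $ x 0 \<noteq> \<V> $ x k\<close> have ne: "\<V> $ x k \<noteq> 0" by simp
  have cp: "complement_part \<Gamma> x k \<V> $ x 0 = 0" "complement_part \<Gamma> x k \<V> $ x k = \<V> $ x k"
    using ch'(2)[of 0] ch'(2)[of k] ch'(5,6) \<V>0 by (simp_all add: complement_part_nth)
  obtain R where R: "orthogonal_transformation R" and RV: "R (\<V> $ x k) = norm (\<V> $ x k) *\<^sub>R e"
    and nd: "nondegenerate_critical_point (reduced_config_space (complementary_linkage \<Gamma> x k) (x 0) (x k) e)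
      (reduced_work_map (x 0) (x k)) (\<chi> v. R (complement_part \<Gamma> x k \<V> $ v))"
    using assms(5) unfolding generically_nontransverse_def is_reduced_coordinate_def
    by (auto simp: cp)
  have lin: "linear R" and nR: "\<And>u. norm (R u) = norm u"
    using R by (auto simp: orthogonal_transformation)
  define \<phi>0 where "\<phi>0 = (\<chi> v. R (\<V> $ v))"
  have "\<phi>0 \<in> ?C"
    unfolding \<phi>0_def by (rule pointed_config_space_isometry[OF lin nR \<V>])
  then have \<phi>0: "\<phi>0 \<in> ?R"
    using ne e \<V>0 linear_0[OF lin]
    by (simp add: reduced_config_space_def \<phi>0_def RV sgn_scaleR) (auto simp: sgn_div_norm)
  have "complement_part \<Gamma> x k \<phi>0 = (\<chi> v. R (complement_part \<Gamma> x k \<V> $ v))"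
    using linear_0[OF lin] by (simp add: vec_eq_iff complement_part_nth \<phi>0_def)
  with nd have nd': "nondegenerate_critical_point (reduced_config_space (complementary_linkage \<Gamma> x k) (x 0) (x k) e)
      (reduced_work_map (x 0) (x k)) (complement_part \<Gamma> x k \<phi>0)" by simp
  have Rs: "R (sgn (\<V> $ x k)) = e"
    using ne by (simp add: sgn_div_norm linear_scale[OF lin] RV)
  have al: "\<exists>\<epsilon>. (\<epsilon> = 1 \<or> \<epsilon> = -1) \<and>
      \<phi>0 $ x (Suc j) - \<phi>0 $ x j = (\<epsilon> * len \<Gamma> {x j, x (Suc j)}) *\<^sub>R e" if "j < k" for j
  proof -
    obtain \<epsilon> where \<epsilon>: "\<epsilon> = 1 \<or> \<epsilon> = -1"
      "\<V> $ x (Suc j) - \<V> $ x j = (\<epsilon> * len \<Gamma> {x j, x (Suc j)}) *\<^sub>R sgn (\<V> $ x k)"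
      using nontransverse_chain_aligned[OF lk ch \<V> nt ne \<open>j < k\<close>] by blast
    have "\<phi>0 $ x (Suc j) - \<phi>0 $ x j = R (\<V> $ x (Suc j) - \<V> $ x j)"
      by (simp add: \<phi>0_def linear_diff[OF lin])
    also have "\<dots> = (\<epsilon> * len \<Gamma> {x j, x (Suc j)}) *\<^sub>R e"
      unfolding \<epsilon>(2) linear_scale[OF lin] Rs ..
    finally show ?thesis using \<epsilon>(1) by blast
  qed
  obtain T :: "(('a ^ 'v) \<times> ('a ^ 'v)) set" and H and s :: nat and b \<sigma> N0 K F P where
    T: "subspace T" and bil: "bilinear H" and sym: "\<forall>u v. H u v = H v u"
    and b: "\<forall>i<s. b i \<in> T \<and> (\<sigma> i = 1 \<or> \<sigma> i = (-1::real))"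
    and Hb: "\<forall>i<s. \<forall>j<s. H (b i) (b j) = (if i = j then \<sigma> i else 0)"
    and exp: "\<forall>z\<in>T. z = (\<Sum>i<s. (\<sigma> i * H z (b i)) *\<^sub>R b i)"
    and N0: "openin (top_of_set ?R) N0" "\<phi>0 \<in> N0"
    and K: "openin (top_of_set {z \<in> T. H z z = 0}) K" and FP: "homeomorphism N0 K F P" and F0: "F \<phi>0 = 0"
    by (rule reduced_config_space_cone_chart[OF lk ch e \<phi>0 al nd'])
  have b': "\<And>i. i < s \<Longrightarrow> b i \<in> T" and \<sigma>: "\<And>i. i < s \<Longrightarrow> \<sigma> i = 1 \<or> \<sigma> i = -1"
    and Hb': "\<And>i j. i < s \<Longrightarrow> j < s \<Longrightarrow> H (b i) (b j) = (if i = j then \<sigma> i else 0)"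
    and exp': "\<And>z. z \<in> T \<Longrightarrow> z = (\<Sum>i<s. (\<sigma> i * H z (b i)) *\<^sub>R b i)"
    and sym': "\<And>u v. H u v = H v u"
    using b Hb exp sym by blast+
  have K0: "0 \<in> K" using FP F0 N0(2) unfolding homeomorphism_def by (metis imageI)
  let ?S = "sphere 0 1 - {- e}"
  obtain N1 A B where N1: "openin (top_of_set ?C) N1" "\<V> \<in> N1"
    and AB: "homeomorphism N1 (?S \<times> ?R) A B" and AV: "A \<V> = (e, \<phi>0)"
    unfolding \<phi>0_def by (rule pointed_config_space_direction_splitting[OF R e \<V> ne RV])
  define E where "E = {z :: 'a. inner e z = 0}"
  have E: "subspace E" unfolding E_def by (rule subspace_hyperplane)
  have "?S homeomorphic E"
    unfolding E_def by (rule homeomorphic_punctured_sphere_hyperplane) (use e in auto)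
  then obtain p q where pq: "homeomorphism ?S E p q" by (auto simp: homeomorphic_def)
  have eS: "e \<in> ?S"
  proof -
    have "e \<noteq> - e"
    proof
      assume "e = - e"
      then have "2 *\<^sub>R e = 0" by (metis add.right_inverse scaleR_2)
      then show False using e by simp
    qed
    then show ?thesis using e by simp
  qed
  have pe: "p e \<in> E" using pq eS by (auto simp: homeomorphism_def)
  define N where "N = B ` (?S \<times> N0)"
  have N0R: "N0 \<subseteq> ?R" using N0(1) openin_imp_subset by blast
  have "openin (top_of_set (?S \<times> ?R)) (?S \<times> N0)" using N0(1) by (intro openin_Times) auto
  then have "openin (top_of_set N1) N"
    unfolding N_def by (rule homeomorphism_imp_open_map[OF homeomorphism_symD[OF AB]])
  then have N: "openin (top_of_set ?C) N" using N1(1) openin_trans by blast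
  then have NC: "N \<subseteq> ?C" by (rule openin_imp_subset)
  have "homeomorphism (?S \<times> N0) N B A"
    by (rule homeomorphism_of_subsets[OF homeomorphism_symD[OF AB]])
       (use N0R AB in \<open>auto simp: N_def homeomorphism_def\<close>)
  note hA = homeomorphism_symD[OF this]
  have \<V>N: "\<V> \<in> N"
  proof -
    have "B (e, \<phi>0) = \<V>" using AB N1(2) AV unfolding homeomorphism_def by metis
    then show ?thesis unfolding N_def using eS N0(2) by force
  qed
  \<comment> \<open>stereographic projection may send \<open>e\<close> to any point of \<open>E\<close>; a translation moves it to \<open>0\<close>\<close>
  have hpF: "homeomorphism (?S \<times> N0) (E \<times> K)
      (\<lambda>z. (((\<lambda>z. z - p e) \<circ> p) (fst z), F (snd z))) (\<lambda>z. ((q \<circ> (\<lambda>z. z + p e)) (fst z), P (snd z)))"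
    by (rule homeomorphism_Times[OF homeomorphism_compose[OF pq homeomorphism_subspace_translation[OF E pe]] FP])
  obtain f g where fg: "homeomorphism N (E \<times> K) f g" and f\<V>: "f \<V> = (0, 0)"
    using homeomorphism_compose[OF hA hpF] AV F0 by force
  have sub: "subtopology (top_of_set ?C) N = top_of_set N"
    using NC by (simp add: subtopology_subtopology inf.absorb2)
  have "locally_euclidean_times_quadratic_cone (top_of_set ?C) \<V>"
  proof -
    obtain s' c K' \<kappa> where c: "nonzero_coefficients s' c" "openin (quadratic_cone s' c) K'" "(\<lambda>_. 0) \<in> K'"
      and \<kappa>: "homeomorphic_map (top_of_set K) (subtopology (quadratic_cone s' c) K') \<kappa>" "\<kappa> 0 = (\<lambda>_. 0)"
      by (rule cone_homeomorphic_quadratic_cone[OF T bil b' \<sigma> Hb' exp' K K0])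
    obtain h where h: "homeomorphic_map (top_of_set E) (Euclidean_space (dim E)) h"
      using subspace_homeomorphic_Euclidean_space[OF E] homeomorphic_space by blast
    obtain h' \<kappa>' where "homeomorphic_maps (top_of_set E) (Euclidean_space (dim E)) h h'"
      "homeomorphic_maps (top_of_set K) (subtopology (quadratic_cone s' c) K') \<kappa> \<kappa>'"
      using h \<kappa>(1) homeomorphic_map_maps by metis
    then have "homeomorphic_maps (prod_topology (top_of_set E) (top_of_set K))
        (prod_topology (Euclidean_space (dim E)) (subtopology (quadratic_cone s' c) K'))
        (\<lambda>(a, y). (h a, \<kappa> y)) (\<lambda>(a, y). (h' a, \<kappa>' y))"
      unfolding homeomorphic_maps_prod by blast
    then have m2: "homeomorphic_map (top_of_set (E \<times> K))
        (prod_topology (Euclidean_space (dim E)) (subtopology (quadratic_cone s' c) K')) (\<lambda>(a, y). (h a, \<kappa> y))"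
      using homeomorphic_map_maps by (metis prod_topology_subtopology_eu)
    have "homeomorphic_map (top_of_set N) (top_of_set (E \<times> K)) f"
      using fg homeomorphic_map_maps unfolding homeomorphism_iff_homeomorphic_maps by blast
    then have m: "homeomorphic_map (subtopology (top_of_set ?C) N)
        (prod_topology (Euclidean_space (dim E)) (subtopology (quadratic_cone s' c) K')) ((\<lambda>(a, y). (h a, \<kappa> y)) \<circ> f)"
      unfolding sub using m2 by (rule homeomorphic_map_compose)
    have "snd (((\<lambda>(a, y). (h a, \<kappa> y)) \<circ> f) \<V>) = (\<lambda>_. 0)" by (simp add: f\<V> \<kappa>(2))
    then show ?thesis
      unfolding locally_euclidean_times_quadratic_cone_def using N \<V>N c m by blast
  qed
  moreover have "topological_singularity (top_of_set ?C) \<V>"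
    if ni: "\<not> isolated_in_reduced_space \<Gamma> (x 0) (x k) e \<V>"
  proof (cases "\<exists>i<s. \<exists>j<s. \<sigma> i = 1 \<and> \<sigma> j = -1")
    case True
    then obtain i0 j0 where ij: "i0 < s" "\<sigma> i0 = 1" "j0 < s" "\<sigma> j0 = -1" by blast
    show ?thesis
    proof (rule topological_singularityI[OF \<V>])
      fix G :: "('a ^ 'v) set" and O' V h k'
      assume G: "subspace G" and O': "openin (top_of_set ?C) O'" "\<V> \<in> O'" and V: "openin (top_of_set G) V"
        and hk: "homeomorphism O' V h k'"
      have "openin (top_of_set ?C) (N \<inter> O')" using N O'(1) by (rule openin_Int)
      then have o1: "openin (top_of_set N) (N \<inter> O')" and o2: "openin (top_of_set O') (N \<inter> O')"
        using NC openin_imp_subset[OF O'(1)] by (auto elim: openin_subset_trans)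
      have o3: "openin (top_of_set (E \<times> K)) (f ` (N \<inter> O'))" by (rule homeomorphism_imp_open_map[OF fg o1])
      have "openin (top_of_set (E \<times> {z \<in> T. H z z = 0})) (E \<times> K)"
        using K by (intro openin_Times) auto
      with o3 have o4: "openin (top_of_set (E \<times> {z \<in> T. H z z = 0})) (f ` (N \<inter> O'))"
        using openin_trans by blast
      have o5: "openin (top_of_set G) (h ` (N \<inter> O'))"
        using homeomorphism_imp_open_map[OF hk o2] V openin_trans by blast
      have i1: "homeomorphism (N \<inter> O') (f ` (N \<inter> O')) f g"
        by (rule homeomorphism_of_subsets[OF fg]) (use fg in \<open>auto simp: homeomorphism_def\<close>)
      have i2: "homeomorphism (N \<inter> O') (h ` (N \<inter> O')) h k'"
        by (rule homeomorphism_of_subsets[OF hk]) (use hk in \<open>auto simp: homeomorphism_def\<close>)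
      have i3: "homeomorphism (f ` (N \<inter> O')) (h ` (N \<inter> O')) (h \<circ> g) (f \<circ> k')"
        by (rule homeomorphism_compose[OF homeomorphism_symD[OF i1] i2])
      have z: "(0, 0) \<in> f ` (N \<inter> O')" using f\<V> \<V>N O'(2) by (metis IntI imageI)
      show False
        by (rule indefinite_cone_not_locally_euclidean[OF E bil sym' T b' \<sigma> Hb' exp' ij o4 z G o5 i3])
    qed
  next
    case False
    then obtain c :: real where "c = 1 \<or> c = -1" "\<And>i. i < s \<Longrightarrow> \<sigma> i = c" using \<sigma> by metis
    then have triv: "{z \<in> T. H z z = 0} \<subseteq> {0}"
      using definite_cone_trivial[OF bil exp'] by blast
    then have "K \<subseteq> {0}" using openin_imp_subset[OF K] by blast
    moreover have "F y \<in> K" "P (F y) = y" if "y \<in> N0" for y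
      using FP that by (auto simp: homeomorphism_def)
    ultimately have "N0 \<subseteq> {P 0}" by (metis singletonD singletonI subsetD subsetI)
    then have N0s: "N0 = {\<phi>0}" using N0(2) by blast
    have "\<not> \<phi>0 islimpt ?R"
    proof
      assume lim: "\<phi>0 islimpt ?R"
      obtain U where U: "open U" "N0 = ?R \<inter> U" using N0(1) unfolding openin_open by blast
      then have "\<phi>0 \<in> U" using N0(2) by blast
      then obtain y where "y \<in> ?R" "y \<in> U" "y \<noteq> \<phi>0" using lim U(1) unfolding islimpt_def by blast
      then show False using U(2) N0s by blast
    qed
    moreover have "is_reduced_coordinate (x 0) (x k) e \<V> \<phi>0"
      unfolding is_reduced_coordinate_def \<phi>0_def using R RV \<V>0 by auto
    ultimately have "isolated_in_reduced_space \<Gamma> (x 0) (x k) e \<V>"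
      unfolding isolated_in_reduced_space_def by blast
    then show ?thesis using ni by blast
  qed
  ultimately show ?thesis by blast
qed

end
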